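(* For $p\in[3,\frac{10}{3}]$ and $c>0$ let $F$, $S(c)$ and $m(c)=\inf_{u\in S(c)}F(u)\in[-\infty,\infty)$ be as defined in the context (they depend on $p$). (I) Let $p\in(3,\frac{10}{3})$ and put $c_1=\inf\{c>0 : m(c)<0\}$. Then: (i) $c_1\in(0,\infty)$; (ii) $m(c)=0$ for every $c\in(0,c_1]$; (iii) $m(c)<0$ for every $c\in(c_1,\infty)$, and $c\mapsto m(c)$ is strictly decreasing on $(c_1,\infty)$. (II) (iv) If $p=3$, then $m(c)=0$ for all $c>0$. (v) If $p=\frac{10}{3}$, put $c_2=\inf\{c>0 : \exists\, u\in S(c)\text{ such that }F(u)\le 0\}$. Then $c_2\in(0,\infty)$, $m(c)=0$ for every $c\in(0,c_2)$, and $m(c)=-\infty$ for every $c\in(c_2,\infty)$.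
   Context: For $p\in(2,6)$ and $u\in H^1(\mathbb{R}^3)$ define $$F(u)=\frac12\int_{\mathbb{R}^3}|\nabla u|^2dx+\frac14\int_{\mathbb{R}^3}\int_{\mathbb{R}^3}\frac{|u(x)|^2|u(y)|^2}{|x-y|}dxdy-\frac1p\int_{\mathbb{R}^3}|u|^pdx.$$ For $c>0$ let $S(c)=\{u\in H^1(\mathbb{R}^3):\int_{\mathbb{R}^3}|u|^2dx=c\}$ and $m(c)=\inf_{u\in S(c)}F(u)$. *)

theory Defs
  imports "HOL-Analysis.Analysis"
begin

definition pderiv_at :: "3 \<Rightarrow> (real^3 \<Rightarrow> real) \<Rightarrow> real^3 \<Rightarrow> real" where
  "pderiv_at i f x = frechet_derivative f (at x) (axis i 1)"

fun k_smooth :: "nat \<Rightarrow> (real^3 \<Rightarrow> real) \<Rightarrow> bool" where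
  "k_smooth 0 f \<longleftrightarrow> continuous_on UNIV f"
| "k_smooth (Suc k) f \<longleftrightarrow>
     (\<forall>x. f differentiable (at x)) \<and> (\<forall>i. k_smooth k (pderiv_at i f))"

definition test_function :: "(real^3 \<Rightarrow> real) \<Rightarrow> bool" where
  "test_function \<phi> \<longleftrightarrow> (\<forall>k. k_smooth k \<phi>) \<and> compact (closure {x. \<phi> x \<noteq> 0})"

text \<open>
  Elements of Lebesgue and Sobolev spaces are represented by real-valued Borel functions; almost
  everywhere equal functions are not identified. Every almost everywhere class of Lebesgue
  measurable functions has a Borel representative, and everything below depends only on the class.
\<close>

definition locally_integrable :: "(real^3 \<Rightarrow> 'b::euclidean_space) \<Rightarrow> bool" where
  "locally_integrable f \<longleftrightarrow>
     f \<in> borel_measurable lborel \<and> (\<forall>K. compact K \<longrightarrow> set_integrable lborel K f)"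

definition square_integrable :: "(real^3 \<Rightarrow> 'b::euclidean_space) \<Rightarrow> bool" where
  "square_integrable f \<longleftrightarrow>
     f \<in> borel_measurable lborel \<and> integrable lborel (\<lambda>x. (norm (f x))\<^sup>2)"

definition has_weak_gradient :: "(real^3 \<Rightarrow> real) \<Rightarrow> (real^3 \<Rightarrow> real^3) \<Rightarrow> bool" where
  "has_weak_gradient u g \<longleftrightarrow>
     locally_integrable u \<and> locally_integrable g \<and>
     (\<forall>\<phi> i. test_function \<phi> \<longrightarrow>
        (LINT x|lborel. u x * pderiv_at i \<phi> x) = - (LINT x|lborel. g x $ i * \<phi> x))"

text \<open>The weak gradient is unique up to a null set, so the choice below is immaterial.\<close>

definition weak_gradient :: "(real^3 \<Rightarrow> real) \<Rightarrow> real^3 \<Rightarrow> real^3" where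
  "weak_gradient u = (SOME g. has_weak_gradient u g)"

definition H1 :: "(real^3 \<Rightarrow> real) set" where
  "H1 = {u. square_integrable u \<and> (\<exists>g. has_weak_gradient u g \<and> square_integrable g)}"

text \<open>
  For \<open>u \<in> H1\<close> and \<open>2 < p < 6\<close> the three integrals converge (Hardy-Littlewood-Sobolev and Sobolev
  inequalities), so the convention that a divergent integral is 0 plays no role; nor does the value
  of the Coulomb kernel on the diagonal, which is a null set.
\<close>

definition energy :: "real \<Rightarrow> (real^3 \<Rightarrow> real) \<Rightarrow> real" where
  "energy p u =
     1/2 * (LINT x|lborel. (norm (weak_gradient u x))\<^sup>2)
   + 1/4 * (LINT x|lborel. (LINT y|lborel. \<bar>u x\<bar>\<^sup>2 * \<bar>u y\<bar>\<^sup>2 / norm (x - y)))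
   - 1/p * (LINT x|lborel. \<bar>u x\<bar> powr p)"

definition mass_sphere :: "real \<Rightarrow> (real^3 \<Rightarrow> real) set" where
  "mass_sphere c = {u \<in> H1. (LINT x|lborel. \<bar>u x\<bar>\<^sup>2) = c}"

definition min_energy :: "real \<Rightarrow> real \<Rightarrow> ereal" where
  "min_energy p c = (INF u\<in>mass_sphere c. ereal (energy p u))"

text \<open>The thresholds are infima in \<^typ>\<open>ereal\<close>, so that the infimum of the empty set is \<open>\<infinity>\<close>.\<close>

definition threshold_neg :: "real \<Rightarrow> ereal" where
  "threshold_neg p = Inf (ereal ` {c. 0 < c \<and> min_energy p c < 0})"

definition threshold_nonpos :: "real \<Rightarrow> ereal" where
  "threshold_nonpos p = Inf (ereal ` {c. 0 < c \<and> (\<exists>u\<in>mass_sphere c. energy p u \<le> 0)})"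

end

theory Submission
  imports Defs
begin

text \<open>
  Averaging \<open>\<integral> u (\<phi> - \<phi>(\<cdot> - v)) = - \<integral>\<^sub>0\<^sup>1 \<integral> g(x) \<bullet> v \<phi>(x - s v) dx ds\<close>, where \<open>g\<close> is the weak gradient of
  \<open>u\<close>, over \<open>v\<close> in a ball of radius \<open>S\<close> and letting \<open>S \<rightarrow> \<infinity>\<close> gives
  \<open>4 \<pi> |u| \<le> \<integral> |g(x)| |x - y|\<^sup>-\<^sup>2 dx\<close> almost everywhere. Since the kernel \<open>|x|\<^sup>-\<^sup>2\<close> convolved with itself is
  at most a multiple of \<open>1/|x|\<close>, this yields for every \<open>w \<ge> 0\<close> and \<open>l > 0\<close> a bound of
  \<open>8 \<pi> \<integral> |u| w\<close> by \<open>l \<parallel>g\<parallel>\<^sup>2\<close> plus a multiple of \<open>1/l\<close> times the Coulomb energy of \<open>w\<close>.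
  The choice \<open>w = u\<^sup>2\<close> bounds \<open>\<integral> |u|\<^sup>3\<close> by the two positive terms of the energy, which settles \<open>p = 3\<close>; the
  choice \<open>w = |u|\<^sup>7\<^sup>/\<^sup>3\<close> gives the Gagliardo--Nirenberg inequality at the exponent \<open>10/3\<close>. By interpolation
  both bounds make the energy nonnegative at small mass. The rest is scaling: \<open>\<theta>\<^sup>2 u(\<theta> x)\<close> has mass \<open>\<theta> c\<close>,
  and it multiplies the positive part of the energy by \<open>\<theta>\<^sup>3\<close> and the negative one by \<open>\<theta>\<^sup>2\<^sup>p\<^sup>-\<^sup>3\<close>;
  \<open>t\<^sup>3\<^sup>/\<^sup>2 u(t x)\<close> has the mass of \<open>u\<close>.
\<close>

section \<open>Smooth functions and test functions\<close>

text \<open>Up to constants, |x|^-2 is the kernel of the Riesz potential of order one in dimension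
  three and the Coulomb kernel that of order two, so the square of the potential of w integrates to
  a Coulomb energy. The bound on |u| is proved against test functions, with the derivative on the
  test function; Sobolev functions are never approximated by smooth ones. Letting the radius grow
  relies on u being in L^2: for a nonzero constant u the bound fails. At the exponent 10/3 the
  Coulomb energy of |u|^(7/3) is itself controlled, quadratically, by the integral X of |u|^(10/3).
  The choice l = X + 1 makes the estimate linear in X with a small enough coefficient, so that X can
  be absorbed. The scalings single out the two end exponents. Under the first one, with \<theta> >
  1, the negative term gains on the positive ones exactly if p > 3. Under the second one the
  gradient term and the |u|^p term scale alike exactly if p = 10/3. The mass c_1 itself has minimal
  energy 0 because negative energy survives a slight decrease of the mass.\<close>

lemma pderiv_at_eqI:
  assumes "(f has_derivative f') (at x)"
  shows "pderiv_at i f x = f' (axis i 1)"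
  using frechet_derivative_at[OF assms] by (simp add: pderiv_at_def)

lemma k_smooth_continuous: "k_smooth k f \<Longrightarrow> continuous_on UNIV f"
  by (cases k) (auto simp: continuous_on_eq_continuous_within intro: differentiable_imp_continuous_within)

lemma k_smooth_SucD: "k_smooth (Suc k) f \<Longrightarrow> k_smooth k f"
proof (induction k arbitrary: f)
  case 0
  then show ?case using k_smooth_continuous k_smooth.simps(1) by blast
next
  case (Suc k)
  then show ?case by (metis k_smooth.simps(2))
qed

lemma k_smooth_const: "k_smooth k (\<lambda>x. c)"
proof (induction k arbitrary: c)
  case (Suc k)
  have "pderiv_at i (\<lambda>x. c) = (\<lambda>x. 0)" for i
    by (rule ext) (simp add: pderiv_at_eqI[OF has_derivative_const])
  then show ?case using Suc by simp
qed simp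

lemma pderiv_at_add:
  assumes "f differentiable (at x)" "g differentiable (at x)"
  shows "pderiv_at i (\<lambda>x. f x + g x) x = pderiv_at i f x + pderiv_at i g x"
  using pderiv_at_eqI[OF has_derivative_add[OF assms[unfolded frechet_derivative_works]]]
  by (simp add: pderiv_at_def)

lemma pderiv_at_mult:
  assumes "f differentiable (at x)" "g differentiable (at x)"
  shows "pderiv_at i (\<lambda>x. f x * g x) x = f x * pderiv_at i g x + pderiv_at i f x * g x"
  using pderiv_at_eqI[OF has_derivative_mult[OF assms[unfolded frechet_derivative_works]]]
  by (simp add: pderiv_at_def)

lemma pderiv_at_affine:
  assumes "f differentiable (at (c *\<^sub>R x + d))"
  shows "pderiv_at i (\<lambda>x. f (c *\<^sub>R x + d)) x = c * pderiv_at i f (c *\<^sub>R x + d)"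
proof -
  let ?D = "frechet_derivative f (at (c *\<^sub>R x + d))"
  have D: "(f has_derivative ?D) (at (c *\<^sub>R x + d))"
    using assms frechet_derivative_works by blast
  have "((\<lambda>x. f (c *\<^sub>R x + d)) has_derivative (\<lambda>h. ?D (c *\<^sub>R h))) (at x)"
    by (rule has_derivative_compose[of "\<lambda>x. c *\<^sub>R x + d", OF _ D])
       (auto intro!: derivative_eq_intros)
  from pderiv_at_eqI[OF this] show ?thesis
    using linear_cmul[OF has_derivative_linear[OF D]] by (simp add: pderiv_at_def)
qed

lemma k_smooth_add: "k_smooth k f \<Longrightarrow> k_smooth k g \<Longrightarrow> k_smooth k (\<lambda>x. f x + g x)"
proof (induction k arbitrary: f g)
  case (Suc k)
  then have "pderiv_at i (\<lambda>x. f x + g x) = (\<lambda>x. pderiv_at i f x + pderiv_at i g x)" for i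
    by (intro ext pderiv_at_add) auto
  then show ?case using Suc by auto
qed (auto intro: continuous_intros)

lemma k_smooth_mult: "k_smooth k f \<Longrightarrow> k_smooth k g \<Longrightarrow> k_smooth k (\<lambda>x. f x * g x)"
proof (induction k arbitrary: f g)
  case (Suc k)
  then have "pderiv_at i (\<lambda>x. f x * g x) =
      (\<lambda>x. f x * pderiv_at i g x + pderiv_at i f x * g x)" for i
    by (intro ext pderiv_at_mult) auto
  moreover have "k_smooth k f" "k_smooth k g" using Suc.prems k_smooth_SucD by blast+
  ultimately show ?case using Suc by (auto intro!: k_smooth_add)
qed (auto intro: continuous_intros)

lemma k_smooth_affine: "k_smooth k f \<Longrightarrow> k_smooth k (\<lambda>x. f (c *\<^sub>R x + d))"
proof (induction k arbitrary: f)
  case 0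
  then show ?case by (auto intro!: continuous_on_compose2[of UNIV f] continuous_intros)
next
  case (Suc k)
  have "pderiv_at i (\<lambda>x. f (c *\<^sub>R x + d)) = (\<lambda>x. c * pderiv_at i f (c *\<^sub>R x + d))" for i
    using Suc.prems by (intro ext pderiv_at_affine) auto
  moreover have "f \<circ> (\<lambda>x. c *\<^sub>R x + d) differentiable (at x)" for x
    using Suc.prems by (intro differentiable_chain_at) auto
  ultimately show ?case using Suc by (auto simp: o_def intro!: k_smooth_mult k_smooth_const)
qed

lemma k_smooth_prod: "(\<And>i. i \<in> I \<Longrightarrow> k_smooth k (f i)) \<Longrightarrow> k_smooth k (\<lambda>x. \<Prod>i\<in>I. f i x)"
  by (induction I rule: infinite_finite_induct) (auto intro: k_smooth_const k_smooth_mult)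

lemma k_smooth_power: "k_smooth k f \<Longrightarrow> k_smooth k (\<lambda>x. f x ^ n)"
  by (induction n) (auto intro: k_smooth_const k_smooth_mult)

lemma k_smooth_diff: "k_smooth k f \<Longrightarrow> k_smooth k g \<Longrightarrow> k_smooth k (\<lambda>x. f x - g x)"
  using k_smooth_add[of k f "\<lambda>x. (-1) * g x"] k_smooth_mult[OF k_smooth_const, of k g "-1"] by simp

section \<open>Closure properties of test functions\<close>

lemma test_function_iff:
  "test_function \<phi> \<longleftrightarrow> (\<forall>k. k_smooth k \<phi>) \<and> bounded {x. \<phi> x \<noteq> 0}"
  by (simp add: test_function_def compact_closure)

lemma test_function_continuous: "test_function \<phi> \<Longrightarrow> continuous_on UNIV \<phi>"
  by (auto simp: test_function_iff intro: k_smooth_continuous)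

lemma test_function_differentiable: "test_function \<phi> \<Longrightarrow> \<phi> differentiable (at x)"
  unfolding test_function_iff using k_smooth.simps(2) by blast

lemma test_function_borel [measurable_dest]: "test_function \<phi> \<Longrightarrow> \<phi> \<in> borel_measurable borel"
  using test_function_continuous borel_measurable_continuous_onI by blast

lemma test_function_mult:
  "test_function \<phi> \<Longrightarrow> test_function \<psi> \<Longrightarrow> test_function (\<lambda>x. \<phi> x * \<psi> x)"
  by (auto simp: test_function_iff intro!: k_smooth_mult elim: bounded_subset)

lemma test_function_cmult: "test_function \<phi> \<Longrightarrow> test_function (\<lambda>x. c * \<phi> x)"
  by (auto simp: test_function_iff intro!: k_smooth_mult k_smooth_const elim: bounded_subset)

lemma test_function_affine:
  assumes "test_function \<phi>" "c \<noteq> 0"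
  shows "test_function (\<lambda>x. \<phi> (c *\<^sub>R x + d))"
proof -
  have "{x. \<phi> (c *\<^sub>R x + d) \<noteq> 0} \<subseteq> (\<lambda>y. - ((1/c) *\<^sub>R d) + (1/c) *\<^sub>R y) ` {x. \<phi> x \<noteq> 0}"
  proof
    fix x assume "x \<in> {x. \<phi> (c *\<^sub>R x + d) \<noteq> 0}"
    moreover have "x = - ((1/c) *\<^sub>R d) + (1/c) *\<^sub>R (c *\<^sub>R x + d)"
      using assms(2) by (simp add: algebra_simps)
    ultimately show "x \<in> (\<lambda>y. - ((1/c) *\<^sub>R d) + (1/c) *\<^sub>R y) ` {x. \<phi> x \<noteq> 0}" by blast
  qed
  moreover have "bounded ((\<lambda>y. - ((1/c) *\<^sub>R d) + (1/c) *\<^sub>R y) ` {x. \<phi> x \<noteq> 0})"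
    using assms bounded_translation[OF bounded_scaling, of "{x. \<phi> x \<noteq> 0}" "-((1/c) *\<^sub>R d)" "1/c"]
    by (simp add: test_function_iff image_image)
  ultimately show ?thesis using assms
    by (auto simp: test_function_iff intro!: k_smooth_affine intro: bounded_subset)
qed

lemma test_function_pderiv:
  assumes "test_function \<phi>"
  shows "test_function (pderiv_at i \<phi>)"
proof -
  \<comment> \<open>The closure matters: at a zero of \<phi> the derivative may be nonzero, but
    \<phi> vanishes near every point outside the closure.\<close>
  have "pderiv_at i \<phi> x = 0" if "x \<notin> closure {x. \<phi> x \<noteq> 0}" for x
  proof -
    have "(\<phi> has_derivative (\<lambda>h. 0)) (at x)"
    proof (rule has_derivative_transform_within_open)
      show "((\<lambda>x. 0) has_derivative (\<lambda>h. 0)) (at x)" by simp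
      show "open (- closure {x. \<phi> x \<noteq> 0})" by (intro open_Compl closed_closure)
      show "0 = \<phi> y" if "y \<in> - closure {x. \<phi> x \<noteq> 0}" for y
        using that subsetD[OF closure_subset, of y "{x. \<phi> x \<noteq> 0}"] by (metis (mono_tags, lifting) ComplD mem_Collect_eq)
    qed (use that in simp)
    from pderiv_at_eqI[OF this] show ?thesis .
  qed
  then have "{x. pderiv_at i \<phi> x \<noteq> 0} \<subseteq> closure {x. \<phi> x \<noteq> 0}" by blast
  moreover have "bounded (closure {x. \<phi> x \<noteq> 0})"
    using assms compact_imp_bounded unfolding test_function_def by blast
  ultimately show ?thesis using assms
    by (metis bounded_subset test_function_iff k_smooth.simps(2))
qed

lemma test_function_bounded:
  assumes "test_function \<phi>"
  obtains M where "M > 0" "\<And>x. \<bar>\<phi> x\<bar> \<le> M"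
proof -
  have "compact (\<phi> ` closure {x. \<phi> x \<noteq> 0})"
    using assms test_function_def test_function_continuous
    by (metis compact_continuous_image continuous_on_subset subset_UNIV)
  then obtain M where "M > 0" and M: "\<And>x. x \<in> closure {x. \<phi> x \<noteq> 0} \<Longrightarrow> \<bar>\<phi> x\<bar> \<le> M"
    using compact_imp_bounded bounded_pos by (metis image_eqI real_norm_def)
  moreover have "\<bar>\<phi> x\<bar> \<le> M" for x
    using M[of x] closure_subset[of "{x. \<phi> x \<noteq> 0}"] \<open>M > 0\<close> by (cases "\<phi> x = 0") auto
  ultimately show ?thesis using that by blast
qed

section \<open>An explicit smooth bump function\<close>

definition exp_germ :: "nat \<Rightarrow> real \<Rightarrow> real" where
  "exp_germ n t = (if t > 0 then exp (- (1/t)) / t ^ n else 0)"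

text \<open>The term of index n + 2 of the exponential series bounds exp (1/t) from below. The
  factor t^2 that is left over makes the difference quotient at 0 tend to 0.\<close>

lemma exp_germ_le: "\<bar>exp_germ n t\<bar> \<le> fact (n + 2) * t\<^sup>2"
proof (cases "t > 0")
  case True
  define N where "N = n + 2"
  have "(\<Sum>k\<in>{N}. (1/t)^k /\<^sub>R fact k) \<le> (\<Sum>k. (1/t)^k /\<^sub>R fact k)"
    using True by (intro sum_le_suminf summable_exp_generic) (auto simp del: power_divide)
  then have "1 / (t ^ N * fact N) \<le> exp (1/t)"
    by (simp add: exp_def divide_inverse mult.commute power_inverse)
  then have "exp (- (1/t)) \<le> fact N * t ^ N"
    using True by (simp add: exp_minus field_simps)
  then show ?thesis using True by (simp add: exp_germ_def field_simps power_add N_def power2_eq_square mult_ac del: fact_Suc fact_2)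
qed (simp add: exp_germ_def)

text \<open>The inverse powers in \<open>exp_germ\<close> make the family closed under
  differentiation; smoothness of every member then follows by one induction over the order, with
  \<open>n\<close> arbitrary.\<close>

lemma DERIV_exp_germ:
  "(exp_germ n has_real_derivative (exp_germ (n+2) t - n * exp_germ (n+1) t)) (at t)"
proof -
  consider "t > 0" | "t < 0" | "t = 0" by linarith
  then show ?thesis
  proof cases
    case 1
    have "((\<lambda>t. exp (- (1/t)) * inverse (t ^ n)) has_real_derivative
        (exp (- (1/t)) * (1/t\<^sup>2) * inverse (t ^ n)
          - exp (- (1/t)) * (n * t ^ (n - Suc 0) * (inverse (t ^ n))\<^sup>2))) (at t)"
      using 1 by (auto intro!: derivative_eq_intros simp: power2_eq_square)
    moreover have "n * t ^ (n - Suc 0) * (inverse (t ^ n))\<^sup>2 = n / t ^ (n + 1)"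
      using 1 by (cases n) (simp_all add: power2_eq_square divide_inverse)
    moreover have "exp (- (1/t)) * (1/t\<^sup>2) * inverse (t ^ n) = exp_germ (n+2) t"
      using 1 by (simp add: exp_germ_def divide_inverse power_add power2_eq_square)
    ultimately have *: "((\<lambda>t. exp (- (1/t)) * inverse (t ^ n)) has_real_derivative
        (exp_germ (n+2) t - n * exp_germ (n+1) t)) (at t)"
      using 1 by (simp add: exp_germ_def mult.commute)
    show ?thesis
      by (rule DERIV_cong_ev[THEN iffD1, OF refl _ refl *])
         (use 1 eventually_nhds_in_open[of "{0<..}" t] in
           \<open>auto simp: exp_germ_def divide_inverse elim!: eventually_mono\<close>)
  next
    case 2
    have "\<forall>\<^sub>F x in nhds t. 0 = exp_germ n x"
      using 2 eventually_nhds_in_open[of "{..<0}" t]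
      by (auto simp: exp_germ_def elim!: eventually_mono)
    moreover have "((\<lambda>t. 0) has_real_derivative 0) (at t)" by simp
    ultimately have "(exp_germ n has_real_derivative 0) (at t)"
      using DERIV_cong_ev[OF refl _ refl, of "\<lambda>_. 0" "exp_germ n" t] by blast
    then show ?thesis using 2 by (simp add: exp_germ_def)
  next
    case 3
    have "((\<lambda>h. (exp_germ n (0 + h) - exp_germ n 0) / h) \<longlongrightarrow> 0) (at 0)"
    proof (rule Lim_null_comparison)
      show "\<forall>\<^sub>F h in at 0. norm ((exp_germ n (0 + h) - exp_germ n 0) / h) \<le> fact (n+2) * \<bar>h\<bar>"
      proof (rule eventually_at_filter[THEN iffD2], rule always_eventually, intro allI impI)
        fix h :: real assume "h \<noteq> 0"
        then show "norm ((exp_germ n (0 + h) - exp_germ n 0) / h) \<le> fact (n+2) * \<bar>h\<bar>"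
          using exp_germ_le[of n h] exp_germ_le[of n 0]
          by (simp add: divide_le_eq power2_eq_square abs_mult_self_eq mult.assoc del: fact_Suc)
      qed
      show "((\<lambda>h. fact (n+2) * \<bar>h\<bar>) \<longlongrightarrow> (0::real)) (at 0)"
        by (auto intro!: tendsto_eq_intros)
    qed
    then show ?thesis using 3 by (simp add: DERIV_def exp_germ_def)
  qed
qed

lemma k_smooth_exp_germ: "k_smooth k (\<lambda>x. exp_germ n (c * x $ j + d))"
proof (induction k arbitrary: n)
  have D: "((\<lambda>x. exp_germ n (c * x $ j + d)) has_derivative
     (\<lambda>h. (c * h $ j) * (exp_germ (n+2) (c * x $ j + d) - n * exp_germ (n+1) (c * x $ j + d)))) (at x)" for n x
  proof -
    have "((\<lambda>x. c * x $ j + d) has_derivative (\<lambda>h. c * h $ j)) (at x)"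
      by (auto intro!: derivative_eq_intros bounded_linear_imp_has_derivative bounded_linear_vec_nth)
    from has_derivative_compose[OF this DERIV_exp_germ[unfolded has_field_derivative_def]]
    show ?thesis by (simp add: mult_ac)
  qed
  have d: "(\<lambda>x. exp_germ n (c * x $ j + d)) differentiable (at x)" for n x
    using D differentiableI by blast
  {
    case 0
    show ?case
      using d by (auto simp: continuous_on_eq_continuous_within intro: differentiable_imp_continuous_within)
  next
    case (Suc k)
    have "pderiv_at i (\<lambda>x. exp_germ n (c * x $ j + d)) = (\<lambda>x. (c * axis i 1 $ j) *
        (exp_germ (n+2) (c * x $ j + d) - n * exp_germ (n+1) (c * x $ j + d)))" for i
      by (rule ext) (rule pderiv_at_eqI[OF D])
    then show ?case
      using Suc d by (auto intro!: k_smooth_mult k_smooth_const k_smooth_diff simp del: One_nat_def)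
  }
qed

text \<open>Boxes are convenient because products of one-dimensional germs are smooth by the product
  rule and every open set is a countable union of open boxes.\<close>

definition box_bump :: "real^3 \<Rightarrow> real^3 \<Rightarrow> real^3 \<Rightarrow> real" where
  "box_bump a b x = (\<Prod>i\<in>UNIV. exp_germ 0 (x $ i - a $ i) * exp_germ 0 (b $ i - x $ i))"

lemma exp_germ_0: "0 \<le> exp_germ 0 t" "exp_germ 0 t \<le> 1" "exp_germ 0 t > 0 \<longleftrightarrow> t > 0"
  by (auto simp: exp_germ_def)

lemma box_bump_range: "0 \<le> box_bump a b x" "box_bump a b x \<le> 1"
  unfolding box_bump_def
  by (intro prod_nonneg prod_le_1 ballI mult_nonneg_nonneg conjI mult_le_one exp_germ_0)+

lemma box_bump_pos_iff: "box_bump a b x > 0 \<longleftrightarrow> x \<in> box a b"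
proof -
  have "box_bump a b x > 0 \<longleftrightarrow> box_bump a b x \<noteq> 0"
    using box_bump_range(1)[of a b x] by linarith
  also have "\<dots> \<longleftrightarrow> (\<forall>i. exp_germ 0 (x $ i - a $ i) \<noteq> 0 \<and> exp_germ 0 (b $ i - x $ i) \<noteq> 0)"
    by (auto simp: box_bump_def)
  also have "\<dots> \<longleftrightarrow> x \<in> box a b"
    by (auto simp: mem_box_cart exp_germ_def)
  finally show ?thesis .
qed

lemma k_smooth_box_bump: "k_smooth k (box_bump a b)"
proof -
  have "k_smooth k (\<lambda>x. exp_germ 0 (x $ i - a $ i) * exp_germ 0 (b $ i - x $ i))" for i
    using k_smooth_mult[OF k_smooth_exp_germ[of k 0 1 i "- a $ i"] k_smooth_exp_germ[of k 0 "-1" i "b $ i"]]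
    by simp
  then show ?thesis unfolding box_bump_def[abs_def] by (rule k_smooth_prod)
qed

section \<open>The fundamental lemma and uniqueness of weak gradients\<close>

lemma test_function_indicator_bound:
  assumes "test_function \<phi>"
  obtains M r where "M > 0" "\<And>x. \<bar>\<phi> x\<bar> \<le> M * indicator (cball 0 r) x"
proof -
  obtain M where "M > 0" and M: "\<And>x. \<bar>\<phi> x\<bar> \<le> M" using test_function_bounded[OF assms] by blast
  obtain r where r: "\<And>x. \<phi> x \<noteq> 0 \<Longrightarrow> norm x \<le> r"
    using assms by (auto simp: test_function_iff bounded_iff)
  have "\<bar>\<phi> x\<bar> \<le> M * indicator (cball 0 r) x" for x
    using M[of x] r[of x] by (cases "\<phi> x = 0") (auto simp: \<open>M > 0\<close> less_imp_le)
  then show ?thesis using that \<open>M > 0\<close> by blast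
qed

lemma locally_integrable_mult:
  fixes f :: "real^3 \<Rightarrow> 'b::euclidean_space"
  assumes "locally_integrable f" and [measurable]: "h \<in> borel_measurable borel"
    and h: "\<And>x. \<bar>h x\<bar> \<le> M * indicator (cball 0 r) x"
  shows "integrable lborel (\<lambda>x. h x *\<^sub>R f x)"
proof (rule Bochner_Integration.integrable_bound)
  have [measurable]: "f \<in> borel_measurable borel"
    using assms by (simp add: locally_integrable_def)
  have "set_integrable lborel (cball 0 r) f"
    using assms by (simp add: locally_integrable_def)
  then show "integrable lborel (\<lambda>x. M * norm (indicator (cball 0 r) x *\<^sub>R f x))"
    unfolding set_integrable_def by (intro integrable_mult_right integrable_norm)
  show "(\<lambda>x. h x *\<^sub>R f x) \<in> borel_measurable lborel" by measurable
  show "AE x in lborel. norm (h x *\<^sub>R f x) \<le> norm (M * norm (indicator (cball 0 r) x *\<^sub>R f x))"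
  proof (rule AE_I2)
    fix x :: "real^3"
    have "0 \<le> M * indicator (cball 0 r) x" using h[of x] abs_ge_zero order_trans by blast
    moreover have "\<bar>h x\<bar> * norm (f x) \<le> (M * indicator (cball 0 r) x) * norm (f x)"
      by (intro mult_right_mono h norm_ge_zero)
    moreover have "norm (M * norm (indicator (cball 0 r) x *\<^sub>R f x))
        = \<bar>M * indicator (cball 0 r) x\<bar> * norm (f x)"
      by (simp add: abs_mult mult.assoc)
    ultimately show "norm (h x *\<^sub>R f x) \<le> norm (M * norm (indicator (cball 0 r) x *\<^sub>R f x))"
      by simp
  qed
qed

lemma locally_integrable_mult_test:
  fixes f :: "real^3 \<Rightarrow> 'b::euclidean_space"
  assumes "locally_integrable f" "test_function \<phi>"
  shows "integrable lborel (\<lambda>x. \<phi> x *\<^sub>R f x)"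
  using test_function_indicator_bound[OF assms(2)]
    locally_integrable_mult[OF assms(1) test_function_borel[OF assms(2)]] by metis

lemma integrable_mult_test:
  fixes f :: "real^3 \<Rightarrow> real"
  assumes "locally_integrable f" "test_function \<phi>"
  shows "integrable lborel (\<lambda>x. f x * \<phi> x)"
  using locally_integrable_mult_test[OF assms] by (simp add: mult.commute)

text \<open>The product is 1 outside all boxes and tends to 0 on each of them as the exponent grows,
  so these functions approximate the indicator of a union of boxes.\<close>

lemma test_function_union_boxes:
  assumes "\<And>i. i < n \<Longrightarrow> box (a i) (b i) \<subseteq> U" "bounded U"
  shows "test_function (\<lambda>x. 1 - (\<Prod>i<n. (1 - box_bump (a i) (b i) x) ^ m))"
  unfolding test_function_iff
proof (intro conjI allI)
  show "k_smooth k (\<lambda>x. 1 - (\<Prod>i<n. (1 - box_bump (a i) (b i) x) ^ m))" for k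
    by (intro k_smooth_diff k_smooth_const k_smooth_prod k_smooth_power k_smooth_box_bump)
  have "{x. 1 - (\<Prod>i<n. (1 - box_bump (a i) (b i) x) ^ m) \<noteq> 0} \<subseteq> U"
  proof
    fix x assume x: "x \<in> {x. 1 - (\<Prod>i<n. (1 - box_bump (a i) (b i) x) ^ m) \<noteq> 0}"
    have "\<exists>i<n. box_bump (a i) (b i) x \<noteq> 0"
    proof (rule ccontr)
      assume "\<not> ?thesis"
      then have "(\<Prod>i<n. (1 - box_bump (a i) (b i) x) ^ m) = 1" by (intro prod.neutral) auto
      then show False using x by simp
    qed
    then obtain i where "i < n" "box_bump (a i) (b i) x > 0"
      using box_bump_range(1) by (metis less_eq_real_def)
    then show "x \<in> U" using assms(1)[of i] box_bump_pos_iff by blast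
  qed
  then show "bounded {x. 1 - (\<Prod>i<n. (1 - box_bump (a i) (b i) x) ^ m) \<noteq> 0}"
    using assms(2) bounded_subset by blast
qed

text \<open>Test functions with values in [0, 1] that vanish outside U converge pointwise to the
  indicator of U; boundedness of U provides the integrable majorant.\<close>

lemma integral_open_nonneg:
  fixes f :: "real^3 \<Rightarrow> real"
  assumes f: "locally_integrable f"
    and pos: "\<And>\<phi>. test_function \<phi> \<Longrightarrow> (\<And>x. 0 \<le> \<phi> x) \<Longrightarrow> 0 \<le> (LINT x|lborel. f x * \<phi> x)"
    and U: "open U" "bounded U"
  shows "0 \<le> (LINT x|lborel. f x * indicator U x)"
proof (cases "U = {}")
  case False
  have [measurable]: "f \<in> borel_measurable borel" using f by (simp add: locally_integrable_def)
  have [measurable]: "U \<in> sets borel" using U by simp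
  obtain \<D> where \<D>: "countable \<D>" "\<D> \<subseteq> Pow U" "\<And>X. X \<in> \<D> \<Longrightarrow> \<exists>a b. X = box a b" "\<Union>\<D> = U"
    using open_countable_Union_open_box[OF U(1)] by blast
  have ne: "\<D> \<noteq> {}" using \<D>(4) False by auto
  have "\<exists>a b. from_nat_into \<D> i = box a b" for i using \<D>(3) from_nat_into[OF ne] by blast
  then obtain a b where ab: "\<And>i. from_nat_into \<D> i = box (a i) (b i)" by metis
  have sub: "box (a i) (b i) \<subseteq> U" for i using ab from_nat_into[OF ne, of i] \<D>(2) by auto
  \<comment> \<open>One index serves both as the number of boxes and as the exponent, so that a
    single sequence exhausts U.\<close>
  define \<psi> where "\<psi> n x = 1 - (\<Prod>i<n. (1 - box_bump (a i) (b i) x) ^ n)" for n x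
  have test: "test_function (\<psi> n)" for n
    unfolding \<psi>_def by (rule test_function_union_boxes[OF sub U(2)])
  have P: "0 \<le> (\<Prod>i<n. (1 - box_bump (a i) (b i) x) ^ n)" "(\<Prod>i<n. (1 - box_bump (a i) (b i) x) ^ n) \<le> 1" for n x
    by (auto intro!: prod_nonneg prod_le_1 power_le_one simp: box_bump_range)
  have zero: "\<psi> n x = 0" if "x \<notin> U" for n x
  proof -
    have "box_bump (a i) (b i) x = 0" for i
      using that sub[of i] box_bump_pos_iff[of "a i" "b i" x] box_bump_range(1)[of "a i" "b i" x] by auto
    then show ?thesis by (simp add: \<psi>_def)
  qed
  have lim: "(\<lambda>n. \<psi> n x) \<longlonglongrightarrow> indicator U x" for x
  proof (cases "x \<in> U")
    case True
    then obtain X where X: "X \<in> \<D>" "x \<in> X" using \<D>(4) by auto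
    then obtain i0 where "from_nat_into \<D> i0 = X" using from_nat_into_surj[OF \<D>(1)] by blast
    then have b: "box_bump (a i0) (b i0) x > 0" using ab X box_bump_pos_iff by auto
    have "(\<lambda>n. \<Prod>i<n. (1 - box_bump (a i) (b i) x) ^ n) \<longlonglongrightarrow> 0"
    proof (rule Lim_null_comparison)
      show "(\<lambda>n. (1 - box_bump (a i0) (b i0) x) ^ n) \<longlonglongrightarrow> 0"
        using b box_bump_range[of "a i0" "b i0" x] by (intro LIMSEQ_realpow_zero) auto
      show "\<forall>\<^sub>F n in sequentially. norm (\<Prod>i<n. (1 - box_bump (a i) (b i) x) ^ n)
          \<le> (1 - box_bump (a i0) (b i0) x) ^ n"
      proof (rule eventually_sequentiallyI)
        fix n assume n: "Suc i0 \<le> n"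
        have "(\<Prod>i<n. (1 - box_bump (a i) (b i) x) ^ n)
            = (1 - box_bump (a i0) (b i0) x) ^ n * (\<Prod>i\<in>{..<n} - {i0}. (1 - box_bump (a i) (b i) x) ^ n)"
          using n by (subst prod.remove[of _ i0]) auto
        also have "\<dots> \<le> (1 - box_bump (a i0) (b i0) x) ^ n * 1"
          by (intro mult_left_mono prod_le_1) (auto intro!: power_le_one simp: box_bump_range)
        finally show "norm (\<Prod>i<n. (1 - box_bump (a i) (b i) x) ^ n) \<le> (1 - box_bump (a i0) (b i0) x) ^ n"
          using P(1)[of x n] by simp
      qed
    qed
    then have "(\<lambda>n. 1 - (\<Prod>i<n. (1 - box_bump (a i) (b i) x) ^ n)) \<longlonglongrightarrow> 1 - 0"
      by (intro tendsto_intros)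
    then show ?thesis using True by (simp add: \<psi>_def)
  qed (simp add: zero)
  obtain r where r: "U \<subseteq> cball 0 r" using U(2) by (auto simp: bounded_iff subset_iff)
  have "(\<lambda>n. LINT x|lborel. f x * \<psi> n x) \<longlonglongrightarrow> (LINT x|lborel. f x * indicator U x)"
  proof (rule integral_dominated_convergence)
    show "integrable lborel (\<lambda>x. norm (indicator (cball 0 r) x *\<^sub>R f x))"
      using f by (auto simp: locally_integrable_def set_integrable_def)
    show "(\<lambda>x. f x * \<psi> n x) \<in> borel_measurable lborel" for n
      using test_function_borel[OF test] by measurable
    show "(\<lambda>x. f x * indicator U x) \<in> borel_measurable lborel"
      by measurable
    show "AE x in lborel. (\<lambda>n. f x * \<psi> n x) \<longlonglongrightarrow> f x * indicator U x"
      by (intro AE_I2 tendsto_intros lim)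
    show "AE x in lborel. norm (f x * \<psi> n x) \<le> norm (indicator (cball 0 r) x *\<^sub>R f x)" for n
    proof (rule AE_I2)
      fix x
      have "\<bar>\<psi> n x\<bar> \<le> 1" using P[of x n] by (auto simp: \<psi>_def)
      then have "\<bar>f x\<bar> * \<bar>\<psi> n x\<bar> \<le> \<bar>f x\<bar>" by (intro mult_left_le) auto
      then show "norm (f x * \<psi> n x) \<le> norm (indicator (cball 0 r) x *\<^sub>R f x)"
        using zero[of x n] subsetD[OF r, of x] by (cases "x \<in> U") (simp_all add: abs_mult)
    qed
  qed
  moreover have "0 \<le> (LINT x|lborel. f x * \<psi> n x)" for n
    using pos[OF test] P by (simp add: \<psi>_def)
  ultimately show ?thesis by (intro LIMSEQ_le_const) auto
qed simp

text \<open>Let E be the part of the negative set inside a ball. Some open V around E exceeds it by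
  |f|-mass less than e, while the integral of f over V is nonnegative. Hence the |f|-mass of E,
  which is minus the integral of f over E, is at most e for every e > 0.\<close>

lemma fundamental_lemma_nonneg:
  fixes f :: "real^3 \<Rightarrow> real"
  assumes f: "locally_integrable f"
    and pos: "\<And>\<phi>. test_function \<phi> \<Longrightarrow> (\<And>x. 0 \<le> \<phi> x) \<Longrightarrow> 0 \<le> (LINT x|lborel. f x * \<phi> x)"
  shows "AE x in lborel. 0 \<le> f x"
proof -
  have [measurable]: "f \<in> borel_measurable borel" using f by (simp add: locally_integrable_def)
  have "AE x in lborel. \<not> (f x < 0 \<and> x \<in> ball 0 (real n))" for n
  proof -
    define B where "B = ball (0::real^3) (real n)"
    define E where "E = {x. f x < 0 \<and> x \<in> B}"
    have [measurable]: "B \<in> sets borel" "E \<in> sets borel" by (auto simp: B_def E_def)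
    have "set_integrable lborel (cball 0 n) f" using f by (simp add: locally_integrable_def)
    then have fB: "integrable lborel (\<lambda>x. f x * indicator S x)"
      if [measurable]: "S \<in> sets borel" and "S \<subseteq> B" for S
      unfolding set_integrable_def
      by (rule Bochner_Integration.integrable_bound) (use that in \<open>auto intro!: AE_I2 simp: B_def indicator_def\<close>)
    \<comment> \<open>Weighting Lebesgue measure by |f| lets outer regularity control the integral
      of |f| over the excess set directly; the restriction to a ball makes the measure
      finite.\<close>
    define M where "M = density lborel (\<lambda>x. ennreal (\<bar>f x\<bar> * indicator B x))"
    have M: "emeasure M S = ennreal (LINT x|lborel. \<bar>f x\<bar> * indicator S x)"
      if [measurable]: "S \<in> sets borel" and "S \<subseteq> B" for S
    proof -
      have "emeasure M S = (\<integral>\<^sup>+x. ennreal (\<bar>f x\<bar> * indicator B x) * indicator S x \<partial>lborel)"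
        unfolding M_def by (rule emeasure_density) auto
      also have "\<dots> = (\<integral>\<^sup>+x. ennreal (\<bar>f x\<bar> * indicator S x) \<partial>lborel)"
        using that by (intro nn_integral_cong) (auto simp: indicator_def)
      also have "\<dots> = ennreal (LINT x|lborel. \<bar>f x\<bar> * indicator S x)"
        using integrable_norm[OF fB[OF that]] by (intro nn_integral_eq_integral) (auto simp: abs_mult)
      finally show ?thesis .
    qed
    have sM: "sets M = sets borel" by (simp add: M_def)
    have "emeasure M (space M) = emeasure M B"
      by (simp add: M_def emeasure_density indicator_inter_arith[symmetric] mult.assoc flip: ennreal_indicator ennreal_mult')
    then have fin: "emeasure M (space M) \<noteq> \<infinity>" using M[of B] by simp
    have EB: "E \<subseteq> B" by (auto simp: E_def)
    let ?N = "\<lambda>S. LINT x|lborel. \<bar>f x\<bar> * indicator S x" and ?I = "\<lambda>S. LINT x|lborel. f x * indicator S x"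
    have int_E: "?N E = - ?I E"
      unfolding integral_minus[symmetric]
      by (intro Bochner_Integration.integral_cong) (auto simp: E_def indicator_def)
    have "?N E \<le> e" if "e > 0" for e
    proof -
      have "emeasure M E < emeasure M E + ennreal e"
        using that M[OF _ EB] by (simp add: ennreal_less_iff flip: ennreal_plus)
      then obtain U where U: "E \<subseteq> U" "open U" "emeasure M U < emeasure M E + ennreal e"
        using outer_regular[OF sM fin, of E] by (auto simp: INF_less_iff)
      define V where "V = U \<inter> B"
      have V: "open V" "bounded V" "V \<subseteq> B" "E \<subseteq> V" 
        using U EB by (auto simp: V_def B_def intro: bounded_Int)
      have [measurable]: "V \<in> sets borel" using V by simp
      have "emeasure M V \<le> emeasure M U"
        by (rule emeasure_mono) (use U sM in \<open>auto simp: V_def\<close>)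
      with U(3) have "emeasure M V < emeasure M E + ennreal e" by simp
      then have "ennreal (?N V)
          < ennreal (?N E + e)"
        using M[of V] M[of E] V EB that by simp
      then have 1: "?N V < ?N E + e"
        using that by (subst (asm) ennreal_less_iff) auto
      have 2: "0 \<le> ?I V"
        using V by (intro integral_open_nonneg[OF f pos]) auto
      have [simp]: "integrable lborel (\<lambda>x. \<bar>f x\<bar> * indicator V x)" "integrable lborel (\<lambda>x. \<bar>f x\<bar> * indicator E x)"
        using integrable_norm[OF fB[of V]] integrable_norm[OF fB[of E]] V EB by (auto simp: abs_mult)
      have "(LINT x|lborel. f x * indicator V x - f x * indicator E x)
          \<le> (LINT x|lborel. \<bar>f x\<bar> * indicator V x - \<bar>f x\<bar> * indicator E x)"
      proof (rule integral_mono)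
        show "integrable lborel (\<lambda>x. f x * indicator V x - f x * indicator E x)"
          using V EB fB by (intro Bochner_Integration.integrable_diff) auto
        show "integrable lborel (\<lambda>x. \<bar>f x\<bar> * indicator V x - \<bar>f x\<bar> * indicator E x)"
          by (intro Bochner_Integration.integrable_diff) simp_all
      qed (use V in \<open>auto simp: indicator_def\<close>)
      then have "?I V - ?I E
         \<le> ?N V - ?N E"
        using V EB fB[of V] fB[of E] by simp
      then show ?thesis using 1 2 int_E by linarith
    qed
    then have "?N E \<le> 0"
      by (intro field_le_epsilon[of _ 0]) simp
    moreover have "0 \<le> ?N E" by simp
    ultimately have "?N E = 0" by linarith
    then have "AE x in lborel. \<bar>f x\<bar> * indicator E x = 0"
      using integrable_norm[OF fB[of E]] EB
      by (subst (asm) integral_nonneg_eq_0_iff_AE) (auto simp: abs_mult)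
    then show ?thesis by eventually_elim (auto simp: E_def B_def indicator_def)
  qed
  then have "AE x in lborel. \<forall>n. \<not> (f x < 0 \<and> x \<in> ball 0 (real n))"
    unfolding AE_all_countable by blast
  then show ?thesis
  proof eventually_elim
    case (elim x)
    obtain n where "norm x < real n" using reals_Archimedean2 by blast
    then show ?case using elim by fastforce
  qed
qed

lemma locally_integrable_diff:
  assumes "locally_integrable f" "locally_integrable g"
  shows "locally_integrable (\<lambda>x. f x - g x)"
  using assms by (auto simp: locally_integrable_def)

lemma fundamental_lemma:
  fixes f :: "real^3 \<Rightarrow> real"
  assumes f: "locally_integrable f"
    and zero: "\<And>\<phi>. test_function \<phi> \<Longrightarrow> (LINT x|lborel. f x * \<phi> x) = 0"
  shows "AE x in lborel. f x = 0"
proof -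
  have "locally_integrable (\<lambda>x. - f x)"
    using f by (auto simp: locally_integrable_def set_integrable_def)
  then have "AE x in lborel. 0 \<le> - f x"
    by (rule fundamental_lemma_nonneg) (simp add: zero)
  moreover have "AE x in lborel. 0 \<le> f x"
    by (rule fundamental_lemma_nonneg[OF f]) (simp add: zero)
  ultimately show ?thesis by eventually_elim simp
qed

lemma locally_integrable_component:
  assumes "locally_integrable (g :: real^3 \<Rightarrow> real^3)"
  shows "locally_integrable (\<lambda>x. g x $ i)"
  unfolding locally_integrable_def
proof (intro conjI allI impI)
  have [measurable]: "g \<in> borel_measurable borel" using assms by (simp add: locally_integrable_def)
  show "(\<lambda>x. g x $ i) \<in> borel_measurable lborel"
    unfolding cart_eq_inner_axis by measurable
  fix K :: "(real^3) set" assume "compact K"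
  then have "integrable lborel (\<lambda>x. indicator K x *\<^sub>R g x)"
    using assms by (simp add: locally_integrable_def set_integrable_def)
  then have "integrable lborel (\<lambda>x. (indicator K x *\<^sub>R g x) $ i)"
    by (rule integrable_bounded_linear[OF bounded_linear_vec_nth])
  then show "set_integrable lborel K (\<lambda>x. g x $ i)"
    by (simp add: set_integrable_def)
qed

lemma has_weak_gradient_unique:
  assumes "has_weak_gradient u g" "has_weak_gradient u h"
  shows "AE x in lborel. g x = h x"
proof -
  have "AE x in lborel. g x $ i - h x $ i = 0" for i
  proof (rule fundamental_lemma)
    show l: "locally_integrable (\<lambda>x. g x $ i - h x $ i)"
      using assms by (intro locally_integrable_diff locally_integrable_component) (auto simp: has_weak_gradient_def)
    fix \<phi> assume \<phi>: "test_function \<phi>"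
    have "integrable lborel (\<lambda>x. g x $ i * \<phi> x)" "integrable lborel (\<lambda>x. h x $ i * \<phi> x)"
      using assms by (auto simp: has_weak_gradient_def intro!: integrable_mult_test[OF _ \<phi>] locally_integrable_component)
    then show "(LINT x|lborel. (g x $ i - h x $ i) * \<phi> x) = 0"
      using assms \<phi> by (simp add: left_diff_distrib has_weak_gradient_def)
  qed
  then have "AE x in lborel. \<forall>i. g x $ i - h x $ i = 0"
    unfolding AE_all_countable by blast
  then show ?thesis by eventually_elim (simp add: vec_eq_iff)
qed

lemma has_weak_gradient_weak_gradient:
  assumes "has_weak_gradient u g"
  shows "has_weak_gradient u (weak_gradient u)"
  using someI_ex[of "has_weak_gradient u"] assms by (auto simp: weak_gradient_def)

section \<open>Kernel integrals\<close>

lemma nn_integral_affine: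
  fixes f :: "'a::euclidean_space \<Rightarrow> ennreal"
  assumes [measurable]: "f \<in> borel_measurable borel" and "c \<noteq> 0"
  shows "(\<integral>\<^sup>+x. f (c *\<^sub>R x + t) \<partial>lborel) = ennreal (1 / \<bar>c\<bar> ^ DIM('a)) * (\<integral>\<^sup>+x. f x \<partial>lborel)"
proof -
  have "(\<integral>\<^sup>+x. f x \<partial>lborel) = ennreal (\<bar>c\<bar> ^ DIM('a)) * (\<integral>\<^sup>+x. f (c *\<^sub>R x + t) \<partial>lborel)"
    by (subst lborel_affine[OF assms(2), of t])
       (simp add: nn_integral_density nn_integral_distr nn_integral_cmult add.commute)
  then show ?thesis
    using assms(2) by (simp add: mult.assoc[symmetric] flip: ennreal_mult)
qed

lemma integral_affine:
  fixes f :: "'a::euclidean_space \<Rightarrow> real"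
  assumes [measurable]: "f \<in> borel_measurable borel" and "c \<noteq> 0"
  shows "(LINT x|lborel. f (c *\<^sub>R x + t)) = (1 / \<bar>c\<bar> ^ DIM('a)) * (LINT x|lborel. f x)"
proof -
  have "(LINT x|lborel. f x) = (\<bar>c\<bar> ^ DIM('a)) * (LINT x|lborel. f (c *\<^sub>R x + t))"
    by (subst lborel_affine[OF assms(2), of t])
       (simp add: integral_density integral_distr add.commute)
  then show ?thesis
    using assms(2) by simp
qed

lemma integrable_affine:
  fixes f :: "'a::euclidean_space \<Rightarrow> 'b::euclidean_space"
  assumes [measurable]: "f \<in> borel_measurable borel" and "c \<noteq> 0" "integrable lborel f"
  shows "integrable lborel (\<lambda>x. f (c *\<^sub>R x + t))"
  using assms(3) unfolding integrable_iff_bounded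
  by (subst nn_integral_affine[OF _ assms(2), of "\<lambda>x. ennreal (norm (f x))"])
     (auto simp: ennreal_mult_less_top)

lemma nn_integral_translate:
  fixes f :: "'a::euclidean_space \<Rightarrow> ennreal"
  assumes "f \<in> borel_measurable borel"
  shows "(\<integral>\<^sup>+x. f (x + t) \<partial>lborel) = (\<integral>\<^sup>+x. f x \<partial>lborel)"
  using nn_integral_affine[OF assms, of 1 t] by simp

lemma nn_integral_reflect:
  fixes f :: "'a::euclidean_space \<Rightarrow> ennreal"
  assumes "f \<in> borel_measurable borel"
  shows "(\<integral>\<^sup>+x. f (t - x) \<partial>lborel) = (\<integral>\<^sup>+x. f x \<partial>lborel)"
  using nn_integral_affine[OF assms, of "-1" t] by simp

section \<open>Integrals of inverse powers of the norm\<close>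

lemma nn_integral_power_tail:
  assumes "a > 0" "n > 0"
  shows "(\<integral>\<^sup>+t. ennreal (n / t ^ (n+1)) * indicator {a..} t \<partial>lborel) = ennreal (1 / a ^ n)"
proof -
  have "(\<integral>\<^sup>+t. ennreal (n / t ^ (n+1)) * indicator {a..} t \<partial>lborel) = ennreal (0 - - inverse (a ^ n))"
  proof (rule nn_integral_FTC_atLeast)
    show "DERIV (\<lambda>t. - inverse (t ^ n)) t :> n / t ^ (n+1)" if "a \<le> t" for t
    proof -
      have "DERIV (\<lambda>t. - inverse (t ^ n)) t :> n * t ^ (n - Suc 0) * (inverse (t ^ n))\<^sup>2"
        using that assms by (auto intro!: derivative_eq_intros simp: power2_eq_square)
      moreover have "n * t ^ (n - Suc 0) * (inverse (t ^ n))\<^sup>2 = n / t ^ (n + 1)"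
        using that assms by (cases n) (simp_all add: power2_eq_square divide_inverse)
      ultimately show ?thesis by simp
    qed
    have "((\<lambda>t::real. inverse (t ^ n)) \<longlongrightarrow> 0) at_top"
      using assms(2) filterlim_pow_at_top[OF assms(2) filterlim_ident]
      by (intro tendsto_inverse_0_at_top)
    then show "((\<lambda>t::real. - inverse (t ^ n)) \<longlongrightarrow> 0) at_top"
      using tendsto_minus by fastforce
  qed (use assms in auto)
  then show ?thesis by (simp add: divide_inverse)
qed

lemma emeasure_cball_3:
  "r \<ge> 0 \<Longrightarrow> emeasure lborel (cball (c::real^3) r) = ennreal (4/3 * pi * r^3)"
  by (simp add: emeasure_cball unit_ball_vol_3)

lemma emeasure_ball_3:
  "r \<ge> 0 \<Longrightarrow> emeasure lborel (ball (c::real^3) r) = ennreal (4/3 * pi * r^3)"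
  by (simp add: emeasure_ball unit_ball_vol_3)

text \<open>Writing |w|^-n as the integral of n t^-(n+1) over t \<ge> |w| and exchanging the
  integrals leaves only volumes of sets inside balls; this takes the place of polar
  coordinates.\<close>

lemma nn_integral_layer_cake:
  fixes S :: "(real^3) set"
  assumes [measurable]: "S \<in> sets borel" and "n > 0"
  shows "(\<integral>\<^sup>+w. ennreal (1 / norm w ^ n) * indicator S w \<partial>lborel)
    = (\<integral>\<^sup>+t. ennreal (n / t ^ (n+1)) * indicator {0<..} t * emeasure lborel (S \<inter> cball 0 t) \<partial>lborel)"
proof -
  have "(\<integral>\<^sup>+w. ennreal (1 / norm w ^ n) * indicator S w \<partial>lborel)
    = (\<integral>\<^sup>+w. (\<integral>\<^sup>+t. ennreal (n / t ^ (n+1)) * indicator {0<..} t * indicator (S \<inter> cball 0 t) w \<partial>lborel) \<partial>lborel)"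
  proof (rule nn_integral_cong_AE)
    \<comment> \<open>The origin is excluded: if it lies in S, the left side is 0 there by 1/0 = 0,
      while the integral on the right diverges.\<close>
    have "AE w in lborel. w \<noteq> (0::real^3)" by (rule AE_lborel_singleton)
    then show "AE w in lborel. ennreal (1 / norm w ^ n) * indicator S w
       = (\<integral>\<^sup>+t. ennreal (n / t ^ (n+1)) * indicator {0<..} t * indicator (S \<inter> cball 0 t) w \<partial>lborel)"
    proof eventually_elim
      case (elim w)
      then have w: "norm w > 0" by simp
      have "(\<integral>\<^sup>+t. ennreal (n / t ^ (n+1)) * indicator {0<..} t * indicator (S \<inter> cball 0 t) w \<partial>lborel)
        = (\<integral>\<^sup>+t. ennreal (n / t ^ (n+1)) * indicator {norm w..} t * indicator S w \<partial>lborel)"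
      proof (rule nn_integral_cong)
        fix t
        show "ennreal (n / t ^ (n+1)) * indicator {0<..} t * indicator (S \<inter> cball 0 t) w
          = ennreal (n / t ^ (n+1)) * indicator {norm w..} t * indicator S w"
          using w order_less_le_trans[OF w, of t] by (auto simp: indicator_def)
      qed
      also have "\<dots> = ennreal (1 / norm w ^ n) * indicator S w"
        by (subst nn_integral_multc) (use nn_integral_power_tail[OF w assms(2)] in auto)
      finally show ?case by simp
    qed
  qed
  also have "\<dots> = (\<integral>\<^sup>+t. (\<integral>\<^sup>+w. ennreal (n / t ^ (n+1)) * indicator {0<..} t * indicator (S \<inter> cball 0 t) w \<partial>lborel) \<partial>lborel)"
  proof -
    have [measurable]: "Measurable.pred (borel \<Otimes>\<^sub>M borel) (\<lambda>p. snd p \<in> S \<inter> cball 0 (fst p))"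
      for S' :: "(real^3) set"
      unfolding Int_iff mem_cball by measurable
    show ?thesis
      by (rule lborel_pair.Fubini'[symmetric]) (simp add: split_beta' indicator_def, measurable)
  qed
  also have "\<dots> = (\<integral>\<^sup>+t. ennreal (n / t ^ (n+1)) * indicator {0<..} t * emeasure lborel (S \<inter> cball 0 t) \<partial>lborel)"
    by (intro nn_integral_cong) (subst nn_integral_cmult, auto intro!: borel_measurable_indicator)
  finally show ?thesis .
qed

lemma nn_integral_inverse_square_ball:
  assumes r: "r > 0"
  shows "(\<integral>\<^sup>+w. ennreal (1 / (norm w)\<^sup>2) * indicator (ball (0::real^3) r) w \<partial>lborel) \<le> ennreal (4 * pi * r)"
proof -
  have "(\<integral>\<^sup>+w. ennreal (1 / norm w ^ 2) * indicator (ball (0::real^3) r) w \<partial>lborel)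
    = (\<integral>\<^sup>+t. ennreal (2 / t ^ 3) * indicator {0<..} t * emeasure lborel (ball (0::real^3) r \<inter> cball 0 t) \<partial>lborel)"
    by (subst nn_integral_layer_cake) (auto simp: numeral_eq_Suc)
  \<comment> \<open>For t \<le> r the ball of radius t counts and contributes 8/3 pi r in total; for
    larger t the whole ball of radius r counts and contributes 4/3 pi r.\<close>
  also have "\<dots> \<le> (\<integral>\<^sup>+t. ennreal (8/3 * pi) * indicator {0..r} t
      + ennreal (4/3 * pi * r^3) * (ennreal (2 / t ^ 3) * indicator {r..} t) \<partial>lborel)"
  proof (rule nn_integral_mono)
    fix t :: real
    consider "t \<le> 0" | "0 < t" "t \<le> r" | "t > r" by linarith
    then show "ennreal (2 / t ^ 3) * indicator {0<..} t * emeasure lborel (ball (0::real^3) r \<inter> cball 0 t)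
      \<le> ennreal (8/3 * pi) * indicator {0..r} t + ennreal (4/3 * pi * r^3) * (ennreal (2 / t ^ 3) * indicator {r..} t)"
    proof cases
      case 2
      have "emeasure lborel (ball (0::real^3) r \<inter> cball 0 t) \<le> emeasure lborel (cball (0::real^3) t)"
        by (rule emeasure_mono) auto
      then have "ennreal (2 / t ^ 3) * emeasure lborel (ball (0::real^3) r \<inter> cball 0 t)
        \<le> ennreal (2 / t^3) * ennreal (4/3 * pi * t^3)"
        using 2 by (intro mult_left_mono) (simp_all add: emeasure_cball_3)
      also have "\<dots> = ennreal (8/3 * pi)"
        using 2 by (simp add: ennreal_mult[symmetric])
      finally show ?thesis using 2 by (auto intro: order_trans add_increasing2)
    next
      case 3
      have "emeasure lborel (ball (0::real^3) r \<inter> cball 0 t) \<le> emeasure lborel (ball (0::real^3) r)"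
        by (rule emeasure_mono) auto
      then have "ennreal (2 / t ^ 3) * emeasure lborel (ball (0::real^3) r \<inter> cball 0 t)
        \<le> ennreal (2 / t^3) * ennreal (4/3 * pi * r^3)"
        using r by (intro mult_left_mono) (simp_all add: emeasure_ball_3)
      then show ?thesis using 3 r by (simp add: mult.commute)
    qed auto
  qed
  also have "\<dots> = ennreal (8/3 * pi) * ennreal r + ennreal (4/3 * pi * r^3) * ennreal (1 / r^2)"
    using r nn_integral_power_tail[of r 2]
    by (subst nn_integral_add; (subst nn_integral_cmult)?) (auto simp: numeral_eq_Suc nn_integral_cmult)
  also have "\<dots> = ennreal (4 * pi * r)"
    using r by (simp add: ennreal_mult[symmetric] ennreal_plus[symmetric] power2_eq_square power3_eq_cube
        del: ennreal_plus)
  finally show ?thesis .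
qed

text \<open>The shell between r and t is estimated by the full ball of radius t, whence 16/3 instead
  of the exact 4.\<close>

lemma nn_integral_inverse_fourth_outside:
  assumes r: "r > 0"
  shows "(\<integral>\<^sup>+w. ennreal (1 / (norm w)^4) * indicator (- ball (0::real^3) r) w \<partial>lborel) \<le> ennreal (16/3 * pi / r)"
proof -
  have "(\<integral>\<^sup>+w. ennreal (1 / norm w ^ 4) * indicator (- ball (0::real^3) r) w \<partial>lborel)
    = (\<integral>\<^sup>+t. ennreal (4 / t ^ 5) * indicator {0<..} t * emeasure lborel (- ball (0::real^3) r \<inter> cball 0 t) \<partial>lborel)"
    by (subst nn_integral_layer_cake) (auto simp: numeral_eq_Suc)
  also have "\<dots> \<le> (\<integral>\<^sup>+t. ennreal (16/3 * pi) * (ennreal (1 / t ^ 2) * indicator {r..} t) \<partial>lborel)"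
  proof (rule nn_integral_mono)
    fix t :: real
    show "ennreal (4 / t ^ 5) * indicator {0<..} t * emeasure lborel (- ball (0::real^3) r \<inter> cball 0 t)
      \<le> ennreal (16/3 * pi) * (ennreal (1 / t ^ 2) * indicator {r..} t)"
    proof (cases "t \<ge> r")
      case True
      then have t: "t > 0" using r by simp
      have "emeasure lborel (- ball (0::real^3) r \<inter> cball 0 t) \<le> emeasure lborel (cball (0::real^3) t)"
        by (rule emeasure_mono) auto
      then have "ennreal (4 / t ^ 5) * emeasure lborel (- ball (0::real^3) r \<inter> cball 0 t)
        \<le> ennreal (4 / t^5) * ennreal (4/3 * pi * t^3)"
        using t by (intro mult_left_mono) (simp_all add: emeasure_cball_3)
      also have "\<dots> = ennreal (16/3 * pi) * ennreal (1 / t^2)"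
        using t by (simp add: ennreal_mult[symmetric] power2_eq_square power3_eq_cube eval_nat_numeral)
      finally show ?thesis using True t by simp
    next
      case False
      then have "- ball (0::real^3) r \<inter> cball 0 t = {}" by auto
      then show ?thesis by simp
    qed
  qed
  also have "\<dots> = ennreal (16/3 * pi) * ennreal (1 / r)"
    using r nn_integral_power_tail[of r 1] by (subst nn_integral_cmult) (auto simp: power2_eq_square)
  also have "\<dots> = ennreal (16/3 * pi / r)"
    using r by (simp add: ennreal_mult[symmetric])
  finally show ?thesis .
qed

text \<open>Every z has distance at least \<rho>, half of |x - y|, from x or from y. If only one of
  them is near, the other factor is at most 1/\<rho>^2; if both are far, the product is at most the
  sum of the two inverse fourth powers. Each centre contributes (4 + 16/3) pi / \<rho> = 28/3 pi /
  \<rho>, and 1/\<rho> = 2/|x - y| turns the two contributions into 112/3.\<close>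

lemma nn_integral_kernel_square:
  fixes x y :: "real^3"
  assumes "x \<noteq> y"
  shows "(\<integral>\<^sup>+z. ennreal (1 / (norm (x - z))\<^sup>2) * ennreal (1 / (norm (y - z))\<^sup>2) \<partial>lborel)
    \<le> ennreal (112/3 * pi) * ennreal (1 / norm (x - y))"
proof -
  define \<rho> where "\<rho> = norm (x - y) / 2"
  have \<rho>: "\<rho> > 0" using assms by (simp add: \<rho>_def)
  have [measurable]: "ball (0::real^3) \<rho> \<in> sets borel" "- ball (0::real^3) \<rho> \<in> sets borel"
    by auto
  define P where "P w = ennreal (1 / \<rho>\<^sup>2) * (ennreal (1 / (norm w)\<^sup>2) * indicator (ball (0::real^3) \<rho>) w)
     + ennreal (1 / (norm w)^4) * indicator (- ball (0::real^3) \<rho>) w" for w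
  have [measurable]: "P \<in> borel_measurable borel" unfolding P_def by measurable
  have P: "(\<integral>\<^sup>+w. P w \<partial>lborel) \<le> ennreal (28/3 * pi / \<rho>)"
  proof -
    have "(\<integral>\<^sup>+w. P w \<partial>lborel) \<le> ennreal (1 / \<rho>\<^sup>2) * ennreal (4 * pi * \<rho>) + ennreal (16/3 * pi / \<rho>)"
      unfolding P_def
      by (subst nn_integral_add; (subst nn_integral_cmult)?)
         (use nn_integral_inverse_square_ball[OF \<rho>] nn_integral_inverse_fourth_outside[OF \<rho>] in
          \<open>auto intro!: add_mono mult_left_mono\<close>)
    also have "\<dots> = ennreal (28/3 * pi / \<rho>)"
      using \<rho> by (simp add: ennreal_mult[symmetric] ennreal_plus[symmetric] power2_eq_square del: ennreal_plus)
    finally show ?thesis .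
  qed
  have pt: "ennreal (1 / (norm (x - z))\<^sup>2) * ennreal (1 / (norm (y - z))\<^sup>2) \<le> P (x - z) + P (y - z)" for z
  proof -
    define a b where "a = norm (x - z)" and "b = norm (y - z)"
    have ab: "a \<ge> 0" "b \<ge> 0" by (auto simp: a_def b_def)
    have "norm (x - y) \<le> a + b"
      using norm_triangle_ineq4[of "x - z" "y - z"] by (simp add: a_def b_def)
    then have tri: "2 * \<rho> \<le> a + b" by (simp add: \<rho>_def)
    have Pa: "P (x - z) = (if a < \<rho> then ennreal (1 / \<rho>\<^sup>2 * (1 / a\<^sup>2)) else ennreal (1 / a^4))"
      and Pb: "P (y - z) = (if b < \<rho> then ennreal (1 / \<rho>\<^sup>2 * (1 / b\<^sup>2)) else ennreal (1 / b^4))"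
      using \<rho> by (auto simp: P_def a_def b_def ennreal_mult[symmetric])
    have inv: "1 / c\<^sup>2 \<le> 1 / \<rho>\<^sup>2" if "c \<ge> \<rho>" for c
      using that \<rho> by (intro divide_left_mono power_mono) auto
    have "ennreal (1 / a\<^sup>2) * ennreal (1 / b\<^sup>2) = ennreal (1 / a\<^sup>2 * (1 / b\<^sup>2))"
      by (simp add: ennreal_mult[symmetric])
    also have "\<dots> \<le> P (x - z) + P (y - z)"
    proof -
      consider "a < \<rho>" "b \<ge> \<rho>" | "b < \<rho>" "a \<ge> \<rho>" | "a \<ge> \<rho>" "b \<ge> \<rho>" using tri by linarith
      then show ?thesis
      proof cases
        case 1
        have "1 / a\<^sup>2 * (1 / b\<^sup>2) \<le> 1 / \<rho>\<^sup>2 * (1 / a\<^sup>2)"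
          using inv[OF 1(2)] by (subst mult.commute) (intro mult_right_mono, auto)
        then show ?thesis using 1 Pa by (simp add: ennreal_leI add_increasing2)
      next
        case 2
        have "1 / a\<^sup>2 * (1 / b\<^sup>2) \<le> 1 / \<rho>\<^sup>2 * (1 / b\<^sup>2)"
          using inv[OF 2(2)] by (intro mult_right_mono) auto
        then show ?thesis using 2 Pb by (simp add: ennreal_leI add_increasing)
      next
        case 3
        have "1 / a\<^sup>2 * (1 / b\<^sup>2) \<le> 1 / a^4 + 1 / b^4"
        proof -
          have "0 \<le> (1 / a\<^sup>2 - 1 / b\<^sup>2)\<^sup>2" by simp
          also have "\<dots> = 1 / a^4 + 1 / b^4 - 2 * (1 / a\<^sup>2 * (1 / b\<^sup>2))"
            by (simp add: power2_diff power_divide flip: power_mult)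
          finally have "2 * (1 / a\<^sup>2 * (1 / b\<^sup>2)) \<le> 1 / a^4 + 1 / b^4" by simp
          moreover have "0 \<le> 1 / a\<^sup>2 * (1 / b\<^sup>2)" by simp
          ultimately show ?thesis by linarith
        qed
        then have "ennreal (1 / a\<^sup>2 * (1 / b\<^sup>2)) \<le> ennreal (1 / a^4) + ennreal (1 / b^4)"
          using ennreal_leI[of "1 / a\<^sup>2 * (1 / b\<^sup>2)" "1 / a^4 + 1 / b^4"] by (simp add: ennreal_plus)
        then show ?thesis using 3 Pa Pb by simp
      qed
    qed
    finally show ?thesis by (simp add: a_def b_def)
  qed
  have "(\<integral>\<^sup>+z. ennreal (1 / (norm (x - z))\<^sup>2) * ennreal (1 / (norm (y - z))\<^sup>2) \<partial>lborel)
      \<le> (\<integral>\<^sup>+z. P (x - z) + P (y - z) \<partial>lborel)"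
    by (intro nn_integral_mono pt)
  also have "\<dots> = (\<integral>\<^sup>+z. P z \<partial>lborel) + (\<integral>\<^sup>+z. P z \<partial>lborel)"
    by (subst nn_integral_add) (simp_all add: nn_integral_reflect)
  also have "\<dots> \<le> ennreal (28/3 * pi / \<rho>) + ennreal (28/3 * pi / \<rho>)"
    by (intro add_mono P)
  also have "\<dots> = ennreal (112/3 * pi) * ennreal (1 / norm (x - y))"
    using \<rho> by (simp add: \<rho>_def ennreal_mult[symmetric] ennreal_plus[symmetric] del: ennreal_plus)
  finally show ?thesis .
qed

section \<open>Weak gradients and translations\<close>

lemma test_function_add:
  assumes "test_function \<phi>" "test_function \<psi>"
  shows "test_function (\<lambda>x. \<phi> x + \<psi> x)"
proof -
  have "{x. \<phi> x + \<psi> x \<noteq> 0} \<subseteq> {x. \<phi> x \<noteq> 0} \<union> {x. \<psi> x \<noteq> 0}" by auto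
  moreover have "bounded ({x. \<phi> x \<noteq> 0} \<union> {x. \<psi> x \<noteq> 0})"
    using assms by (simp add: test_function_iff)
  ultimately have "bounded {x. \<phi> x + \<psi> x \<noteq> 0}" by (rule bounded_subset[rotated])
  then show ?thesis using assms by (simp add: test_function_iff k_smooth_add)
qed

lemma test_function_zero: "test_function (\<lambda>x. 0)"
  by (simp add: test_function_iff k_smooth_const)

lemma test_function_sum:
  "(\<And>i. i \<in> I \<Longrightarrow> test_function (f i)) \<Longrightarrow> test_function (\<lambda>x. \<Sum>i\<in>I. f i x)"
  by (induction I rule: infinite_finite_induct) (auto intro: test_function_zero test_function_add)

lemma borel_measurable_lborel_pair:
  "f \<in> borel_measurable (borel \<Otimes>\<^sub>M borel) \<Longrightarrow> f \<in> borel_measurable (lborel \<Otimes>\<^sub>M lborel)"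
  by (subst measurable_cong_sets[OF sets_pair_measure_cong[OF sets_lborel sets_lborel] refl])

lemma nn_integral_swap:
  fixes f :: "'a::euclidean_space \<Rightarrow> 'b::euclidean_space \<Rightarrow> ennreal"
  assumes "case_prod f \<in> borel_measurable (borel \<Otimes>\<^sub>M borel)"
  shows "(\<integral>\<^sup>+y. (\<integral>\<^sup>+x. f x y \<partial>lborel) \<partial>lborel) = (\<integral>\<^sup>+x. (\<integral>\<^sup>+y. f x y \<partial>lborel) \<partial>lborel)"
  by (rule lborel_pair.Fubini'[OF borel_measurable_lborel_pair[OF assms]])

text \<open>Expressed through partial derivatives because weak gradients are tested one coordinate
  at a time.\<close>

definition dir_deriv :: "(real^3 \<Rightarrow> real) \<Rightarrow> real^3 \<Rightarrow> real^3 \<Rightarrow> real" where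
  "dir_deriv f v x = (\<Sum>i\<in>UNIV. v $ i * pderiv_at i f x)"

lemma test_function_dir_deriv: "test_function \<phi> \<Longrightarrow> test_function (dir_deriv \<phi> v)"
  unfolding dir_deriv_def[abs_def] by (intro test_function_sum test_function_cmult test_function_pderiv)

lemma test_function_has_derivative:
  assumes "test_function \<phi>"
  shows "(\<phi> has_derivative (\<lambda>v. dir_deriv \<phi> v x)) (at x)"
proof -
  let ?D = "frechet_derivative \<phi> (at x)"
  have D: "(\<phi> has_derivative ?D) (at x)"
    using test_function_differentiable[OF assms] frechet_derivative_works by blast
  note lin = has_derivative_linear[OF D]
  have "?D v = dir_deriv \<phi> v x" for v
  proof -
    have "?D v = ?D (\<Sum>i\<in>UNIV. v $ i *\<^sub>R axis i 1)"
      using basis_expansion[of v] by (simp add: scalar_mult_eq_scaleR)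
    then show ?thesis
      by (simp add: linear_sum[OF lin] linear_cmul[OF lin] dir_deriv_def pderiv_at_def)
  qed
  then have "?D = (\<lambda>v. dir_deriv \<phi> v x)" by (rule ext)
  with D show ?thesis by simp
qed

lemma test_function_shift_FTC:
  assumes "test_function \<phi>"
  shows "(LINT s|lborel. dir_deriv \<phi> v (x - s *\<^sub>R v) * indicator {0..1::real} s) = \<phi> x - \<phi> (x - v)"
proof -
  have "(LINT s|lborel. dir_deriv \<phi> v (x - s *\<^sub>R v) * indicator {0..1::real} s)
     = - \<phi> (x - 1 *\<^sub>R v) - (- \<phi> (x - 0 *\<^sub>R v))"
  proof (rule integral_FTC_Icc_real)
    fix s :: real
    have "((\<lambda>s. x - s *\<^sub>R v) has_derivative (\<lambda>h. - (h *\<^sub>R v))) (at s)"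
      by (auto intro!: derivative_eq_intros)
    from has_derivative_compose[OF this test_function_has_derivative[OF assms]]
    have "((\<lambda>s. - \<phi> (x - s *\<^sub>R v)) has_derivative (\<lambda>h. - dir_deriv \<phi> (- (h *\<^sub>R v)) (x - s *\<^sub>R v))) (at s)"
      by (rule has_derivative_minus)
    moreover have "- dir_deriv \<phi> (- (h *\<^sub>R v)) (x - s *\<^sub>R v) = dir_deriv \<phi> v (x - s *\<^sub>R v) * h" for h
      by (simp add: dir_deriv_def sum_negf sum_distrib_right sum_distrib_left mult_ac)
    ultimately show "DERIV (\<lambda>s. - \<phi> (x - s *\<^sub>R v)) s :> dir_deriv \<phi> v (x - s *\<^sub>R v)"
      by (simp add: has_field_derivative_def)
    have "continuous_on UNIV (\<lambda>s. dir_deriv \<phi> v (x - s *\<^sub>R v))"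
      by (rule continuous_on_compose2[OF test_function_continuous[OF test_function_dir_deriv[OF assms]]])
         (auto intro!: continuous_intros)
    then show "isCont (\<lambda>s. dir_deriv \<phi> v (x - s *\<^sub>R v)) s"
      by (simp add: continuous_on_eq_continuous_at)
  qed simp
  then show ?thesis by simp
qed

lemma test_function_translate: "test_function \<phi> \<Longrightarrow> test_function (\<lambda>x. \<phi> (x - v))"
  using test_function_affine[of \<phi> 1 "- v"] by simp

lemma pderiv_at_translate:
  assumes "test_function \<phi>"
  shows "pderiv_at i (\<lambda>x. \<phi> (x - v)) x = pderiv_at i \<phi> (x - v)"
  using pderiv_at_affine[of \<phi> 1 x "- v" i] test_function_differentiable[OF assms] by simp

text \<open>The fundamental theorem of calculus is applied to the test function along the segment,
  so u may be merely locally integrable. Fubini applies because all the shifted derivatives vanish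
  outside a ball enlarged by |v|.\<close>

lemma shift_identity:
  fixes u :: "real^3 \<Rightarrow> real"
  assumes u: "locally_integrable u" and \<phi>: "test_function \<phi>"
  shows "(LINT x|lborel. u x * \<phi> x) - (LINT x|lborel. u x * \<phi> (x - v))
    = (LINT s|lborel. indicator {0..1::real} s * (LINT x|lborel. u x * dir_deriv \<phi> v (x - s *\<^sub>R v)))"
proof -
  have [measurable]: "u \<in> borel_measurable borel" using u by (simp add: locally_integrable_def)
  note [measurable] = test_function_borel[OF test_function_dir_deriv[OF \<phi>]]
  obtain M r where M: "M > 0" "\<And>x. \<bar>dir_deriv \<phi> v x\<bar> \<le> M * indicator (cball 0 r) x"
    using test_function_indicator_bound[OF test_function_dir_deriv[OF \<phi>]] by metis
  define R where "R = r + norm v"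
  have [measurable]: "cball (0::real^3) R \<in> sets borel" by simp
  define F where "F = (\<lambda>(x, s). u x * (dir_deriv \<phi> v (x - s *\<^sub>R v) * indicator {0..1::real} s))"
  define G where "G = (\<lambda>(x, s). (M * (indicator (cball 0 R) x * u x)) * indicator {0..1::real} s)"
  have uR: "integrable lborel (\<lambda>x. M * (indicator (cball 0 R) x * u x))"
    using u by (auto simp: locally_integrable_def set_integrable_def)
  have "integrable (lborel \<Otimes>\<^sub>M lborel) G"
  proof (rule lborel_pair.Fubini_integrable)
    show "G \<in> borel_measurable (lborel \<Otimes>\<^sub>M lborel)" unfolding G_def
      by (rule borel_measurable_lborel_pair) measurable
    show "integrable lborel (\<lambda>x. LINT s|lborel. norm (G (x, s)))"
      using integrable_norm[OF uR] by (simp add: G_def abs_mult)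
    show "AE x in lborel. integrable lborel (\<lambda>s. G (x, s))"
      by (simp add: G_def)
  qed
  then have F: "integrable (lborel \<Otimes>\<^sub>M lborel) F"
  proof (rule Bochner_Integration.integrable_bound)
    show "F \<in> borel_measurable (lborel \<Otimes>\<^sub>M lborel)" unfolding F_def
      by (rule borel_measurable_lborel_pair) measurable
    show "AE p in lborel \<Otimes>\<^sub>M lborel. norm (F p) \<le> norm (G p)"
    proof (rule AE_I2, clarify)
      fix x s
      show "norm (F (x, s)) \<le> norm (G (x, s))"
      proof (cases "s \<in> {0..1}")
        case True
        have "\<bar>dir_deriv \<phi> v (x - s *\<^sub>R v)\<bar> \<le> M * indicator (cball 0 R) x"
        proof -
          have "norm x \<le> norm (x - s *\<^sub>R v) + norm (s *\<^sub>R v)"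
            using norm_triangle_ineq[of "x - s *\<^sub>R v" "s *\<^sub>R v"] by simp
          also have "norm (s *\<^sub>R v) \<le> norm v" using True by (simp add: mult_left_le_one_le)
          finally have "x - s *\<^sub>R v \<in> cball 0 r \<Longrightarrow> x \<in> cball 0 R" by (simp add: R_def)
          then have "M * indicator (cball 0 r) (x - s *\<^sub>R v) \<le> M * indicator (cball 0 R) x"
            using M(1) by (auto simp: indicator_def)
          then show ?thesis using M(2)[of "x - s *\<^sub>R v"] by linarith
        qed
        then have "\<bar>u x\<bar> * \<bar>dir_deriv \<phi> v (x - s *\<^sub>R v)\<bar> \<le> \<bar>u x\<bar> * (M * indicator (cball 0 R) x)"
          by (intro mult_left_mono) auto
        then show ?thesis using True M(1) by (simp add: F_def G_def abs_mult mult_ac)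
      qed (simp add: F_def)
    qed
  qed
  have "(LINT x|lborel. u x * \<phi> x) - (LINT x|lborel. u x * \<phi> (x - v))
     = (LINT x|lborel. u x * \<phi> x - u x * \<phi> (x - v))"
    using integrable_mult_test[OF u \<phi>] integrable_mult_test[OF u test_function_translate[OF \<phi>]] by simp
  also have "\<dots> = (LINT x|lborel. (LINT s|lborel. F (x, s)))"
    unfolding F_def by (simp add: test_function_shift_FTC[OF \<phi>] right_diff_distrib)
  also have "\<dots> = (LINT s|lborel. (LINT x|lborel. F (x, s)))"
    using lborel_pair.Fubini_integral[of "\<lambda>x s. F (x, s)"] F by simp
  also have "\<dots> = (LINT s|lborel. indicator {0..1::real} s * (LINT x|lborel. u x * dir_deriv \<phi> v (x - s *\<^sub>R v)))"
    unfolding F_def integral_mult_right_zero[symmetric] by (simp add: mult_ac)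
  finally show ?thesis .
qed

lemma locally_integrable_continuous:
  fixes f :: "real^3 \<Rightarrow> 'b::euclidean_space"
  assumes "continuous_on UNIV f"
  shows "locally_integrable f"
  unfolding locally_integrable_def set_integrable_def
  using borel_integrable_compact[OF _ continuous_on_subset[OF assms]] assms
  by (auto simp: borel_measurable_continuous_onI)

lemma locally_integrable_const: "locally_integrable (\<lambda>x. c :: real)"
  by (intro locally_integrable_continuous continuous_intros)

text \<open>For u = 1 the left side of the shift identity is 0 by translation invariance, and the
  right side is the integral in question.\<close>

lemma integral_pderiv_at:
  assumes "test_function \<phi>"
  shows "(LINT x|lborel. pderiv_at i \<phi> x) = 0"
proof -
  note [measurable] = test_function_borel[OF assms] test_function_borel[OF test_function_pderiv[OF assms]]
  have dir: "dir_deriv \<phi> (axis i 1) = pderiv_at i \<phi>"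
    by (simp add: dir_deriv_def fun_eq_iff axis_def if_distrib[of "\<lambda>a. a * b" for b] cong: if_cong)
  have tr: "(LINT x|lborel. f (x - w)) = (LINT x|lborel. f x)"
    if "f \<in> borel_measurable borel" for f :: "real^3 \<Rightarrow> real" and w
    using integral_affine[OF that, of 1 "- w"] by simp
  have "0 = (LINT s|lborel. indicator {0..1::real} s * (LINT x|lborel. pderiv_at i \<phi> x))"
    using shift_identity[OF locally_integrable_const[of 1] assms, of "axis i 1"]
    by (simp add: dir tr)
  also have "\<dots> = (LINT x|lborel. pderiv_at i \<phi> x)" by simp
  finally show ?thesis by simp
qed

text \<open>The derivative of the product of two test functions integrates to 0, which is
  integration by parts. This is what places bump functions in \<open>H1\<close>, so that mass
  spheres have elements.\<close>

lemma has_weak_gradient_test_function: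
  assumes "test_function \<phi>"
  shows "has_weak_gradient \<phi> (\<lambda>x. \<chi> i. pderiv_at i \<phi> x)"
  unfolding has_weak_gradient_def
proof (intro conjI allI impI)
  note c = test_function_continuous[OF assms] test_function_continuous[OF test_function_pderiv[OF assms]]
  show "locally_integrable \<phi>" by (rule locally_integrable_continuous[OF c(1)])
  show "locally_integrable (\<lambda>x. \<chi> i. pderiv_at i \<phi> x)"
    by (intro locally_integrable_continuous continuous_on_vec_lambda c)
  fix \<psi> i assume \<psi>: "test_function \<psi>"
  have "integrable lborel (\<lambda>x. \<phi> x * pderiv_at i \<psi> x)" "integrable lborel (\<lambda>x. pderiv_at i \<phi> x * \<psi> x)"
    using \<psi> by (auto intro!: integrable_mult_test locally_integrable_continuous c test_function_pderiv)
  then have "(LINT x|lborel. \<phi> x * pderiv_at i \<psi> x) + (LINT x|lborel. pderiv_at i \<phi> x * \<psi> x)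
     = (LINT x|lborel. \<phi> x * pderiv_at i \<psi> x + pderiv_at i \<phi> x * \<psi> x)" by simp
  also have "\<dots> = (LINT x|lborel. pderiv_at i (\<lambda>x. \<phi> x * \<psi> x) x)"
    using assms \<psi> by (simp add: pderiv_at_mult test_function_differentiable)
  also have "\<dots> = 0" by (intro integral_pderiv_at test_function_mult assms \<psi>)
  finally show "(LINT x|lborel. \<phi> x * pderiv_at i \<psi> x) = - (LINT x|lborel. (\<chi> i. pderiv_at i \<phi> x) $ i * \<psi> x)"
    by simp
qed

lemma weak_gradient_dir_deriv:
  assumes g: "has_weak_gradient u g" and \<phi>: "test_function \<phi>"
  shows "(LINT x|lborel. u x * dir_deriv \<phi> v (x - w)) = - (LINT x|lborel. (g x \<bullet> v) * \<phi> (x - w))"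
proof -
  let ?\<phi> = "\<lambda>x. \<phi> (x - w)"
  note \<phi>w = test_function_translate[OF \<phi>, of w]
  have u: "locally_integrable u" and g': "locally_integrable g" using g by (auto simp: has_weak_gradient_def)
  have "(LINT x|lborel. u x * dir_deriv \<phi> v (x - w)) = (LINT x|lborel. (\<Sum>i\<in>UNIV. v $ i * (u x * pderiv_at i ?\<phi> x)))"
    by (simp add: dir_deriv_def pderiv_at_translate[OF \<phi>] sum_distrib_left mult_ac)
  also have "\<dots> = (\<Sum>i\<in>UNIV. v $ i * (LINT x|lborel. u x * pderiv_at i ?\<phi> x))"
    using integrable_mult_test[OF u test_function_pderiv[OF \<phi>w]] by (subst Bochner_Integration.integral_sum) auto
  also have "\<dots> = - (\<Sum>i\<in>UNIV. v $ i * (LINT x|lborel. g x $ i * ?\<phi> x))"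
    using g \<phi>w by (simp add: has_weak_gradient_def sum_negf)
  also have "(\<Sum>i\<in>UNIV. v $ i * (LINT x|lborel. g x $ i * ?\<phi> x))
     = (LINT x|lborel. (\<Sum>i\<in>UNIV. v $ i * (g x $ i * ?\<phi> x)))"
    using integrable_mult_test[OF locally_integrable_component[OF g'] \<phi>w]
    by (subst Bochner_Integration.integral_sum) auto
  also have "\<dots> = (LINT x|lborel. (g x \<bullet> v) * ?\<phi> x)"
    by (simp add: inner_vec_def sum_distrib_right sum_distrib_left mult_ac)
  finally show ?thesis .
qed

section \<open>Riesz potentials\<close>

text \<open>In the non-integrable case the left side is 0 by the convention for the Bochner
  integral.\<close>

lemma ennreal_abs_integral_le:
  fixes f :: "'a \<Rightarrow> real"
  shows "ennreal \<bar>integral\<^sup>L M f\<bar> \<le> (\<integral>\<^sup>+x. ennreal \<bar>f x\<bar> \<partial>M)"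
  using integral_norm_bound_ennreal[of M f] by (cases "integrable M f") (auto simp: not_integrable_integral_eq)

text \<open>For fixed s the substitution w = s v turns the shift by s v into one by w. Integrating
  over s then collects all weights into a kernel in w alone, of size at most S^3 / (3
  |w|^2).\<close>

lemma averaged_shift_bound:
  fixes h p :: "real^3 \<Rightarrow> ennreal"
  assumes [measurable]: "h \<in> borel_measurable borel" "p \<in> borel_measurable borel" and S: "S > 0"
  shows "(\<integral>\<^sup>+v. indicator (ball 0 S) v * (\<integral>\<^sup>+s. indicator {0..1::real} s * (ennreal (norm v) * (\<integral>\<^sup>+x. h x * p (x - s *\<^sub>R v) \<partial>lborel)) \<partial>lborel) \<partial>lborel)
    \<le> ennreal (S^3/3) * (\<integral>\<^sup>+y. p y * (\<integral>\<^sup>+w. h (y + w) * ennreal (1 / (norm w)\<^sup>2) \<partial>lborel) \<partial>lborel)" (is "?L \<le> _")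
proof -
  define k where "k s v = (if norm v < S \<and> 0 \<le> s \<and> s \<le> 1 then ennreal (norm v) else 0)" for s :: real and v :: "real^3"
  \<comment> \<open>The weight after the substitution: |v| has become |w| / s, and the Jacobian
    contributes s^-3.\<close>
  define k' where "k' s w = (if norm w < s * S \<and> 0 < s \<and> s \<le> 1 then ennreal (norm w / s^4) else 0)" for s :: real and w :: "real^3"
  have [measurable (raw)]: "(\<lambda>q. k (f q) (g q)) \<in> borel_measurable M" "(\<lambda>q. k' (f q) (g q)) \<in> borel_measurable M"
    if [measurable]: "f \<in> borel_measurable M" "g \<in> borel_measurable M" for f g and M :: "'m measure"
    unfolding k_def k'_def by measurable
  let ?A = "\<lambda>v. indicator (ball 0 S) v * (\<integral>\<^sup>+s. indicator {0..1::real} s * (ennreal (norm v) * (\<integral>\<^sup>+x. h x * p (x - s *\<^sub>R v) \<partial>lborel)) \<partial>lborel)"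
  let ?H = "\<lambda>s v. \<integral>\<^sup>+y. h (y + s *\<^sub>R v) * p y \<partial>lborel"
  let ?B = "\<lambda>v. \<integral>\<^sup>+s. k s v * ?H s v \<partial>lborel"
  let ?C = "\<lambda>s. \<integral>\<^sup>+y. p y * (\<integral>\<^sup>+v. k s v * h (y + s *\<^sub>R v) \<partial>lborel) \<partial>lborel"
  have "?L
    = (\<integral>\<^sup>+v. ?B v \<partial>lborel)"
  proof (rule nn_integral_cong)
    fix v :: "real^3"
    have "(\<integral>\<^sup>+x. h x * p (x - s *\<^sub>R v) \<partial>lborel) = ?H s v" for s
      using nn_integral_translate[of "\<lambda>x. h x * p (x - s *\<^sub>R v)" "s *\<^sub>R v"] by simp
    then have "?A v
      = (\<integral>\<^sup>+s. indicator (ball 0 S) v * (indicator {0..1::real} s * (ennreal (norm v) * ?H s v)) \<partial>lborel)"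
      by (subst nn_integral_cmult) auto
    also have "\<dots> = ?B v"
      by (intro nn_integral_cong) (auto simp: k_def indicator_def)
    finally show "?A v
      = ?B v" .
  qed
  also have "\<dots> = (\<integral>\<^sup>+s. (\<integral>\<^sup>+v. k s v * ?H s v \<partial>lborel) \<partial>lborel)"
    by (rule nn_integral_swap) measurable
  also have "\<dots> = (\<integral>\<^sup>+s. ?C s \<partial>lborel)"
  proof (rule nn_integral_cong)
    fix s :: real
    have "(\<integral>\<^sup>+v. k s v * ?H s v \<partial>lborel)
      = (\<integral>\<^sup>+v. (\<integral>\<^sup>+y. k s v * (h (y + s *\<^sub>R v) * p y) \<partial>lborel) \<partial>lborel)"
      by (simp add: nn_integral_cmult)
    also have "\<dots> = (\<integral>\<^sup>+y. (\<integral>\<^sup>+v. k s v * (h (y + s *\<^sub>R v) * p y) \<partial>lborel) \<partial>lborel)"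
      by (rule nn_integral_swap) measurable
    also have "\<dots> = ?C s"
      by (subst nn_integral_cmult[symmetric]) (auto simp: mult_ac)
    finally show "(\<integral>\<^sup>+v. k s v * ?H s v \<partial>lborel)
      = ?C s" .
  qed
  also have "\<dots> = (\<integral>\<^sup>+s. (\<integral>\<^sup>+y. p y * (\<integral>\<^sup>+w. k' s w * h (y + w) \<partial>lborel) \<partial>lborel) \<partial>lborel)"
  proof (rule nn_integral_cong_AE)
    \<comment> \<open>At s = 0 the substitution degenerates and the two weights disagree.\<close>
    have "AE s in lborel. s \<noteq> (0::real)" by (rule AE_lborel_singleton)
    then show "AE s in lborel. ?C s
      = (\<integral>\<^sup>+y. p y * (\<integral>\<^sup>+w. k' s w * h (y + w) \<partial>lborel) \<partial>lborel)"
    proof eventually_elim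
      case (elim s)
      have "(\<integral>\<^sup>+v. k s v * h (y + s *\<^sub>R v) \<partial>lborel) = (\<integral>\<^sup>+w. k' s w * h (y + w) \<partial>lborel)" for y
      proof (cases "0 < s \<and> s \<le> 1")
        case True
        define f where "f w = (if norm w < s * S then ennreal (norm w / s) * h (y + w) else 0)" for w
        have [measurable]: "f \<in> borel_measurable borel" unfolding f_def by measurable
        have "(\<integral>\<^sup>+v. k s v * h (y + s *\<^sub>R v) \<partial>lborel) = (\<integral>\<^sup>+v. f (s *\<^sub>R v + 0) \<partial>lborel)"
          using True by (intro nn_integral_cong) (auto simp: k_def f_def)
        also have "\<dots> = ennreal (1 / s ^ 3) * (\<integral>\<^sup>+w. f w \<partial>lborel)"
          using True by (subst nn_integral_affine) auto
        also have "\<dots> = (\<integral>\<^sup>+w. ennreal (1 / s ^ 3) * f w \<partial>lborel)"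
          by (simp add: nn_integral_cmult)
        also have "\<dots> = (\<integral>\<^sup>+w. k' s w * h (y + w) \<partial>lborel)"
        proof (rule nn_integral_cong)
          fix w :: "real^3"
          have "ennreal (1 / s ^ 3) * ennreal (norm w / s) = ennreal (norm w / s ^ 4)"
            using True by (simp add: ennreal_mult[symmetric] eval_nat_numeral)
          then show "ennreal (1 / s ^ 3) * f w = k' s w * h (y + w)"
            using True by (simp add: k'_def f_def flip: mult.assoc)
        qed
        finally show ?thesis .
      next
        case False
        then have "k s v = 0" "k' s v = 0" for v using elim by (auto simp: k_def k'_def)
        then show ?thesis by simp
      qed
      then show ?case by simp
    qed
  qed
  also have "\<dots> = (\<integral>\<^sup>+y. (\<integral>\<^sup>+s. p y * (\<integral>\<^sup>+w. k' s w * h (y + w) \<partial>lborel) \<partial>lborel) \<partial>lborel)"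
    by (rule nn_integral_swap) measurable
  also have "\<dots> = (\<integral>\<^sup>+y. p y * (\<integral>\<^sup>+w. h (y + w) * (\<integral>\<^sup>+s. k' s w \<partial>lborel) \<partial>lborel) \<partial>lborel)"
  proof (rule nn_integral_cong)
    fix y :: "real^3"
    have "(\<integral>\<^sup>+s. p y * (\<integral>\<^sup>+w. k' s w * h (y + w) \<partial>lborel) \<partial>lborel)
      = p y * (\<integral>\<^sup>+s. (\<integral>\<^sup>+w. k' s w * h (y + w) \<partial>lborel) \<partial>lborel)"
      by (subst nn_integral_cmult) auto
    also have "(\<integral>\<^sup>+s. (\<integral>\<^sup>+w. k' s w * h (y + w) \<partial>lborel) \<partial>lborel)
      = (\<integral>\<^sup>+w. (\<integral>\<^sup>+s. k' s w * h (y + w) \<partial>lborel) \<partial>lborel)"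
      by (rule nn_integral_swap) measurable
    also have "\<dots> = (\<integral>\<^sup>+w. h (y + w) * (\<integral>\<^sup>+s. k' s w \<partial>lborel) \<partial>lborel)"
      by (subst nn_integral_cmult[symmetric]) (auto simp: mult_ac)
    finally show "(\<integral>\<^sup>+s. p y * (\<integral>\<^sup>+w. k' s w * h (y + w) \<partial>lborel) \<partial>lborel)
      = p y * (\<integral>\<^sup>+w. h (y + w) * (\<integral>\<^sup>+s. k' s w \<partial>lborel) \<partial>lborel)" .
  qed
  also have "\<dots> \<le> (\<integral>\<^sup>+y. p y * (\<integral>\<^sup>+w. h (y + w) * ennreal (S^3/3 * (1 / (norm w)\<^sup>2)) \<partial>lborel) \<partial>lborel)"
  proof (rule nn_integral_mono, rule mult_left_mono, rule nn_integral_mono_AE)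
    fix y :: "real^3"
    have "AE w in lborel. w \<noteq> (0::real^3)" by (rule AE_lborel_singleton)
    then show "AE w in lborel. h (y + w) * (\<integral>\<^sup>+s. k' s w \<partial>lborel) \<le> h (y + w) * ennreal (S^3/3 * (1 / (norm w)\<^sup>2))"
    proof eventually_elim
      case (elim w)
      then have w: "norm w > 0" by simp
      \<comment> \<open>Only s > |w| / S contributes. Dropping the restriction s \<le> 1 leaves a
        pure power tail.\<close>
      have "(\<integral>\<^sup>+s. k' s w \<partial>lborel) \<le> (\<integral>\<^sup>+s. ennreal (norm w / 3) * (ennreal (real 3 / s ^ (3+1)) * indicator {norm w / S..} s) \<partial>lborel)"
      proof (rule nn_integral_mono)
        fix s
        show "k' s w \<le> ennreal (norm w / 3) * (ennreal (real 3 / s ^ (3+1)) * indicator {norm w / S..} s)"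
          using S by (auto simp: k'_def indicator_def ennreal_mult[symmetric] field_simps)
      qed
      also have "\<dots> = ennreal (norm w / 3) * ennreal (1 / (norm w / S)^3)"
        using nn_integral_power_tail[of "norm w / S" 3] w S by (subst nn_integral_cmult) auto
      also have "\<dots> = ennreal (S^3/3 * (1 / (norm w)\<^sup>2))"
        using w S by (simp add: ennreal_mult[symmetric] power_divide eval_nat_numeral)
      finally show ?case by (intro mult_left_mono) auto
    qed
  qed auto
  also have "\<dots> = ennreal (S^3/3) * (\<integral>\<^sup>+y. p y * (\<integral>\<^sup>+w. h (y + w) * ennreal (1 / (norm w)\<^sup>2) \<partial>lborel) \<partial>lborel)"
  proof -
    have "h (y + w) * ennreal (S^3/3 * (1 / (norm w)\<^sup>2)) = ennreal (S^3/3) * (h (y + w) * ennreal (1 / (norm w)\<^sup>2))" for y w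
      using S by (subst ennreal_mult) (auto simp: mult_ac)
    then have "(\<integral>\<^sup>+w. h (y + w) * ennreal (S^3/3 * (1 / (norm w)\<^sup>2)) \<partial>lborel)
      = ennreal (S^3/3) * (\<integral>\<^sup>+w. h (y + w) * ennreal (1 / (norm w)\<^sup>2) \<partial>lborel)" for y
      by (simp only:) (rule nn_integral_cmult, measurable)
    then have "p y * (\<integral>\<^sup>+w. h (y + w) * ennreal (S^3/3 * (1 / (norm w)\<^sup>2)) \<partial>lborel)
      = ennreal (S^3/3) * (p y * (\<integral>\<^sup>+w. h (y + w) * ennreal (1 / (norm w)\<^sup>2) \<partial>lborel))" for y
      by (simp only: mult.left_commute)
    then show ?thesis by (simp add: nn_integral_cmult)
  qed
  finally show ?thesis .
qed


text \<open>In the shift identity the directional derivative is moved from \<phi> to u at each time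
  s; then both terms are estimated by absolute values.\<close>

lemma weak_gradient_shift_bound:
  assumes g: "has_weak_gradient u g" and \<phi>: "test_function \<phi>" and nn: "\<And>x. 0 \<le> \<phi> x"
  shows "ennreal \<bar>LINT x|lborel. u x * \<phi> x\<bar> \<le> (\<integral>\<^sup>+x. ennreal \<bar>u x\<bar> * ennreal (\<phi> (x - v)) \<partial>lborel)
     + (\<integral>\<^sup>+s. indicator {0..1::real} s * (ennreal (norm v) * (\<integral>\<^sup>+x. ennreal (norm (g x)) * ennreal (\<phi> (x - s *\<^sub>R v)) \<partial>lborel)) \<partial>lborel)"
  (is "_ \<le> ?T1 + ?T2")
proof -
  note [measurable] = test_function_borel[OF \<phi>]
  have u: "locally_integrable u" and g': "locally_integrable g" using g by (auto simp: has_weak_gradient_def)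
  have [measurable]: "u \<in> borel_measurable borel" "g \<in> borel_measurable borel"
    using u g' by (auto simp: locally_integrable_def)
  have 1: "ennreal \<bar>LINT x|lborel. u x * \<phi> (x - v)\<bar> \<le> ?T1"
    using ennreal_abs_integral_le[of lborel "\<lambda>x. u x * \<phi> (x - v)"] nn by (simp add: abs_mult ennreal_mult)
  define W where "W s = (LINT x|lborel. u x * dir_deriv \<phi> v (x - s *\<^sub>R v))" for s
  have "ennreal \<bar>LINT s|lborel. indicator {0..1::real} s * W s\<bar> \<le> (\<integral>\<^sup>+s. ennreal \<bar>indicator {0..1::real} s * W s\<bar> \<partial>lborel)"
    by (rule ennreal_abs_integral_le)
  also have "\<dots> \<le> ?T2"
  proof (rule nn_integral_mono)
    fix s :: real
    have "ennreal \<bar>W s\<bar> = ennreal \<bar>LINT x|lborel. (g x \<bullet> v) * \<phi> (x - s *\<^sub>R v)\<bar>"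
      by (simp add: W_def weak_gradient_dir_deriv[OF g \<phi>])
    also have "\<dots> \<le> (\<integral>\<^sup>+x. ennreal \<bar>(g x \<bullet> v) * \<phi> (x - s *\<^sub>R v)\<bar> \<partial>lborel)"
      by (rule ennreal_abs_integral_le)
    also have "\<dots> \<le> (\<integral>\<^sup>+x. ennreal (norm v) * (ennreal (norm (g x)) * ennreal (\<phi> (x - s *\<^sub>R v))) \<partial>lborel)"
    proof (rule nn_integral_mono)
      fix x
      have "\<bar>(g x \<bullet> v) * \<phi> (x - s *\<^sub>R v)\<bar> \<le> norm v * (norm (g x) * \<phi> (x - s *\<^sub>R v))"
        using mult_right_mono[OF Cauchy_Schwarz_ineq2[of "g x" v] nn[of "x - s *\<^sub>R v"]] nn[of "x - s *\<^sub>R v"]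
        by (simp add: abs_mult mult_ac)
      then show "ennreal \<bar>(g x \<bullet> v) * \<phi> (x - s *\<^sub>R v)\<bar> \<le> ennreal (norm v) * (ennreal (norm (g x)) * ennreal (\<phi> (x - s *\<^sub>R v)))"
        by (simp add: nn ennreal_mult[symmetric] ennreal_leI)
    qed
    also have "\<dots> = ennreal (norm v) * (\<integral>\<^sup>+x. ennreal (norm (g x)) * ennreal (\<phi> (x - s *\<^sub>R v)) \<partial>lborel)"
      by (rule nn_integral_cmult) measurable
    finally show "ennreal \<bar>indicator {0..1::real} s * W s\<bar>
      \<le> indicator {0..1::real} s * (ennreal (norm v) * (\<integral>\<^sup>+x. ennreal (norm (g x)) * ennreal (\<phi> (x - s *\<^sub>R v)) \<partial>lborel))"
      by (auto simp: indicator_def)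
  qed
  finally have 2: "ennreal \<bar>LINT s|lborel. indicator {0..1::real} s * W s\<bar>
     \<le> ?T2" .
  have "\<bar>LINT x|lborel. u x * \<phi> x\<bar> \<le> \<bar>LINT x|lborel. u x * \<phi> (x - v)\<bar> + \<bar>LINT s|lborel. indicator {0..1::real} s * W s\<bar>"
    using shift_identity[OF u \<phi>, of v] by (simp add: W_def)
  then have "ennreal \<bar>LINT x|lborel. u x * \<phi> x\<bar> \<le> ennreal \<bar>LINT x|lborel. u x * \<phi> (x - v)\<bar> + ennreal \<bar>LINT s|lborel. indicator {0..1::real} s * W s\<bar>"
    by (simp add: ennreal_leI flip: ennreal_plus)
  also note add_mono[OF 1 2]
  finally show ?thesis .
qed

section \<open>The Riesz potential of order one and the pointwise bound by it\<close>

definition riesz :: "(real^3 \<Rightarrow> real) \<Rightarrow> real^3 \<Rightarrow> ennreal" where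
  "riesz f y = (\<integral>\<^sup>+w. ennreal (f (y + w)) * ennreal (1 / (norm w)\<^sup>2) \<partial>lborel)"

lemma borel_measurable_riesz [measurable (raw)]:
  assumes [measurable]: "f \<in> borel_measurable borel" "h \<in> borel_measurable M"
  shows "(\<lambda>x. riesz f (h x)) \<in> borel_measurable M"
  unfolding riesz_def by measurable

text \<open>Averaged over |v| < S, the gradient term contributes S^3/3 times the potential, against
  the volume 4/3 pi S^3 on the left; the quotient is the 4 pi. The shifted term is a multiple of the
  integral of |u| over a ball of radius S + r', which square integrability makes of order S^2,
  negligible against S^3.\<close>

lemma riesz_weak_bound:
  assumes g: "has_weak_gradient u g" and sq: "square_integrable u"
    and \<phi>: "test_function \<phi>" and nn: "\<And>x. 0 \<le> \<phi> x"
  shows "ennreal (4 * pi * \<bar>LINT x|lborel. u x * \<phi> x\<bar>) \<le> (\<integral>\<^sup>+y. ennreal (\<phi> y) * riesz (\<lambda>x. norm (g x)) y \<partial>lborel)"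
proof -
  define J where "J = (\<integral>\<^sup>+y. ennreal (\<phi> y) * riesz (\<lambda>x. norm (g x)) y \<partial>lborel)"
  define c where "c = \<bar>LINT x|lborel. u x * \<phi> x\<bar>"
  note [measurable] = test_function_borel[OF \<phi>]
  have [measurable]: "u \<in> borel_measurable borel" "g \<in> borel_measurable borel"
    using g by (auto simp: has_weak_gradient_def locally_integrable_def)
  define D where "D = (LINT x|lborel. (u x)\<^sup>2)"
  have D: "(\<integral>\<^sup>+x. ennreal ((u x)\<^sup>2) \<partial>lborel) = ennreal D"
    unfolding D_def using sq by (intro nn_integral_eq_integral) (auto simp: square_integrable_def)
  have D0: "D \<ge> 0" by (simp add: D_def)
  obtain M r where M: "M > 0" "\<And>x. \<bar>\<phi> x\<bar> \<le> M * indicator (cball 0 r) x"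
    using test_function_indicator_bound[OF \<phi>] by metis
  define r' where "r' = max r 0"
  have supp: "\<phi> x = 0" if "norm x > r'" for x
    using M(2)[of x] that by (auto simp: r'_def)
  have r': "r' \<ge> 0" by (simp add: r'_def)
  define \<Phi> where "\<Phi> = (LINT x|lborel. \<phi> x)"
  have \<Phi>: "(\<integral>\<^sup>+x. ennreal (\<phi> x) \<partial>lborel) = ennreal \<Phi>"
    unfolding \<Phi>_def using integrable_mult_test[OF locally_integrable_const[of 1] \<phi>] nn
    by (intro nn_integral_eq_integral) auto
  have \<Phi>0: "\<Phi> \<ge> 0" by (simp add: \<Phi>_def nn)
  let ?U = "\<lambda>v. \<integral>\<^sup>+x. ennreal \<bar>u x\<bar> * ennreal (\<phi> (x - v)) \<partial>lborel"
  have main: "4/3 * pi * c * S^3 \<le> \<Phi> * (S * D + 4/3 * pi * (S + r')^3 / S) + S^3/3 * j"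
    if S: "S > 0" and j: "J = ennreal j" "j \<ge> 0" for S j
  proof -
    define T where "T v = (\<integral>\<^sup>+s. indicator {0..1::real} s * (ennreal (norm v) * (\<integral>\<^sup>+x. ennreal (norm (g x)) * ennreal (\<phi> (x - s *\<^sub>R v)) \<partial>lborel)) \<partial>lborel)" for v
    have [measurable]: "T \<in> borel_measurable borel" unfolding T_def by measurable
    have [measurable]: "ball (0::real^3) S \<in> sets borel" "cball (0::real^3) (S + r') \<in> sets borel" by auto
    have "ennreal (4/3 * pi * c * S^3) = ennreal c * emeasure lborel (ball (0::real^3) S)"
      using S by (simp add: emeasure_ball_3 ennreal_mult[symmetric] c_def mult_ac)
    also have "\<dots> = (\<integral>\<^sup>+v. indicator (ball (0::real^3) S) v * ennreal c \<partial>lborel)"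
      by (subst nn_integral_multc) (auto simp: mult.commute)
    also have "\<dots> \<le> (\<integral>\<^sup>+v. indicator (ball 0 S) v * ?U v + indicator (ball 0 S) v * T v \<partial>lborel)"
      unfolding c_def T_def distrib_left[symmetric]
      by (intro nn_integral_mono mult_left_mono weak_gradient_shift_bound[OF g \<phi> nn]) auto
    also have "\<dots> = (\<integral>\<^sup>+v. indicator (ball 0 S) v * ?U v \<partial>lborel) + (\<integral>\<^sup>+v. indicator (ball 0 S) v * T v \<partial>lborel)"
      by (rule nn_integral_add) auto
    also have "\<dots> \<le> ennreal (\<Phi> * (S * D + 4/3 * pi * (S + r')^3 / S)) + ennreal (S^3/3) * J"
    proof (rule add_mono)
      show "(\<integral>\<^sup>+v. indicator (ball 0 S) v * T v \<partial>lborel) \<le> ennreal (S^3/3) * J"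
        unfolding T_def J_def riesz_def by (rule averaged_shift_bound[OF _ _ S]) auto
      have "(\<integral>\<^sup>+v. indicator (ball 0 S) v * ?U v \<partial>lborel)
        \<le> (\<integral>\<^sup>+v. (\<integral>\<^sup>+x. (ennreal \<bar>u x\<bar> * indicator (cball 0 (S + r')) x) * ennreal (\<phi> (x - v)) \<partial>lborel) \<partial>lborel)"
      proof (rule nn_integral_mono)
        fix v
        have "\<phi> (x - v) = 0" if "norm v < S" "norm x > S + r'" for x
          using that norm_triangle_ineq2[of x v] by (intro supp) auto
        then show "indicator (ball 0 S) v * ?U v
         \<le> (\<integral>\<^sup>+x. (ennreal \<bar>u x\<bar> * indicator (cball 0 (S + r')) x) * ennreal (\<phi> (x - v)) \<partial>lborel)"
          by (cases "norm v < S") (auto intro!: nn_integral_mono simp: indicator_def)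
      qed
      also have "\<dots> = (\<integral>\<^sup>+x. (\<integral>\<^sup>+v. (ennreal \<bar>u x\<bar> * indicator (cball 0 (S + r')) x) * ennreal (\<phi> (x - v)) \<partial>lborel) \<partial>lborel)"
        by (rule nn_integral_swap) measurable
      also have "\<dots> = (\<integral>\<^sup>+x. (ennreal \<bar>u x\<bar> * indicator (cball 0 (S + r')) x) * ennreal \<Phi> \<partial>lborel)"
        by (subst nn_integral_cmult) (auto simp: nn_integral_reflect[of "\<lambda>x. ennreal (\<phi> x)"] \<Phi>)
      \<comment> \<open>By |u| \<le> S u^2 + 1/S the integral over the ball is at most S times the
        mass plus the volume divided by S.\<close>
      also have "\<dots> \<le> (\<integral>\<^sup>+x. (ennreal (S * (u x)\<^sup>2) + ennreal (1/S) * indicator (cball 0 (S + r')) x) * ennreal \<Phi> \<partial>lborel)"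
      proof (rule nn_integral_mono, rule mult_right_mono)
        fix x
        have "0 \<le> (S * \<bar>u x\<bar> - 1/2)\<^sup>2" by simp
        then have "S * \<bar>u x\<bar> \<le> S\<^sup>2 * (u x)\<^sup>2 + 1/4"
          by (simp add: power2_diff power_mult_distrib power_one_over)
        then have "S * \<bar>u x\<bar> \<le> S * (S * (u x)\<^sup>2 + 1/S)" using S by (simp add: power2_eq_square distrib_left mult.assoc)
        then have "\<bar>u x\<bar> \<le> S * (u x)\<^sup>2 + 1/S" using S by simp
        then show "ennreal \<bar>u x\<bar> * indicator (cball 0 (S + r')) x
          \<le> ennreal (S * (u x)\<^sup>2) + ennreal (1/S) * indicator (cball 0 (S + r')) x"
          using S by (auto simp: indicator_def ennreal_leI simp flip: ennreal_plus)
      qed simp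
      also have "\<dots> = ((\<integral>\<^sup>+x. ennreal (S * (u x)\<^sup>2) \<partial>lborel) + ennreal (1/S) * emeasure lborel (cball (0::real^3) (S + r'))) * ennreal \<Phi>"
        by (subst nn_integral_multc; (subst nn_integral_add)?; (subst nn_integral_cmult_indicator)?) auto
      also have "(\<integral>\<^sup>+x. ennreal (S * (u x)\<^sup>2) \<partial>lborel) = ennreal (S * D)"
        using S D D0 by (simp add: ennreal_mult nn_integral_cmult)
      also have "(ennreal (S * D) + ennreal (1/S) * emeasure lborel (cball (0::real^3) (S + r'))) * ennreal \<Phi>
         = ennreal (\<Phi> * (S * D + 4/3 * pi * (S + r')^3 / S))"
        using S D0 r' \<Phi>0 by (simp add: emeasure_cball_3 ennreal_mult[symmetric] ennreal_plus[symmetric] mult_ac del: ennreal_plus)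
      finally show "(\<integral>\<^sup>+v. indicator (ball 0 S) v * ?U v \<partial>lborel)
         \<le> ennreal (\<Phi> * (S * D + 4/3 * pi * (S + r')^3 / S))" .
    qed
    also have "\<dots> = ennreal (\<Phi> * (S * D + 4/3 * pi * (S + r')^3 / S) + S^3/3 * j)"
      using S D0 r' \<Phi>0 j by (simp add: ennreal_mult[symmetric] ennreal_plus)
    finally show ?thesis
      using S D0 r' \<Phi>0 j by (subst (asm) ennreal_le_iff) auto
  qed
  show ?thesis
  proof (cases J)
    case (real j)
    have bd: "4/3 * pi * c \<le> \<Phi> * (D / S^2 + 4/3 * pi * (1 + r'/S)^3 / S) + j / 3" if "S > 0" for S
    proof -
      have "(4/3 * pi * c) * S^3 \<le> (\<Phi> * (D / S^2 + 4/3 * pi * (1 + r'/S)^3 / S) + j / 3) * S^3"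
      proof -
        have "(1 + r'/S)^3 * S^3 = (S + r')^3"
          using that by (simp add: power_mult_distrib[symmetric] distrib_right)
        then have "(\<Phi> * (D / S^2 + 4/3 * pi * (1 + r'/S)^3 / S) + j / 3) * S^3 = \<Phi> * (S * D + 4/3 * pi * (S + r')^3 / S) + S^3/3 * j"
          using that by (simp add: field_simps eval_nat_numeral)
        then show ?thesis using main[OF that, of j] real by (simp add: J_def)
      qed
      then show ?thesis using that by simp
    qed
    have lim: "((\<lambda>S. \<Phi> * (D / S^2 + 4/3 * pi * (1 + r'/S)^3 / S) + j / 3) \<longlongrightarrow> \<Phi> * (0 + 0) + j/3) at_top"
    proof (intro tendsto_intros)
      show "((\<lambda>S. D / S\<^sup>2) \<longlongrightarrow> 0) at_top"
        by (intro tendsto_divide_0[OF tendsto_const] filterlim_at_top_imp_at_infinity filterlim_pow_at_top filterlim_ident) auto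
      have "((\<lambda>S. r' / S) \<longlongrightarrow> 0) at_top"
        by (intro tendsto_divide_0[OF tendsto_const] filterlim_at_top_imp_at_infinity filterlim_ident)
      then have "((\<lambda>S. 4/3 * pi * (1 + r'/S)^3) \<longlongrightarrow> 4/3 * pi * (1 + 0)^3) at_top"
        by (intro tendsto_intros)
      then show "((\<lambda>S. 4/3 * pi * (1 + r'/S)^3 / S) \<longlongrightarrow> 0) at_top"
        by (rule tendsto_divide_0) (intro filterlim_at_top_imp_at_infinity filterlim_ident)
    qed
    have "\<forall>\<^sub>F S in at_top. 4/3 * pi * c \<le> \<Phi> * (D / S^2 + 4/3 * pi * (1 + r'/S)^3 / S) + j / 3"
      by (rule eventually_mono[OF eventually_gt_at_top[of 0] bd])
    from tendsto_lowerbound[OF lim this] have "4/3 * pi * c \<le> \<Phi> * (0 + 0) + j/3"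
      by simp
    then have "4 * pi * c \<le> j" by simp
    then have "ennreal (4 * pi * c) \<le> J" using real by (simp add: ennreal_leI)
    then show ?thesis by (simp add: c_def J_def)
  qed (simp add: J_def)
qed

lemma nn_integral_inverse_square_unit_ball:
  "(\<integral>\<^sup>+w. ennreal (1 / (norm w)\<^sup>2) * indicator (ball (0::real^3) 1) w \<partial>lborel) \<le> ennreal (4 * pi)"
  using nn_integral_inverse_square_ball[of 1] by simp

text \<open>The kernel is split at |w| = 1. Near the origin it is integrable and f \<le> 1 + f^2;
  far away its square |w|^-4 is integrable, and the product of f and the kernel is at most the sum
  of their squares. Only the near term with f^2 depends on y, and it is a convolution of two
  integrable functions.\<close>

lemma riesz_local_integral_finite:
  assumes [measurable]: "f \<in> borel_measurable borel"
    and fin: "(\<integral>\<^sup>+x. ennreal ((f x)\<^sup>2) \<partial>lborel) < \<infinity>" and f0: "\<And>x. 0 \<le> f x"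
  shows "(\<integral>\<^sup>+y. riesz f y * indicator (cball 0 R) y \<partial>lborel) < \<infinity>"
proof -
  have [measurable]: "ball (0::real^3) 1 \<in> sets borel" "- ball (0::real^3) 1 \<in> sets borel" "cball (0::real^3) R \<in> sets borel" by auto
  define A where "A = (\<integral>\<^sup>+x. ennreal ((f x)\<^sup>2) \<partial>lborel)"
  define a where "a w = ennreal (1 / (norm w)\<^sup>2) * indicator (ball (0::real^3) 1) w" for w
  define a' where "a' w = ennreal (1 / (norm w)^4) * indicator (- ball (0::real^3) 1) w" for w
  have [measurable]: "a \<in> borel_measurable borel" "a' \<in> borel_measurable borel"
    unfolding a_def a'_def by measurable
  define J where "J y = (\<integral>\<^sup>+w. ennreal ((f (y + w))\<^sup>2) * a w \<partial>lborel)" for y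
  have [measurable]: "J \<in> borel_measurable borel" unfolding J_def by measurable
  define C where "C = (\<integral>\<^sup>+w. a w \<partial>lborel) + A + (\<integral>\<^sup>+w. a' w \<partial>lborel)"
  have C: "C < \<infinity>"
    using nn_integral_inverse_square_unit_ball nn_integral_inverse_fourth_outside[of 1] fin
    by (auto simp: C_def a_def a'_def A_def intro: le_less_trans)
  have "riesz f y \<le> C + J y" for y
  proof -
    have "riesz f y \<le> (\<integral>\<^sup>+w. (a w + ennreal ((f (y + w))\<^sup>2) * a w) + (ennreal ((f (y + w))\<^sup>2) + a' w) \<partial>lborel)"
      unfolding riesz_def
    proof (rule nn_integral_mono)
      fix w :: "real^3"
      define s where "s = f (y + w)"
      have s: "s \<ge> 0" by (simp add: s_def f0)
      show "ennreal (f (y + w)) * ennreal (1 / (norm w)\<^sup>2)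
         \<le> (a w + ennreal ((f (y + w))\<^sup>2) * a w) + (ennreal ((f (y + w))\<^sup>2) + a' w)"
        unfolding s_def[symmetric]
      proof (cases "norm w < 1")
        case True
        have "0 \<le> (s - 1/2)\<^sup>2" by simp
        then have "s \<le> 1 + s\<^sup>2" by (simp add: power2_diff power_one_over)
        then have "s * (1 / (norm w)\<^sup>2) \<le> (1 + s\<^sup>2) * (1 / (norm w)\<^sup>2)" by (intro mult_right_mono) auto
        then have "s * (1 / (norm w)\<^sup>2) \<le> 1 / (norm w)\<^sup>2 + s\<^sup>2 * (1 / (norm w)\<^sup>2)"
          by (simp only: distrib_right mult_1_left)
        then have "ennreal s * ennreal (1 / (norm w)\<^sup>2) \<le> a w + ennreal (s\<^sup>2) * a w"
          using True s by (simp add: a_def ennreal_mult[symmetric] ennreal_plus[symmetric] ennreal_leI del: ennreal_plus)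
        then show "ennreal s * ennreal (1 / (norm w)\<^sup>2) \<le> (a w + ennreal (s\<^sup>2) * a w) + (ennreal (s\<^sup>2) + a' w)"
          by (simp add: add_increasing2)
      next
        case False
        define q where "q = 1 / (norm w)\<^sup>2"
        have "0 \<le> (s - q)\<^sup>2" by simp
        then have "2 * (s * q) \<le> s\<^sup>2 + q\<^sup>2" by (simp add: power2_diff)
        moreover have "0 \<le> s * q" using s by (simp add: q_def)
        ultimately have "s * q \<le> s\<^sup>2 + q\<^sup>2" by linarith
        also have "q\<^sup>2 = 1 / (norm w)^4" by (simp add: q_def power_divide flip: power_mult)
        finally have "ennreal s * ennreal (1 / (norm w)\<^sup>2) \<le> ennreal (s\<^sup>2) + a' w"
          using False s by (simp add: q_def a'_def ennreal_mult[symmetric] ennreal_plus[symmetric] ennreal_leI del: ennreal_plus)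
        then show "ennreal s * ennreal (1 / (norm w)\<^sup>2) \<le> (a w + ennreal (s\<^sup>2) * a w) + (ennreal (s\<^sup>2) + a' w)"
          by (simp add: add_increasing)
      qed
    qed
    also have "\<dots> = ((\<integral>\<^sup>+w. a w \<partial>lborel) + J y) + ((\<integral>\<^sup>+w. ennreal ((f (y + w))\<^sup>2) \<partial>lborel) + (\<integral>\<^sup>+w. a' w \<partial>lborel))"
      unfolding J_def by (simp add: nn_integral_add)
    also have "(\<integral>\<^sup>+w. ennreal ((f (y + w))\<^sup>2) \<partial>lborel) = A"
      unfolding A_def using nn_integral_translate[of "\<lambda>w. ennreal ((f w)\<^sup>2)" y] by (simp add: add.commute)
    finally show ?thesis by (simp add: C_def ac_simps)
  qed
  then have "(\<integral>\<^sup>+y. riesz f y * indicator (cball 0 R) y \<partial>lborel) \<le> (\<integral>\<^sup>+y. C * indicator (cball 0 R) y + J y \<partial>lborel)"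
    by (intro nn_integral_mono) (auto simp: indicator_def)
  also have "\<dots> = C * emeasure lborel (cball (0::real^3) R) + (\<integral>\<^sup>+y. J y \<partial>lborel)"
    by (subst nn_integral_add) (auto simp: nn_integral_cmult_indicator)
  also have "(\<integral>\<^sup>+y. J y \<partial>lborel) = (\<integral>\<^sup>+w. (\<integral>\<^sup>+y. ennreal ((f (y + w))\<^sup>2) * a w \<partial>lborel) \<partial>lborel)"
    unfolding J_def by (rule nn_integral_swap) measurable
  also have "\<dots> = (\<integral>\<^sup>+w. A * a w \<partial>lborel)"
    by (simp add: nn_integral_multc nn_integral_translate[of "\<lambda>y. ennreal ((f y)\<^sup>2)"] A_def)
  also have "\<dots> = A * (\<integral>\<^sup>+w. a w \<partial>lborel)" by (simp add: nn_integral_cmult)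
  finally have "(\<integral>\<^sup>+y. riesz f y * indicator (cball 0 R) y \<partial>lborel)
    \<le> C * emeasure lborel (cball (0::real^3) R) + A * (\<integral>\<^sup>+w. a w \<partial>lborel)" .
  also have "\<dots> < \<infinity>"
    using C fin nn_integral_inverse_square_unit_ball emeasure_lborel_cball_finite[of "0::real^3" R]
    by (auto simp: ennreal_mult_less_top a_def A_def intro: le_less_trans)
  finally show ?thesis .
qed

lemma riesz_finite_AE:
  assumes [measurable]: "f \<in> borel_measurable borel"
    and "(\<integral>\<^sup>+x. ennreal ((f x)\<^sup>2) \<partial>lborel) < \<infinity>" "\<And>x. 0 \<le> f x"
  shows "AE y in lborel. riesz f y < \<infinity>"
proof -
  have [measurable]: "riesz f \<in> borel_measurable borel" "cball (0::real^3) (real n) \<in> sets borel" for n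
    using borel_measurable_riesz[of f "\<lambda>x. x" borel] by simp_all
  have "AE y in lborel. riesz f y * indicator (cball 0 (real n)) y \<noteq> \<infinity>" for n
    using riesz_local_integral_finite[OF assms, of n] by (intro nn_integral_PInf_AE) auto
  then have "AE y in lborel. \<forall>n. riesz f y * indicator (cball 0 (real n)) y \<noteq> \<infinity>"
    unfolding AE_all_countable by blast
  then show ?thesis
  proof eventually_elim
    case (elim y)
    obtain n where "norm y \<le> real n" using real_arch_simple by blast
    then show ?case using elim[rule_format, of n] by (simp add: less_top)
  qed
qed

lemma square_integrable_nn_integral:
  "square_integrable f \<Longrightarrow> (\<integral>\<^sup>+x. ennreal ((norm (f x))\<^sup>2) \<partial>lborel) = ennreal (LINT x|lborel. (norm (f x))\<^sup>2)"
  by (intro nn_integral_eq_integral) (auto simp: square_integrable_def)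

text \<open>The fundamental lemma turns the bound against nonnegative test functions into one almost
  everywhere. It is applied to Q - u and Q + u, where Q is the potential divided by 4 pi; local
  integrability of the potential makes this legitimate.\<close>

lemma riesz_pointwise_bound:
  assumes g: "has_weak_gradient u g" and sq: "square_integrable u" "square_integrable g"
  shows "AE y in lborel. ennreal (4 * pi * \<bar>u y\<bar>) \<le> riesz (\<lambda>x. norm (g x)) y"
proof -
  have u: "locally_integrable u" using g by (simp add: has_weak_gradient_def)
  have [measurable]: "u \<in> borel_measurable borel" "g \<in> borel_measurable borel"
    using g by (auto simp: has_weak_gradient_def locally_integrable_def)
  let ?r = "riesz (\<lambda>x. norm (g x))"
  have fin: "(\<integral>\<^sup>+x. ennreal ((norm (g x))\<^sup>2) \<partial>lborel) < \<infinity>"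
    by (simp add: square_integrable_nn_integral[OF sq(2)])
  have AEfin: "AE y in lborel. ?r y < \<infinity>"
    by (rule riesz_finite_AE[OF _ fin]) auto
  define Q where "Q y = enn2real (?r y) / (4 * pi)" for y
  have [measurable]: "Q \<in> borel_measurable borel" unfolding Q_def by measurable
  have Q0: "Q y \<ge> 0" for y by (simp add: Q_def)
  have Q: "AE y in lborel. ennreal (4 * pi * Q y) = ?r y"
    using AEfin by eventually_elim (simp add: Q_def)
  have lQ: "locally_integrable Q"
    unfolding locally_integrable_def
  proof (intro conjI allI impI)
    fix K :: "(real^3) set" assume K: "compact K"
    then have [measurable]: "K \<in> sets borel" by (simp add: compact_imp_closed)
    obtain R where R: "K \<subseteq> cball 0 R" using compact_imp_bounded[OF K] by (auto simp: bounded_iff subset_iff)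
    have "(\<integral>\<^sup>+y. ennreal (norm (indicator K y *\<^sub>R Q y)) \<partial>lborel) \<le> (\<integral>\<^sup>+y. ?r y * indicator (cball 0 R) y \<partial>lborel)"
    proof (rule nn_integral_mono_AE)
      show "AE y in lborel. ennreal (norm (indicator K y *\<^sub>R Q y)) \<le> ?r y * indicator (cball 0 R) y"
        using Q
      proof eventually_elim
        case (elim y)
        have "Q y \<le> 4 * pi * Q y" using Q0[of y] pi_ge_two mult_right_mono[of 1 "4 * pi" "Q y"] by simp
        then have "ennreal (Q y) \<le> ?r y" using elim ennreal_leI by metis
        then show ?case using R Q0[of y] by (auto simp: indicator_def)
      qed
    qed
    also have "\<dots> < \<infinity>" by (rule riesz_local_integral_finite[OF _ fin]) auto
    finally show "set_integrable lborel K Q"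
      unfolding set_integrable_def integrable_iff_bounded by simp
  qed simp
  have sign: "AE y in lborel. 0 \<le> Q y - \<sigma> * u y" if \<sigma>: "\<bar>\<sigma>\<bar> = 1" for \<sigma>
  proof (rule fundamental_lemma_nonneg)
    have \<sigma>u: "locally_integrable (\<lambda>y. \<sigma> * u y)"
      using u by (auto simp: locally_integrable_def set_integrable_def mult.left_commute)
    then show "locally_integrable (\<lambda>y. Q y - \<sigma> * u y)"
      by (rule locally_integrable_diff[OF lQ])
    fix \<phi> assume \<phi>: "test_function \<phi>" and nn: "\<And>x. 0 \<le> \<phi> x"
    note [measurable] = test_function_borel[OF \<phi>]
    have "ennreal (4 * pi * \<bar>LINT x|lborel. u x * \<phi> x\<bar>) \<le> (\<integral>\<^sup>+y. ennreal (\<phi> y) * ?r y \<partial>lborel)"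
      by (rule riesz_weak_bound[OF g sq(1) \<phi> nn])
    also have "\<dots> = (\<integral>\<^sup>+y. ennreal (4 * pi * (Q y * \<phi> y)) \<partial>lborel)"
    proof (rule nn_integral_cong_AE)
      show "AE y in lborel. ennreal (\<phi> y) * ?r y = ennreal (4 * pi * (Q y * \<phi> y))"
        using Q
      proof eventually_elim
        case (elim y)
        then show ?case
          using nn[of y] Q0[of y] by (simp add: elim[symmetric] ennreal_mult[symmetric] mult_ac)
      qed
    qed
    also have "\<dots> = ennreal (4 * pi * (LINT y|lborel. Q y * \<phi> y))"
      using integrable_mult_test[OF lQ \<phi>] by (subst nn_integral_eq_integral) (auto simp: nn Q0)
    finally have "\<bar>LINT x|lborel. u x * \<phi> x\<bar> \<le> (LINT y|lborel. Q y * \<phi> y)"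
      by (subst (asm) ennreal_le_iff) (auto simp: nn Q0)
    moreover have "\<sigma> * (LINT x|lborel. u x * \<phi> x) \<le> \<bar>LINT x|lborel. u x * \<phi> x\<bar>"
      using \<sigma> abs_ge_self[of "\<sigma> * (LINT x|lborel. u x * \<phi> x)"] by (simp add: abs_mult)
    moreover have "(LINT x|lborel. (Q x - \<sigma> * u x) * \<phi> x) = (LINT x|lborel. Q x * \<phi> x) - \<sigma> * (LINT x|lborel. u x * \<phi> x)"
      using integrable_mult_test[OF lQ \<phi>] integrable_mult_test[OF u \<phi>]
      by (simp add: left_diff_distrib mult.assoc)
    ultimately show "0 \<le> (LINT x|lborel. (Q x - \<sigma> * u x) * \<phi> x)" by linarith
  qed
  have s: "AE y in lborel. 0 \<le> Q y - 1 * u y" "AE y in lborel. 0 \<le> Q y - (-1) * u y"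
    by (rule sign; simp)+
  show ?thesis
    using s Q
  proof eventually_elim
    case (elim y)
    then have "4 * pi * \<bar>u y\<bar> \<le> 4 * pi * Q y" by (intro mult_left_mono) auto
    then show ?case using elim ennreal_leI by metis
  qed
qed

section \<open>Duality between the gradient and the Coulomb energy\<close>

definition coulomb :: "(real^3 \<Rightarrow> real) \<Rightarrow> ennreal" where
  "coulomb w = (\<integral>\<^sup>+x. \<integral>\<^sup>+y. ennreal (w x) * ennreal (w y) * ennreal (1 / norm (x - y)) \<partial>lborel \<partial>lborel)"

text \<open>P is an extended real because it will be a potential that is not known to be
  finite.\<close>

lemma ennreal_young:
  assumes "l > 0" "s \<ge> 0"
  shows "2 * (ennreal s * P) \<le> ennreal l * ennreal (s\<^sup>2) + ennreal (1 / l) * P\<^sup>2"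
proof (cases P)
  case (real q)
  have "0 \<le> (l * s - q)\<^sup>2 / l" using assms by simp
  also have "\<dots> = l * s\<^sup>2 + 1 / l * q\<^sup>2 - 2 * (s * q)"
    using assms by (simp add: power2_diff field_simps power2_eq_square)
  finally have "ennreal (2 * (s * q)) \<le> ennreal (l * s\<^sup>2 + 1 / l * q\<^sup>2)" by (intro ennreal_leI) simp
  also have "ennreal (l * s\<^sup>2 + 1 / l * q\<^sup>2) = ennreal l * ennreal (s\<^sup>2) + ennreal (1 / l) * P\<^sup>2"
    using real assms by (simp add: ennreal_plus ennreal_power ennreal_mult[symmetric] del: times_divide_eq_left)
  also have "ennreal (2 * (s * q)) = 2 * (ennreal s * P)"
    using real assms by (simp add: ennreal_mult)
  finally show ?thesis .
next
  case top
  then show ?thesis using assms by (simp add: ennreal_mult_top power2_eq_square)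
qed

text \<open>The kernel is symmetric, so the potential can be moved from |g| to w, and Young's
  inequality then separates g from w. The weight l stays free: the cubic bound takes 8 pi, the
  Gagliardo-Nirenberg estimate a value that depends on u.\<close>

lemma riesz_duality:
  assumes g: "has_weak_gradient u g" and sq: "square_integrable u" "square_integrable g"
    and [measurable]: "w \<in> borel_measurable borel" and w: "\<And>x. 0 \<le> w x" and l: "l > 0"
  shows "ennreal (8 * pi) * (\<integral>\<^sup>+x. ennreal (\<bar>u x\<bar> * w x) \<partial>lborel)
    \<le> ennreal l * ennreal (LINT x|lborel. (norm (g x))\<^sup>2) + ennreal (112/3 * pi / l) * coulomb w"
proof -
  let ?U = "\<integral>\<^sup>+x. ennreal (\<bar>u x\<bar> * w x) \<partial>lborel"
  have [measurable]: "u \<in> borel_measurable borel" "g \<in> borel_measurable borel"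
    using g by (auto simp: has_weak_gradient_def locally_integrable_def)
  define k where "k x y = ennreal (1 / (norm (x - y))\<^sup>2)" for x y :: "real^3"
  have ks: "k x y = k y x" for x y by (simp add: k_def norm_minus_commute)
  have [measurable (raw)]: "(\<lambda>q. k (f q) (h q)) \<in> borel_measurable M"
    if [measurable]: "f \<in> borel_measurable M" "h \<in> borel_measurable M" for f h and M :: "'m measure"
    unfolding k_def by measurable
  define P where "P x = (\<integral>\<^sup>+y. ennreal (w y) * k x y \<partial>lborel)" for x
  have [measurable]: "P \<in> borel_measurable borel" unfolding P_def by measurable
  have rz: "riesz (\<lambda>x. norm (g x)) y = (\<integral>\<^sup>+x. ennreal (norm (g x)) * k x y \<partial>lborel)" for y
    unfolding riesz_def k_def
    using nn_integral_translate[of "\<lambda>x. ennreal (norm (g x)) * ennreal (1 / (norm (x - y))\<^sup>2)" y]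
    by (simp add: add.commute)
  have "ennreal (4 * pi) * ?U = (\<integral>\<^sup>+y. ennreal (4 * pi * \<bar>u y\<bar>) * ennreal (w y) \<partial>lborel)"
    by (subst nn_integral_cmult[symmetric]) (auto simp: w ennreal_mult[symmetric] mult_ac)
  also have "\<dots> \<le> (\<integral>\<^sup>+y. riesz (\<lambda>x. norm (g x)) y * ennreal (w y) \<partial>lborel)"
    using riesz_pointwise_bound[OF g sq]
    by (intro nn_integral_mono_AE, eventually_elim) (intro mult_right_mono, auto)
  also have "\<dots> = (\<integral>\<^sup>+y. (\<integral>\<^sup>+x. ennreal (norm (g x)) * (ennreal (w y) * k x y) \<partial>lborel) \<partial>lborel)"
    unfolding rz by (subst nn_integral_multc[symmetric]) (auto simp: mult_ac)
  also have "\<dots> = (\<integral>\<^sup>+x. (\<integral>\<^sup>+y. ennreal (norm (g x)) * (ennreal (w y) * k x y) \<partial>lborel) \<partial>lborel)"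
    by (rule nn_integral_swap) measurable
  also have "\<dots> = (\<integral>\<^sup>+x. ennreal (norm (g x)) * P x \<partial>lborel)"
    unfolding P_def by (simp add: nn_integral_cmult)
  finally have 1: "ennreal (4 * pi) * ?U \<le> (\<integral>\<^sup>+x. ennreal (norm (g x)) * P x \<partial>lborel)" .
  \<comment> \<open>The square is expanded into a double integral over y and z; integrating over x
    first leaves the kernel convolved with itself.\<close>
  have "(\<integral>\<^sup>+x. (P x)\<^sup>2 \<partial>lborel) = (\<integral>\<^sup>+x. (\<integral>\<^sup>+y. (\<integral>\<^sup>+z. (ennreal (w y) * ennreal (w z)) * (k x y * k x z) \<partial>lborel) \<partial>lborel) \<partial>lborel)"
  proof (rule nn_integral_cong)
    fix x
    have "(P x)\<^sup>2 = (\<integral>\<^sup>+y. ennreal (w y) * k x y * P x \<partial>lborel)"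
      by (subst nn_integral_multc) (auto simp: P_def power2_eq_square)
    also have "\<dots> = (\<integral>\<^sup>+y. (\<integral>\<^sup>+z. (ennreal (w y) * k x y) * (ennreal (w z) * k x z) \<partial>lborel) \<partial>lborel)"
      by (subst nn_integral_cmult) (auto simp: P_def)
    finally show "(P x)\<^sup>2 = (\<integral>\<^sup>+y. (\<integral>\<^sup>+z. (ennreal (w y) * ennreal (w z)) * (k x y * k x z) \<partial>lborel) \<partial>lborel)"
      by (simp add: mult_ac)
  qed
  also have "\<dots> = (\<integral>\<^sup>+y. (\<integral>\<^sup>+x. (\<integral>\<^sup>+z. (ennreal (w y) * ennreal (w z)) * (k x y * k x z) \<partial>lborel) \<partial>lborel) \<partial>lborel)"
    by (rule nn_integral_swap) measurable
  also have "\<dots> = (\<integral>\<^sup>+y. (\<integral>\<^sup>+z. (\<integral>\<^sup>+x. (ennreal (w y) * ennreal (w z)) * (k x y * k x z) \<partial>lborel) \<partial>lborel) \<partial>lborel)"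
    by (intro nn_integral_cong nn_integral_swap) measurable
  also have "\<dots> = (\<integral>\<^sup>+y. (\<integral>\<^sup>+z. (ennreal (w y) * ennreal (w z)) * (\<integral>\<^sup>+x. k x y * k x z \<partial>lborel) \<partial>lborel) \<partial>lborel)"
    by (subst nn_integral_cmult) auto
  also have "\<dots> \<le> (\<integral>\<^sup>+y. (\<integral>\<^sup>+z. (ennreal (w y) * ennreal (w z)) * (ennreal (112/3 * pi) * ennreal (1 / norm (y - z))) \<partial>lborel) \<partial>lborel)"
  proof (rule nn_integral_mono, rule nn_integral_mono_AE)
    fix y :: "real^3"
    \<comment> \<open>On the diagonal the right side is 0 by 1/0 = 0, while the kernel integral
      diverges.\<close>
    have "AE z in lborel. z \<noteq> y" by (rule AE_lborel_singleton)
    then show "AE z in lborel. (ennreal (w y) * ennreal (w z)) * (\<integral>\<^sup>+x. k x y * k x z \<partial>lborel)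
       \<le> (ennreal (w y) * ennreal (w z)) * (ennreal (112/3 * pi) * ennreal (1 / norm (y - z)))"
    proof eventually_elim
      case (elim z)
      have "(\<integral>\<^sup>+x. k x y * k x z \<partial>lborel) = (\<integral>\<^sup>+x. k y x * k z x \<partial>lborel)"
        by (intro nn_integral_cong) (metis ks)
      then show ?case
        using nn_integral_kernel_square[of y z] elim by (intro mult_left_mono) (auto simp: k_def)
    qed
  qed
  also have "\<dots> = ennreal (112/3 * pi) * coulomb w"
  proof -
    have e: "(ennreal (w y) * ennreal (w z)) * (ennreal (112/3 * pi) * ennreal (1 / norm (y - z)))
      = ennreal (112/3 * pi) * (ennreal (w y) * ennreal (w z) * ennreal (1 / norm (y - z)))" for y z
      by (simp only: mult_ac)
    show ?thesis unfolding coulomb_def e by (subst nn_integral_cmult, measurable)+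
  qed
  finally have 2: "(\<integral>\<^sup>+x. (P x)\<^sup>2 \<partial>lborel) \<le> ennreal (112/3 * pi) * coulomb w" .
  have "ennreal (8 * pi) * ?U = 2 * (ennreal (4 * pi) * ?U)"
    by (simp add: mult.assoc[symmetric] ennreal_mult[symmetric] flip: ennreal_numeral)
  also have "\<dots> \<le> 2 * (\<integral>\<^sup>+x. ennreal (norm (g x)) * P x \<partial>lborel)"
    by (intro mult_left_mono 1) auto
  also have "\<dots> = (\<integral>\<^sup>+x. 2 * (ennreal (norm (g x)) * P x) \<partial>lborel)"
    by (rule nn_integral_cmult[symmetric]) measurable
  also have "\<dots> \<le> (\<integral>\<^sup>+x. ennreal l * ennreal ((norm (g x))\<^sup>2) + ennreal (1 / l) * (P x)\<^sup>2 \<partial>lborel)"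
    by (intro nn_integral_mono ennreal_young l) simp
  also have "\<dots> = ennreal l * (\<integral>\<^sup>+x. ennreal ((norm (g x))\<^sup>2) \<partial>lborel) + ennreal (1 / l) * (\<integral>\<^sup>+x. (P x)\<^sup>2 \<partial>lborel)"
    by (subst nn_integral_add; (subst nn_integral_cmult)?) (auto simp: nn_integral_cmult)
  also have "\<dots> \<le> ennreal l * ennreal (LINT x|lborel. (norm (g x))\<^sup>2) + ennreal (1 / l) * (ennreal (112/3 * pi) * coulomb w)"
    using 2 by (intro add_mono mult_left_mono) (auto simp: square_integrable_nn_integral[OF sq(2)])
  also have "ennreal (1 / l) * (ennreal (112/3 * pi) * coulomb w) = ennreal (112/3 * pi / l) * coulomb w"
    using l by (simp add: mult.assoc[symmetric] ennreal_mult[symmetric] mult.commute[of l 3])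
  finally show ?thesis .
qed

section \<open>A Gagliardo--Nirenberg inequality\<close>

text \<open>In dimension three 1/|x - y| is square integrable over the unit ball around x, and its
  square has integral at most 4 pi; Young's inequality pairs it with b^5.\<close>

lemma nn_integral_near_kernel_le:
  fixes b :: "real^3 \<Rightarrow> real"
  assumes [measurable]: "b \<in> borel_measurable borel" and b: "\<And>x. 0 \<le> b x"
  shows "2 * (\<integral>\<^sup>+y. ennreal (b y ^ 5) * (ennreal (1 / norm (x - y)) * indicator (ball x 1) y) \<partial>lborel)
    \<le> (\<integral>\<^sup>+y. ennreal (b y ^ 10) \<partial>lborel) + ennreal (4 * pi)"
proof -
  have [measurable]: "ball x 1 \<in> sets borel" "ball (0::real^3) 1 \<in> sets borel" by auto
  define h where "h w = ennreal (1 / (norm w)\<^sup>2) * indicator (ball (0::real^3) 1) w" for w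
  have [measurable]: "h \<in> borel_measurable borel" unfolding h_def by measurable
  have "2 * (\<integral>\<^sup>+y. ennreal (b y ^ 5) * (ennreal (1 / norm (x - y)) * indicator (ball x 1) y) \<partial>lborel)
    = (\<integral>\<^sup>+y. 2 * (ennreal (b y ^ 5) * (ennreal (1 / norm (x - y)) * indicator (ball x 1) y)) \<partial>lborel)"
    by (rule nn_integral_cmult[symmetric]) measurable
  also have "\<dots> \<le> (\<integral>\<^sup>+y. ennreal (b y ^ 10) + h (x - y) \<partial>lborel)"
  proof (rule nn_integral_mono)
    fix y
    have "2 * (ennreal (b y ^ 5) * (ennreal (1 / norm (x - y)) * indicator (ball x 1) y))
      \<le> ennreal 1 * ennreal ((b y ^ 5)\<^sup>2) + ennreal (1 / 1) * (ennreal (1 / norm (x - y)) * indicator (ball x 1) y)\<^sup>2"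
      using b by (intro ennreal_young) auto
    also have "\<dots> = ennreal (b y ^ 10) + h (x - y)"
      by (auto simp: h_def indicator_def dist_norm norm_minus_commute[of y x] ennreal_power power_divide simp flip: power_mult)
    finally show "2 * (ennreal (b y ^ 5) * (ennreal (1 / norm (x - y)) * indicator (ball x 1) y))
      \<le> ennreal (b y ^ 10) + h (x - y)" .
  qed
  also have "\<dots> = (\<integral>\<^sup>+y. ennreal (b y ^ 10) \<partial>lborel) + (\<integral>\<^sup>+y. h (x - y) \<partial>lborel)"
    by (rule nn_integral_add) measurable
  also have "(\<integral>\<^sup>+y. h (x - y) \<partial>lborel) = (\<integral>\<^sup>+y. h y \<partial>lborel)"
    by (rule nn_integral_reflect) measurable
  also have "\<dots> \<le> ennreal (4 * pi)" unfolding h_def by (rule nn_integral_inverse_square_unit_ball)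
  finally show ?thesis by (simp add: add_left_mono)
qed

text \<open>Applied to \<open>b = |u|\<^sup>1\<^sup>/\<^sup>3\<close>, so that all exponents are natural numbers.\<close>

lemma coulomb_power_le:
  fixes b :: "real^3 \<Rightarrow> real"
  assumes [measurable]: "b \<in> borel_measurable borel" and b: "\<And>x. 0 \<le> b x"
  shows "2 * coulomb (\<lambda>x. b x ^ (5 + m))
    \<le> (\<integral>\<^sup>+x. ennreal (b x ^ (5 + 2 * m)) \<partial>lborel) * ((\<integral>\<^sup>+y. ennreal (b y ^ 10) \<partial>lborel) + ennreal (4 * pi))
      + 2 * (\<integral>\<^sup>+x. ennreal (b x ^ (5 + m)) \<partial>lborel)\<^sup>2"
proof -
  \<comment> \<open>The Coulomb kernel is cut at distance 1; beyond it the kernel is at most 1 and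
    the double integral factors.\<close>
  define near where "near x y = (if norm (x - y) < 1 then ennreal (1 / norm (x - y)) else 0)" for x y :: "real^3"
  have near_sym: "near x y = near y x" for x y by (simp add: near_def norm_minus_commute)
  have [measurable (raw)]: "(\<lambda>q. near (f q) (h q)) \<in> borel_measurable M"
    if [measurable]: "f \<in> borel_measurable M" "h \<in> borel_measurable M" for f h and M :: "'m measure"
    unfolding near_def by measurable
  define P where "P x y = ennreal (b x ^ (5 + 2 * m)) * (ennreal (b y ^ 5) * near x y)" for x y
  have [measurable (raw)]: "(\<lambda>q. P (f q) (h q)) \<in> borel_measurable M"
    if [measurable]: "f \<in> borel_measurable M" "h \<in> borel_measurable M" for f h and M :: "'m measure"
    unfolding P_def by measurable
  let ?w = "\<lambda>x. ennreal (b x ^ (5 + m))"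
  let ?X = "(\<integral>\<^sup>+y. ennreal (b y ^ 10) \<partial>lborel)"
  have pt: "2 * (?w x * ?w y * ennreal (1 / norm (x - y))) \<le> (P x y + P y x) + 2 * (?w x * ?w y)" for x y
  proof (cases "norm (x - y) < 1")
    case True
    \<comment> \<open>The square of b x ^ m - b y ^ m shifts the surplus powers to one variable and
      leaves the fifth power of the other, for which the near kernel bound is uniform.\<close>
    have "2 * (b x ^ (5+m) * b y ^ (5+m)) \<le> b x ^ (5 + 2 * m) * b y ^ 5 + b y ^ (5 + 2 * m) * b x ^ 5"
    proof -
      have "0 \<le> (b x ^ 5 * b y ^ 5) * (b x ^ m - b y ^ m)\<^sup>2" using b by simp
      also have "\<dots> = b x ^ (5 + 2 * m) * b y ^ 5 + b y ^ (5 + 2 * m) * b x ^ 5 - 2 * (b x ^ (5+m) * b y ^ (5+m))"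
        by (simp only: power2_diff power_add power_mult power2_eq_square power_mult_distrib mult_2) (simp add: algebra_simps)
      finally show ?thesis by simp
    qed
    then have "(2 * (b x ^ (5+m) * b y ^ (5+m))) * (1 / norm (x - y)) \<le> (b x ^ (5 + 2 * m) * b y ^ 5 + b y ^ (5 + 2 * m) * b x ^ 5) * (1 / norm (x - y))"
      by (intro mult_right_mono) auto
    then have "2 * (b x ^ (5+m) * b y ^ (5+m) * (1 / norm (x - y))) \<le> b x ^ (5 + 2 * m) * (b y ^ 5 * (1 / norm (x - y))) + b y ^ (5 + 2 * m) * (b x ^ 5 * (1 / norm (x - y)))"
      by (simp only: distrib_right mult.assoc)
    then have "ennreal (2 * (b x ^ (5+m) * b y ^ (5+m) * (1 / norm (x - y)))) \<le> ennreal (b x ^ (5 + 2 * m) * (b y ^ 5 * (1 / norm (x - y))) + b y ^ (5 + 2 * m) * (b x ^ 5 * (1 / norm (x - y))))"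
      by (rule ennreal_leI)
    also have "\<dots> = P x y + P y x"
      using True b by (simp add: P_def near_def ennreal_mult[symmetric] ennreal_plus[symmetric] norm_minus_commute[of y x]
          del: ennreal_plus)
    also have "ennreal (2 * (b x ^ (5+m) * b y ^ (5+m) * (1 / norm (x - y)))) = 2 * (?w x * ?w y * ennreal (1 / norm (x - y)))"
      using b by (simp add: ennreal_mult[symmetric] flip: ennreal_numeral)
    finally show ?thesis by (simp add: add_increasing2)
  next
    case False
    then have "1 / norm (x - y) \<le> 1" by (cases "x = y") (auto simp: divide_le_eq)
    then have "ennreal (1 / norm (x - y)) \<le> 1" using ennreal_leI ennreal_1 by metis
    then have "?w x * ?w y * ennreal (1 / norm (x - y)) \<le> ?w x * ?w y"
      using mult_left_mono[of "ennreal (1 / norm (x - y))" 1 "?w x * ?w y"] by simp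
    then show ?thesis by (intro add_increasing mult_left_mono) auto
  qed
  let ?P = "\<integral>\<^sup>+x. \<integral>\<^sup>+y. P x y \<partial>lborel \<partial>lborel" and ?Q = "\<integral>\<^sup>+x. ennreal (b x ^ (5 + 2 * m)) \<partial>lborel"
  have Pint: "?P = (\<integral>\<^sup>+x. ennreal (b x ^ (5 + 2 * m)) * (\<integral>\<^sup>+y. ennreal (b y ^ 5) * near x y \<partial>lborel) \<partial>lborel)"
    unfolding P_def by (simp add: nn_integral_cmult)
  have N: "2 * (\<integral>\<^sup>+y. ennreal (b y ^ 5) * near x y \<partial>lborel) \<le> ?X + ennreal (4 * pi)" for x
  proof -
    have "(\<integral>\<^sup>+y. ennreal (b y ^ 5) * near x y \<partial>lborel) = (\<integral>\<^sup>+y. ennreal (b y ^ 5) * (ennreal (1 / norm (x - y)) * indicator (ball x 1) y) \<partial>lborel)"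
      by (intro nn_integral_cong) (auto simp: near_def dist_norm)
    then show ?thesis using nn_integral_near_kernel_le[OF assms, of x] by simp
  qed
  have "2 * ?P = (\<integral>\<^sup>+x. ennreal (b x ^ (5 + 2 * m)) * (2 * (\<integral>\<^sup>+y. ennreal (b y ^ 5) * near x y \<partial>lborel)) \<partial>lborel)"
    unfolding Pint by (subst nn_integral_cmult[symmetric]) (auto simp: mult_ac)
  also have "\<dots> \<le> (\<integral>\<^sup>+x. ennreal (b x ^ (5 + 2 * m)) * (?X + ennreal (4 * pi)) \<partial>lborel)"
    by (intro nn_integral_mono mult_left_mono N) auto
  also have "\<dots> = ?Q * (?X + ennreal (4 * pi))"
    by (rule nn_integral_multc) measurable
  finally have P1: "2 * ?P \<le> ?Q * (?X + ennreal (4 * pi))" .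
  have P2: "(\<integral>\<^sup>+x. \<integral>\<^sup>+y. P y x \<partial>lborel \<partial>lborel) = ?P"
    by (rule nn_integral_swap) measurable
  have "2 * coulomb (\<lambda>x. b x ^ (5 + m)) = (\<integral>\<^sup>+x. \<integral>\<^sup>+y. 2 * (?w x * ?w y * ennreal (1 / norm (x - y))) \<partial>lborel \<partial>lborel)"
    unfolding coulomb_def by (simp add: nn_integral_cmult)
  also have "\<dots> \<le> (\<integral>\<^sup>+x. \<integral>\<^sup>+y. (P x y + P y x) + 2 * (?w x * ?w y) \<partial>lborel \<partial>lborel)"
    by (intro nn_integral_mono pt)
  also have "\<dots> = (?P + (\<integral>\<^sup>+x. \<integral>\<^sup>+y. P y x \<partial>lborel \<partial>lborel)) + 2 * ((\<integral>\<^sup>+x. ?w x \<partial>lborel) * (\<integral>\<^sup>+x. ?w x \<partial>lborel))"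
    by (simp add: nn_integral_add nn_integral_cmult nn_integral_multc)
  also have "\<dots> \<le> ?Q * (?X + ennreal (4 * pi)) + 2 * (\<integral>\<^sup>+x. ?w x \<partial>lborel)\<^sup>2"
    using P1 unfolding P2 mult_2[of ?P] power2_eq_square
    by (rule add_right_mono)
  finally show ?thesis .
qed


text \<open>The right side of \<open>gn_arith\<close> for k = 112/3 * pi, the constant from the
  kernel convolved with itself.\<close>

definition gn_const :: real where
  "gn_const = 2 + 4 * pi * (112/3 * pi)^4 + 4 * (112/3 * pi)^3"

text \<open>The hypothesis is the doubled duality estimate for l = x + 1. Division by x + 1 makes
  the quadratic terms linear: the coefficient of x on the right becomes 2 + 4 pi + 1, and the 16 pi
  on the left exceeds it by 12 pi - 3 \<ge> 1.\<close>

lemma gn_arith: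
  fixes x k :: real
  assumes x: "x \<ge> 0" and k: "k \<ge> 4"
    and le: "16 * pi * x \<le> 2 * (x + 1) + k / (x + 1) * ((x / k + k^3) * (x + 4 * pi) + 2 * (x / k^3 + k)\<^sup>2)"
  shows "x \<le> 2 + 4 * pi * k^4 + 4 * k^3"
proof -
  have pi: "pi \<ge> 2" by (rule pi_ge_two)
  have a: "k * ((x / k + k^3) * (x + 4 * pi)) \<le> (4 * pi * (x + k^4)) * (x + 1)"
  proof -
    have "4 * pi * (x + 1) - (x + 4 * pi) = (4 * pi - 1) * x" by (simp add: algebra_simps)
    also have "\<dots> \<ge> 0" using pi x by simp
    finally have "x + 4 * pi \<le> 4 * pi * (x + 1)" by simp
    then have "(x + k^4) * (x + 4 * pi) \<le> (x + k^4) * (4 * pi * (x + 1))"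
      using x by (intro mult_left_mono) auto
    also have "(x + k^4) * (x + 4 * pi) = k * ((x / k + k^3) * (x + 4 * pi))"
      using k by (simp add: field_simps eval_nat_numeral)
    finally show ?thesis by (simp only: mult_ac)
  qed
  have b: "k * (2 * (x / k^3 + k)\<^sup>2) \<le> (x + 4 * k^3) * (x + 1)"
  proof -
    have "0 \<le> (x / k^3 - k)\<^sup>2" by simp
    then have "(x / k^3 + k)\<^sup>2 \<le> 2 * (x / k^3)\<^sup>2 + 2 * k\<^sup>2" by (simp add: power2_sum power2_diff)
    then have "k * (2 * (x / k^3 + k)\<^sup>2) \<le> k * (2 * (2 * (x / k^3)\<^sup>2 + 2 * k\<^sup>2))"
      using k by (intro mult_left_mono) auto
    also have "\<dots> = 4 / k^5 * x\<^sup>2 + 4 * k^3"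
      using k by (simp add: field_simps eval_nat_numeral)
    also have "4 / k^5 * x\<^sup>2 \<le> 1 * x\<^sup>2"
    proof (rule mult_right_mono)
      have "k ^ 1 \<le> k ^ 5" using k by (intro power_increasing) auto
      then show "4 / k^5 \<le> 1" using k by simp
    qed simp
    also have "1 * x\<^sup>2 + 4 * k^3 \<le> (x + 4 * k^3) * (x + 1)"
      using x k by (simp add: algebra_simps power2_eq_square)
    finally show ?thesis by simp
  qed
  have "k / (x + 1) * ((x / k + k^3) * (x + 4 * pi) + 2 * (x / k^3 + k)\<^sup>2) \<le> 4 * pi * (x + k^4) + (x + 4 * k^3)"
  proof -
    have "k * ((x / k + k^3) * (x + 4 * pi) + 2 * (x / k^3 + k)\<^sup>2) \<le> (4 * pi * (x + k^4) + (x + 4 * k^3)) * (x + 1)"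
      using a b by (simp only: distrib_left distrib_right)
    then show ?thesis using x by (simp add: divide_le_eq)
  qed
  with le have "16 * pi * x \<le> 2 * (x + 1) + 4 * pi * (x + k^4) + (x + 4 * k^3)" by linarith
  then have "(12 * pi - 3) * x \<le> 2 + 4 * pi * k^4 + 4 * k^3" by (simp add: algebra_simps)
  moreover have "1 * x \<le> (12 * pi - 3) * x" using pi x by (intro mult_right_mono) auto
  ultimately show ?thesis by simp
qed

text \<open>The cases b \<le> t and b > t yield one summand each. For b = |u|^(1/3) this
  interpolates the exponents 3 and 7/3 between 2 and 10/3.\<close>

lemma power_interpolation:
  fixes b t :: real
  assumes "b \<ge> 0" "t > 0"
  shows "b^9 \<le> b^10 / t + t^3 * b^6" "b^7 \<le> b^10 / t^3 + t * b^6"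
proof -
  show "b^9 \<le> b^10 / t + t^3 * b^6"
  proof (cases "b \<le> t")
    case True
    have "b^9 = b^3 * b^6" by (simp flip: power_add)
    also have "\<dots> \<le> t^3 * b^6" using True assms by (intro mult_right_mono power_mono) auto
    finally show ?thesis using assms by (simp add: add_increasing)
  next
    case False
    have "t * b^9 \<le> b * b^9" using False assms by (intro mult_right_mono) auto
    then have "b^9 \<le> b^10 / t" using assms by (simp add: field_simps eval_nat_numeral)
    then show ?thesis using assms by (simp add: add_increasing2)
  qed
  show "b^7 \<le> b^10 / t^3 + t * b^6"
  proof (cases "b \<le> t")
    case True
    have "b^7 = b * b^6" by (simp add: eval_nat_numeral)
    also have "\<dots> \<le> t * b^6" using True assms by (intro mult_right_mono) auto
    finally show ?thesis using assms by (simp add: add_increasing)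
  next
    case False
    have "t^3 * b^7 \<le> b^3 * b^7" using False assms by (intro mult_right_mono power_mono) auto
    then have "b^7 \<le> b^10 / t^3" using assms by (simp add: field_simps eval_nat_numeral)
    then show ?thesis using assms by (simp add: add_increasing2)
  qed
qed

lemma nn_integral_affine_bound:
  assumes [measurable]: "f \<in> borel_measurable M" "h \<in> borel_measurable M"
    and "\<And>x. k x \<le> f x * c + d * h x" "\<And>x. 0 \<le> f x" "\<And>x. 0 \<le> h x" "0 \<le> c" "0 \<le> d"
  shows "(\<integral>\<^sup>+x. ennreal (k x) \<partial>M) \<le> (\<integral>\<^sup>+x. ennreal (f x) \<partial>M) * ennreal c + ennreal d * (\<integral>\<^sup>+x. ennreal (h x) \<partial>M)"
proof -
  have "(\<integral>\<^sup>+x. ennreal (k x) \<partial>M) \<le> (\<integral>\<^sup>+x. ennreal (f x) * ennreal c + ennreal d * ennreal (h x) \<partial>M)"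
    using assms by (intro nn_integral_mono) (simp add: ennreal_mult[symmetric] ennreal_plus[symmetric] ennreal_leI del: ennreal_plus)
  also have "\<dots> = (\<integral>\<^sup>+x. ennreal (f x) \<partial>M) * ennreal c + ennreal d * (\<integral>\<^sup>+x. ennreal (h x) \<partial>M)"
    by (simp add: nn_integral_add nn_integral_cmult nn_integral_multc)
  finally show ?thesis .
qed

text \<open>Truncation makes \<open>\<integral> b\<^sup>1\<^sup>0\<close> finite, so that it can be absorbed into the left-hand side.\<close>

lemma gn_normalized_truncated:
  assumes g: "has_weak_gradient u g" and sq: "square_integrable u" "square_integrable g"
    and A: "(LINT x|lborel. (norm (g x))\<^sup>2) \<le> 1" and D: "(LINT x|lborel. (norm (u x))\<^sup>2) \<le> 1"
    and [measurable]: "b \<in> borel_measurable borel"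
    and b: "\<And>x. 0 \<le> b x" "\<And>x. b x ^ 3 \<le> \<bar>u x\<bar>" "\<And>x. b x \<le> N"
  shows "(\<integral>\<^sup>+x. ennreal (b x ^ 10) \<partial>lborel) \<le> ennreal gn_const"
proof -
  define k where "k = 112/3 * pi"
  have k: "k \<ge> 4" using pi_ge_two by (simp add: k_def)
  have [measurable]: "u \<in> borel_measurable borel"
    using g by (auto simp: has_weak_gradient_def locally_integrable_def)
  have b6: "(\<integral>\<^sup>+x. ennreal (b x ^ 6) \<partial>lborel) \<le> 1"
  proof -
    have "(\<integral>\<^sup>+x. ennreal (b x ^ 6) \<partial>lborel) \<le> (\<integral>\<^sup>+x. ennreal ((norm (u x))\<^sup>2) \<partial>lborel)"
    proof (intro nn_integral_mono ennreal_leI)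
      fix x
      have "(b x ^ 3)\<^sup>2 \<le> \<bar>u x\<bar>\<^sup>2" using b by (intro power_mono) auto
      then show "b x ^ 6 \<le> (norm (u x))\<^sup>2" by (simp flip: power_mult)
    qed
    also have "\<dots> \<le> ennreal 1"
      unfolding square_integrable_nn_integral[OF sq(1)] using D by (rule ennreal_leI)
    finally show ?thesis by simp
  qed
  let ?X = "\<integral>\<^sup>+x. ennreal (b x ^ 10) \<partial>lborel"
  have "?X \<le> (\<integral>\<^sup>+x. ennreal (N^4) * ennreal (b x ^ 6) \<partial>lborel)"
  proof (rule nn_integral_mono)
    fix x
    have "b x ^ 10 = b x ^ 4 * b x ^ 6" by (simp flip: power_add)
    also have "\<dots> \<le> N^4 * b x ^ 6" using b by (intro mult_right_mono power_mono) auto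
    finally show "ennreal (b x ^ 10) \<le> ennreal (N^4) * ennreal (b x ^ 6)"
      using b by (simp add: ennreal_mult[symmetric] ennreal_leI)
  qed
  also have "\<dots> = ennreal (N^4) * (\<integral>\<^sup>+x. ennreal (b x ^ 6) \<partial>lborel)" by (rule nn_integral_cmult) measurable
  also have "\<dots> \<le> ennreal (N^4) * 1" by (intro mult_left_mono b6) auto
  finally have "?X < \<infinity>" by (simp add: le_less_trans)
  then obtain x where x: "?X = ennreal x" "x \<ge> 0" by (cases ?X) auto
  \<comment> \<open>Interpolation at the level t = k makes the 1/k in front of x cancel the factor k
    that the kernel constant brings in later.\<close>
  have Y9: "(\<integral>\<^sup>+x. ennreal (b x ^ 9) \<partial>lborel) \<le> ennreal (x / k + k^3)"
  proof -
    have "(\<integral>\<^sup>+x. ennreal (b x ^ 9) \<partial>lborel) \<le> ?X * ennreal (1/k) + ennreal (k^3) * (\<integral>\<^sup>+x. ennreal (b x ^ 6) \<partial>lborel)"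
      using power_interpolation(1)[OF b(1), of k] b k by (intro nn_integral_affine_bound) auto
    also have "\<dots> \<le> ennreal x * ennreal (1/k) + ennreal (k^3) * 1"
      unfolding x by (intro add_left_mono mult_left_mono b6) auto
    also have "\<dots> = ennreal (x / k + k^3)"
      using x k by (simp add: ennreal_mult[symmetric] ennreal_plus[symmetric] del: ennreal_plus)
    finally show ?thesis .
  qed
  have Y7: "(\<integral>\<^sup>+x. ennreal (b x ^ 7) \<partial>lborel) \<le> ennreal (x / k^3 + k)"
  proof -
    have "(\<integral>\<^sup>+x. ennreal (b x ^ 7) \<partial>lborel) \<le> ?X * ennreal (1/k^3) + ennreal k * (\<integral>\<^sup>+x. ennreal (b x ^ 6) \<partial>lborel)"
      using power_interpolation(2)[OF b(1), of k] b k by (intro nn_integral_affine_bound) auto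
    also have "\<dots> \<le> ennreal x * ennreal (1/k^3) + ennreal k * 1"
      unfolding x by (intro add_left_mono mult_left_mono b6) auto
    also have "\<dots> = ennreal (x / k^3 + k)"
      using x k by (simp add: ennreal_mult[symmetric] ennreal_plus[symmetric] del: ennreal_plus)
    finally show ?thesis .
  qed
  let ?Z = "(x / k + k^3) * (x + 4 * pi) + 2 * (x / k^3 + k)\<^sup>2"
  have coul: "2 * coulomb (\<lambda>x. b x ^ 7) \<le> ennreal ?Z"
  proof -
    have "2 * coulomb (\<lambda>x. b x ^ 7) \<le> (\<integral>\<^sup>+x. ennreal (b x ^ 9) \<partial>lborel) * (?X + ennreal (4 * pi)) + 2 * (\<integral>\<^sup>+x. ennreal (b x ^ 7) \<partial>lborel)\<^sup>2"
      using coulomb_power_le[of b 2] b by simp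
    also have "\<dots> \<le> ennreal (x / k + k^3) * (ennreal x + ennreal (4 * pi)) + 2 * (ennreal (x / k^3 + k))\<^sup>2"
      unfolding x(1) by (intro add_mono mult_right_mono mult_left_mono power_mono Y9 Y7) auto
    also have "\<dots> = ennreal ?Z"
      using x(2) k by (simp add: ennreal_power ennreal_mult[symmetric] ennreal_plus[symmetric] del: ennreal_plus flip: ennreal_numeral)
    finally show ?thesis .
  qed
  have "ennreal (16 * pi * x) = 2 * (ennreal (8 * pi) * ?X)"
    using x by (simp add: ennreal_mult[symmetric] flip: ennreal_numeral)
  also have "\<dots> \<le> 2 * (ennreal (8 * pi) * (\<integral>\<^sup>+x. ennreal (\<bar>u x\<bar> * b x ^ 7) \<partial>lborel))"
  proof (intro mult_left_mono nn_integral_mono ennreal_leI)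
    fix x
    have "b x ^ 10 = b x ^ 3 * b x ^ 7" by (simp flip: power_add)
    also have "\<dots> \<le> \<bar>u x\<bar> * b x ^ 7" using b by (intro mult_right_mono) auto
    finally show "b x ^ 10 \<le> \<bar>u x\<bar> * b x ^ 7" .
  qed auto
  \<comment> \<open>The choice l = x + 1 answers to a Coulomb term that grows like x^2; adding 1
    keeps l positive.\<close>
  also have "\<dots> \<le> 2 * (ennreal (x + 1) * ennreal (LINT x|lborel. (norm (g x))\<^sup>2) + ennreal (112/3 * pi / (x + 1)) * coulomb (\<lambda>x. b x ^ 7))"
    using b x by (intro mult_left_mono riesz_duality[OF g sq]) auto
  also have "\<dots> = 2 * (ennreal (x + 1) * ennreal (LINT x|lborel. (norm (g x))\<^sup>2)) + ennreal (k / (x + 1)) * (2 * coulomb (\<lambda>x. b x ^ 7))"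
    by (simp add: distrib_left mult_ac k_def)
  also have "\<dots> \<le> 2 * (ennreal (x + 1) * ennreal 1) + ennreal (k / (x + 1)) * ennreal ?Z"
    by (intro add_mono mult_left_mono ennreal_leI A coul) auto
  also have "\<dots> = ennreal (2 * (x + 1) + k / (x + 1) * ?Z)"
  proof -
    define Z where "Z = (x / k + k^3) * (x + 4 * pi) + 2 * (x / k^3 + k)\<^sup>2"
    define c where "c = k / (x + 1)"
    have "0 \<le> Z" "0 \<le> c" using x k by (auto simp: Z_def c_def)
    then have "2 * (ennreal (x + 1) * ennreal 1) + ennreal c * ennreal Z = ennreal (2 * (x + 1) + c * Z)"
      using x(2) by (simp add: ennreal_mult[symmetric] ennreal_plus[symmetric] del: ennreal_plus flip: ennreal_numeral ennreal_1)
    then show ?thesis by (simp only: Z_def c_def)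
  qed
  finally have "16 * pi * x \<le> 2 * (x + 1) + k / (x + 1) * ?Z"
    using x k by (subst (asm) ennreal_le_iff) auto
  from gn_arith[OF x(2) k this] show ?thesis
    unfolding x gn_const_def k_def by (rule ennreal_leI)
qed

text \<open>The bound is uniform in the truncation level, so monotone convergence removes the
  truncation.\<close>

lemma gn_normalized:
  assumes g: "has_weak_gradient u g" and sq: "square_integrable u" "square_integrable g"
    and A: "(LINT x|lborel. (norm (g x))\<^sup>2) \<le> 1" and D: "(LINT x|lborel. (norm (u x))\<^sup>2) \<le> 1"
  shows "(\<integral>\<^sup>+x. ennreal (\<bar>u x\<bar> powr (10/3)) \<partial>lborel) \<le> ennreal gn_const"
proof -
  have [measurable]: "u \<in> borel_measurable borel"
    using g by (auto simp: has_weak_gradient_def locally_integrable_def)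
  define b where "b n x = min \<bar>u x\<bar> (real n) powr (1/3)" for n x
  have [measurable]: "b n \<in> borel_measurable borel" for n unfolding b_def by measurable
  have pw: "b n x ^ k = min \<bar>u x\<bar> (real n) powr (real k / 3)" if "k > 0" for n x k
    using that powr_realpow'[of "b n x" k] by (simp add: b_def powr_powr)
  have bound: "(\<integral>\<^sup>+x. ennreal (b n x ^ 10) \<partial>lborel) \<le> ennreal gn_const" for n
  proof (rule gn_normalized_truncated[OF g sq A D])
    show "0 \<le> b n x" "b n x \<le> real n powr (1/3)" for x by (auto simp: b_def intro!: powr_mono2)
    show "b n x ^ 3 \<le> \<bar>u x\<bar>" for x using pw[of 3 n x] by simp
  qed simp
  have inc: "incseq (\<lambda>n x. ennreal (b n x ^ 10))"
    by (auto simp: incseq_def le_fun_def b_def intro!: ennreal_leI power_mono powr_mono2)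
  have "(SUP n. ennreal (b n x ^ 10)) = ennreal (\<bar>u x\<bar> powr (10/3))" for x
  proof (rule antisym)
    show "(SUP n. ennreal (b n x ^ 10)) \<le> ennreal (\<bar>u x\<bar> powr (10/3))"
      by (rule SUP_least) (auto simp: pw intro!: ennreal_leI powr_mono2)
    obtain n where "\<bar>u x\<bar> \<le> real n" using real_arch_simple by blast
    then show "ennreal (\<bar>u x\<bar> powr (10/3)) \<le> (SUP n. ennreal (b n x ^ 10))"
      by (intro SUP_upper2[of n]) (simp_all add: pw)
  qed
  then have "(\<integral>\<^sup>+x. ennreal (\<bar>u x\<bar> powr (10/3)) \<partial>lborel) = (SUP n. \<integral>\<^sup>+x. ennreal (b n x ^ 10) \<partial>lborel)"
    by (subst nn_integral_monotone_convergence_SUP[OF inc, symmetric]) auto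
  also have "\<dots> \<le> ennreal gn_const" by (intro SUP_least bound)
  finally show ?thesis .
qed

section \<open>Scaling\<close>

definition dirichlet :: "(real^3 \<Rightarrow> real) \<Rightarrow> real" where
  "dirichlet u = (LINT x|lborel. (norm (weak_gradient u x))\<^sup>2)"

definition hartree :: "(real^3 \<Rightarrow> real) \<Rightarrow> real" where
  "hartree u = (LINT x|lborel. (LINT y|lborel. \<bar>u x\<bar>\<^sup>2 * \<bar>u y\<bar>\<^sup>2 / norm (x - y)))"

definition lp_power :: "real \<Rightarrow> (real^3 \<Rightarrow> real) \<Rightarrow> real" where
  "lp_power q u = (LINT x|lborel. \<bar>u x\<bar> powr q)"

definition mass :: "(real^3 \<Rightarrow> real) \<Rightarrow> real" where
  "mass u = (LINT x|lborel. \<bar>u x\<bar>\<^sup>2)"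

lemma energy_eq: "energy p u = 1/2 * dirichlet u + 1/4 * hartree u - 1/p * lp_power p u"
  by (simp add: energy_def dirichlet_def hartree_def lp_power_def)

lemma mass_sphere_iff: "u \<in> mass_sphere c \<longleftrightarrow> u \<in> H1 \<and> mass u = c"
  by (simp add: mass_sphere_def mass_def)

lemma dirichlet_nonneg: "0 \<le> dirichlet u" and hartree_nonneg: "0 \<le> hartree u"
  and lp_power_nonneg: "0 \<le> lp_power q u"
  by (auto simp: dirichlet_def hartree_def lp_power_def intro!: Bochner_Integration.integral_nonneg)

text \<open>Two weak gradients agree almost everywhere, so the explicit gradient of a rescaled
  function can stand in for the chosen one.\<close>

lemma dirichlet_eq:
  assumes "has_weak_gradient u g"
  shows "dirichlet u = (LINT x|lborel. (norm (g x))\<^sup>2)"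
proof -
  have wg: "has_weak_gradient u (weak_gradient u)" using has_weak_gradient_weak_gradient[OF assms] .
  have [measurable]: "g \<in> borel_measurable borel" "weak_gradient u \<in> borel_measurable borel"
    using assms wg by (auto simp: has_weak_gradient_def locally_integrable_def)
  show ?thesis unfolding dirichlet_def
    using has_weak_gradient_unique[OF wg assms] by (intro integral_cong_AE) auto
qed

lemma H1_weak_gradient:
  assumes "u \<in> H1"
  shows "has_weak_gradient u (weak_gradient u)" "square_integrable u" "square_integrable (weak_gradient u)"
proof -
  obtain g where g: "has_weak_gradient u g" "square_integrable g" and sq: "square_integrable u"
    using assms by (auto simp: H1_def)
  show wg: "has_weak_gradient u (weak_gradient u)" using has_weak_gradient_weak_gradient[OF g(1)] .
  have [measurable]: "g \<in> borel_measurable borel" "weak_gradient u \<in> borel_measurable borel"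
    using g wg by (auto simp: has_weak_gradient_def locally_integrable_def)
  have "integrable lborel (\<lambda>x. (norm (g x))\<^sup>2) = integrable lborel (\<lambda>x. (norm (weak_gradient u x))\<^sup>2)"
    using has_weak_gradient_unique[OF wg g(1)] by (intro integrable_cong_AE) auto
  then show "square_integrable (weak_gradient u)" using g(2) by (simp add: square_integrable_def)
  show "square_integrable u" by (rule sq)
qed

lemma H1_borel [measurable_dest]: "u \<in> H1 \<Longrightarrow> u \<in> borel_measurable borel"
  by (simp add: H1_def square_integrable_def)

lemma H1_mass_nonneg: "0 \<le> mass u" by (simp add: mass_def)

lemma AE_zero_if_lp_power_zero:
  assumes "u \<in> H1" "integrable lborel (\<lambda>x. \<bar>u x\<bar> powr q)" "lp_power q u = 0"
  shows "mass u = 0"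
proof -
  have "AE x in lborel. \<bar>u x\<bar> powr q = 0"
    using assms(2,3) unfolding lp_power_def by (subst (asm) integral_nonneg_eq_0_iff_AE) auto
  then have "AE x in lborel. \<bar>u x\<bar>\<^sup>2 = 0" by eventually_elim simp
  then show ?thesis unfolding mass_def by (rule integral_eq_zero_AE)
qed

text \<open>Amplitude and length scale are independent because several combinations occur: the
  normalisation in the Gagliardo-Nirenberg inequality, the dilation with a = b^2, and the
  mass-preserving one with a = b^(3/2).\<close>

definition rescale :: "real \<Rightarrow> real \<Rightarrow> (real^3 \<Rightarrow> real) \<Rightarrow> real^3 \<Rightarrow> real" where
  "rescale a b u = (\<lambda>x. a * u (b *\<^sub>R x))"

lemma locally_integrable_scaleR:
  fixes f :: "real^3 \<Rightarrow> 'b::euclidean_space"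
  assumes f: "locally_integrable f" and b: "b > 0"
  shows "locally_integrable (\<lambda>x. a *\<^sub>R f (b *\<^sub>R x))"
  unfolding locally_integrable_def
proof (intro conjI allI impI)
  have [measurable]: "f \<in> borel_measurable borel" using f by (simp add: locally_integrable_def)
  show "(\<lambda>x. a *\<^sub>R f (b *\<^sub>R x)) \<in> borel_measurable lborel" by measurable
  fix K :: "(real^3) set" assume K: "compact K"
  then have bK: "compact ((\<lambda>x. b *\<^sub>R x) ` K)" by (rule compact_scaling)
  then have [measurable]: "(\<lambda>x. b *\<^sub>R x) ` K \<in> sets borel" by (simp add: compact_imp_closed)
  have "integrable lborel (\<lambda>x. indicator ((\<lambda>x. b *\<^sub>R x) ` K) x *\<^sub>R f x)"
    using f bK by (simp add: locally_integrable_def set_integrable_def)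
  from integrable_affine[OF _ _ this, of b 0]
  have "integrable lborel (\<lambda>x. indicator ((\<lambda>x. b *\<^sub>R x) ` K) (b *\<^sub>R x) *\<^sub>R f (b *\<^sub>R x))"
    using b by simp
  then have "integrable lborel (\<lambda>x. a *\<^sub>R indicator ((\<lambda>x. b *\<^sub>R x) ` K) (b *\<^sub>R x) *\<^sub>R f (b *\<^sub>R x))"
    by (rule integrable_scaleR_right)
  moreover have "indicator ((\<lambda>x. b *\<^sub>R x) ` K) (b *\<^sub>R x) = (indicator K x :: real)" for x
    using b by (auto simp: indicator_def)
  ultimately show "set_integrable lborel K (\<lambda>x. a *\<^sub>R f (b *\<^sub>R x))"
    by (simp add: set_integrable_def mult.commute)
qed

text \<open>A change of variables moves the scaling onto the test function, and the chain rule for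
  its partial derivatives supplies the factor b.\<close>

lemma has_weak_gradient_rescale:
  assumes g: "has_weak_gradient u g" and b: "b > 0"
  shows "has_weak_gradient (rescale a b u) (\<lambda>x. (a * b) *\<^sub>R g (b *\<^sub>R x))"
  unfolding has_weak_gradient_def
proof (intro conjI allI impI)
  have u: "locally_integrable u" and g': "locally_integrable g" using g by (auto simp: has_weak_gradient_def)
  have [measurable]: "u \<in> borel_measurable borel" "(\<lambda>x. g x $ i) \<in> borel_measurable borel" for i
    using u locally_integrable_component[OF g', of i] by (auto simp: locally_integrable_def)
  show "locally_integrable (rescale a b u)"
    using locally_integrable_scaleR[OF u b, of a] by (simp add: rescale_def)
  show "locally_integrable (\<lambda>x. (a * b) *\<^sub>R g (b *\<^sub>R x))" by (rule locally_integrable_scaleR[OF g' b])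
  fix \<phi> i assume \<phi>: "test_function \<phi>"
  define \<psi> where "\<psi> = (\<lambda>x. \<phi> ((1/b) *\<^sub>R x + 0))"
  have \<psi>: "test_function \<psi>" unfolding \<psi>_def using b by (intro test_function_affine[OF \<phi>]) auto
  have [measurable]: "\<psi> \<in> borel_measurable borel" "pderiv_at i \<psi> \<in> borel_measurable borel"
    using test_function_borel[OF \<psi>] test_function_borel[OF test_function_pderiv[OF \<psi>]] by auto
  have \<phi>\<psi>: "\<phi> x = \<psi> (b *\<^sub>R x)" for x using b by (simp add: \<psi>_def)
  have d: "pderiv_at i \<phi> x = b * pderiv_at i \<psi> (b *\<^sub>R x)" for x
    using pderiv_at_affine[of \<phi> "1/b" "b *\<^sub>R x" 0 i] test_function_differentiable[OF \<phi>] b by (simp add: \<psi>_def)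
  have "(LINT x|lborel. rescale a b u x * pderiv_at i \<phi> x) = (LINT x|lborel. (a * b) * ((\<lambda>y. u y * pderiv_at i \<psi> y) (b *\<^sub>R x + 0)))"
    by (simp add: rescale_def d mult_ac)
  also have "\<dots> = (a * b) * (1 / \<bar>b\<bar> ^ DIM(real^3) * (LINT y|lborel. u y * pderiv_at i \<psi> y))"
    using b by (subst integral_mult_right_zero, subst integral_affine) auto
  also have "(LINT y|lborel. u y * pderiv_at i \<psi> y) = - (LINT y|lborel. g y $ i * \<psi> y)"
    using g \<psi> by (simp add: has_weak_gradient_def)
  also have "(a * b) * (1 / \<bar>b\<bar> ^ DIM(real^3) * - (LINT y|lborel. g y $ i * \<psi> y))
    = - ((a * b) * (1 / \<bar>b\<bar> ^ DIM(real^3) * (LINT y|lborel. g y $ i * \<psi> y)))" by simp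
  also have "(a * b) * (1 / \<bar>b\<bar> ^ DIM(real^3) * (LINT y|lborel. g y $ i * \<psi> y))
     = (LINT x|lborel. (a * b) * ((\<lambda>y. g y $ i * \<psi> y) (b *\<^sub>R x + 0)))"
    using b by (subst integral_mult_right_zero, subst integral_affine) auto
  also have "\<dots> = (LINT x|lborel. ((a * b) *\<^sub>R g (b *\<^sub>R x)) $ i * \<phi> x)"
    by (simp add: \<phi>\<psi> mult_ac)
  finally show "(LINT x|lborel. rescale a b u x * pderiv_at i \<phi> x) = - (LINT x|lborel. ((a * b) *\<^sub>R g (b *\<^sub>R x)) $ i * \<phi> x)" .
qed

lemma square_integrable_rescale:
  fixes f :: "real^3 \<Rightarrow> 'b::euclidean_space"
  assumes "square_integrable f" "b > 0"
  shows "square_integrable (\<lambda>x. a *\<^sub>R f (b *\<^sub>R x))"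
proof -
  have [measurable]: "f \<in> borel_measurable borel" using assms by (simp add: square_integrable_def)
  have "integrable lborel (\<lambda>x. a\<^sup>2 * (norm (f (b *\<^sub>R x + 0)))\<^sup>2)"
    using assms by (intro integrable_mult_right integrable_affine[of "\<lambda>x. (norm (f x))\<^sup>2"])
      (auto simp: square_integrable_def)
  then show ?thesis by (simp add: square_integrable_def power_mult_distrib)
qed

lemma rescale_H1:
  assumes "u \<in> H1" "b > 0"
  shows "rescale a b u \<in> H1"
  unfolding H1_def
proof (intro CollectI conjI exI)
  note u = H1_weak_gradient[OF assms(1)]
  show "square_integrable (rescale a b u)"
    using square_integrable_rescale[OF u(2) assms(2), of a] by (simp add: rescale_def)
  show "has_weak_gradient (rescale a b u) (\<lambda>x. (a * b) *\<^sub>R weak_gradient u (b *\<^sub>R x))"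
    by (rule has_weak_gradient_rescale[OF u(1) assms(2)])
  show "square_integrable (\<lambda>x. (a * b) *\<^sub>R weak_gradient u (b *\<^sub>R x))"
    by (rule square_integrable_rescale[OF u(3) assms(2)])
qed

lemma mass_rescale:
  assumes "u \<in> H1" "b > 0"
  shows "mass (rescale a b u) = a\<^sup>2 / b^3 * mass u"
proof -
  have [measurable]: "u \<in> borel_measurable borel" using assms H1_borel by blast
  show ?thesis
    using assms integral_affine[of "\<lambda>x. \<bar>u x\<bar>\<^sup>2" b 0] by (simp add: mass_def rescale_def power_mult_distrib)
qed

lemma lp_power_rescale:
  assumes "u \<in> H1" "b > 0" "a \<ge> 0"
  shows "lp_power q (rescale a b u) = a powr q / b^3 * lp_power q u"
proof -
  have [measurable]: "u \<in> borel_measurable borel" using assms H1_borel by blast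
  show ?thesis
    using assms integral_affine[of "\<lambda>x. \<bar>u x\<bar> powr q" b 0]
    by (simp add: lp_power_def rescale_def abs_mult powr_mult)
qed

lemma dirichlet_rescale:
  assumes "u \<in> H1" "b > 0"
  shows "dirichlet (rescale a b u) = a\<^sup>2 / b * dirichlet u"
proof -
  note u = H1_weak_gradient[OF assms(1)]
  have [measurable]: "weak_gradient u \<in> borel_measurable borel" using u(3) by (simp add: square_integrable_def)
  have "dirichlet (rescale a b u) = (LINT x|lborel. (a * b)\<^sup>2 * (norm (weak_gradient u (b *\<^sub>R x + 0)))\<^sup>2)"
    using dirichlet_eq[OF has_weak_gradient_rescale[OF u(1) assms(2), of a]] by (simp add: power_mult_distrib abs_mult)
  also have "\<dots> = (a * b)\<^sup>2 * (1 / \<bar>b\<bar> ^ DIM(real^3) * dirichlet u)"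
    using assms integral_affine[of "\<lambda>x. (norm (weak_gradient u x))\<^sup>2" b 0] by (simp add: dirichlet_def)
  also have "\<dots> = a\<^sup>2 / b * dirichlet u"
    using assms(2) by (simp add: field_simps eval_nat_numeral)
  finally show ?thesis .
qed

lemma hartree_rescale:
  assumes "u \<in> H1" "b > 0"
  shows "hartree (rescale a b u) = a^4 / b^5 * hartree u"
proof -
  have [measurable]: "u \<in> borel_measurable borel" using assms H1_borel by blast
  define G where "G x = (LINT y|lborel. \<bar>u x\<bar>\<^sup>2 * \<bar>u y\<bar>\<^sup>2 / norm (x - y))" for x
  have [measurable]: "G \<in> borel_measurable borel" unfolding G_def by measurable
  have inner: "(LINT y|lborel. \<bar>rescale a b u x\<bar>\<^sup>2 * \<bar>rescale a b u y\<bar>\<^sup>2 / norm (x - y)) = a^4 / b\<^sup>2 * G (b *\<^sub>R x)" for x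
  proof -
    let ?F = "\<lambda>z. \<bar>u (b *\<^sub>R x)\<bar>\<^sup>2 * \<bar>u z\<bar>\<^sup>2 / norm (b *\<^sub>R x - z)"
    have n: "norm (b *\<^sub>R x - b *\<^sub>R y) = b * norm (x - y)" for y
      using assms(2) by (simp flip: scaleR_diff_right)
    have "(LINT y|lborel. \<bar>rescale a b u x\<bar>\<^sup>2 * \<bar>rescale a b u y\<bar>\<^sup>2 / norm (x - y)) = (LINT y|lborel. (a^4 * b) * ?F (b *\<^sub>R y + 0))"
      using assms(2) by (intro Bochner_Integration.integral_cong)
        (simp_all add: rescale_def n power4_eq_xxxx power2_eq_square)
    also have "\<dots> = (a^4 * b) * (1 / \<bar>b\<bar> ^ DIM(real^3) * G (b *\<^sub>R x))"
      using assms(2) by (subst integral_mult_right_zero, subst integral_affine) (auto simp: G_def)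
    also have "\<dots> = a^4 / b\<^sup>2 * G (b *\<^sub>R x)"
      using assms(2) by (simp add: field_simps eval_nat_numeral)
    finally show ?thesis .
  qed
  have "hartree (rescale a b u) = (LINT x|lborel. a^4 / b\<^sup>2 * G (b *\<^sub>R x + 0))"
    unfolding hartree_def inner by simp
  also have "\<dots> = a^4 / b\<^sup>2 * (1 / \<bar>b\<bar> ^ DIM(real^3) * (LINT x|lborel. G x))"
    using assms(2) by (subst integral_mult_right_zero, subst integral_affine) auto
  also have "(LINT x|lborel. G x) = hartree u" by (simp add: G_def hartree_def)
  also have "a^4 / b\<^sup>2 * (1 / \<bar>b\<bar> ^ DIM(real^3) * hartree u) = a^4 / b^5 * hartree u"
    using assms(2) by (simp add: field_simps eval_nat_numeral)
  finally show ?thesis .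
qed

section \<open>The Gagliardo-Nirenberg inequality for arbitrary mass\<close>

lemma gn_const_pos: "gn_const > 0"
  unfolding gn_const_def by (intro add_pos_nonneg) auto

lemma gagliardo_nirenberg:
  assumes u: "u \<in> H1" and m: "mass u > 0"
  shows "integrable lborel (\<lambda>x. \<bar>u x\<bar> powr (10/3))"
    and "lp_power (10/3) u \<le> gn_const * mass u powr (2/3) * dirichlet u"
proof -
  have [measurable]: "u \<in> borel_measurable borel" using u H1_borel by blast
  let ?X = "\<integral>\<^sup>+x. ennreal (\<bar>u x\<bar> powr (10/3)) \<partial>lborel"
  \<comment> \<open>A number A strictly above the gradient term can be divided by even if that term
    vanishes; at the end A is lowered to it.\<close>
  have main: "?X \<le> ennreal (gn_const * mass u powr (2/3) * A)" if A: "A > dirichlet u" for A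
  proof -
    have A0: "A > 0" using A dirichlet_nonneg[of u] by linarith
    \<comment> \<open>The parameters solve a^2 / b = 1 / A and a^2 / b^3 = 1 / mass u, so the
      gradient term becomes at most 1 and the mass equal to 1.\<close>
    define b where "b = sqrt (mass u / A)"
    define a where "a = sqrt (b / A)"
    have b: "b > 0" "b\<^sup>2 = mass u / A" using m A0 by (auto simp: b_def)
    have a: "a > 0" "a\<^sup>2 = b / A" using b A0 by (auto simp: a_def)
    let ?v = "rescale a b u"
    have vH: "?v \<in> H1" by (rule rescale_H1[OF u b(1)])
    have "dirichlet ?v = dirichlet u / A" using dirichlet_rescale[OF u b(1), of a] a b by simp
    then have dv: "dirichlet ?v \<le> 1" using A A0 by simp
    have "b^3 = b * (mass u / A)" using b(2) by (simp add: eval_nat_numeral)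
    then have mv: "mass ?v = 1" using mass_rescale[OF u b(1), of a] a b(1) m A0 by simp
    note v = H1_weak_gradient[OF vH]
    have "(\<integral>\<^sup>+x. ennreal (\<bar>?v x\<bar> powr (10/3)) \<partial>lborel) \<le> ennreal gn_const"
      using dv mv by (intro gn_normalized[OF v]) (auto simp: dirichlet_def mass_def)
    also have "(\<integral>\<^sup>+x. ennreal (\<bar>?v x\<bar> powr (10/3)) \<partial>lborel) = (\<integral>\<^sup>+x. ennreal (a powr (10/3)) * ennreal (\<bar>u (b *\<^sub>R x + 0)\<bar> powr (10/3)) \<partial>lborel)"
      using a by (simp add: rescale_def abs_mult powr_mult ennreal_mult)
    also have "\<dots> = ennreal (a powr (10/3)) * (ennreal (1 / \<bar>b\<bar> ^ DIM(real^3)) * ?X)"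
      using b by (subst nn_integral_cmult, measurable)
        (subst nn_integral_affine[of "\<lambda>x. ennreal (\<bar>u x\<bar> powr (10/3))"], auto)
    also have "\<dots> = ennreal (a powr (10/3) / b^3) * ?X"
      using b by (simp add: mult.assoc[symmetric] ennreal_mult[symmetric])
    finally have le: "ennreal (a powr (10/3) / b^3) * ?X \<le> ennreal gn_const" .
    have ap: "a powr (10/3) = (b / A) powr (5/3)"
      using a A0 b by (simp add: a_def powr_half_sqrt[symmetric] powr_powr)
    have bp: "b = (mass u / A) powr (1/2)"
      using m A0 by (simp add: b_def powr_half_sqrt)
    have q: "a powr (10/3) / b^3 = 1 / (mass u powr (2/3) * A)"
    proof -
      have "b^3 = b powr 3" using b by simp
      then have "a powr (10/3) / b^3 = b powr (5/3) / A powr (5/3) / b powr 3"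
        using b A0 by (simp add: ap powr_divide)
      also have "\<dots> = b powr (5/3) / b powr 3 / A powr (5/3)" by (simp only: divide_divide_eq_left mult.commute)
      also have "b powr (5/3) / b powr 3 = b powr (-(4/3))"
        using powr_diff[of b "5/3" 3] by simp
      also have "b powr (-(4/3)) = (mass u / A) powr (-(2/3))"
        by (subst bp, simp add: powr_powr)
      also have "\<dots> = A powr (2/3) / mass u powr (2/3)"
        using m A0 by (simp add: powr_minus_divide powr_divide)
      also have "A powr (2/3) / mass u powr (2/3) / A powr (5/3) = (A powr (2/3) / A powr (5/3)) / mass u powr (2/3)"
        by simp
      also have "A powr (2/3) / A powr (5/3) = A powr (-1)"
        using powr_diff[of A "2/3" "5/3"] by simp
      finally show ?thesis using A0 by (simp add: powr_minus_divide)
    qed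
    define c where "c = mass u powr (2/3) * A"
    have c: "c > 0" using m A0 by (simp add: c_def)
    have "?X = ennreal c * (ennreal (1 / c) * ?X)"
      using c by (simp add: mult.assoc[symmetric] ennreal_mult[symmetric])
    also have "\<dots> \<le> ennreal c * ennreal gn_const"
      using le unfolding q c_def by (intro mult_left_mono) auto
    also have "\<dots> = ennreal (gn_const * mass u powr (2/3) * A)"
      using c gn_const_pos by (simp add: c_def ennreal_mult[symmetric] mult_ac)
    finally show ?thesis .
  qed
  have "?X < \<infinity>" using main[of "dirichlet u + 1"] by (simp add: le_less_trans)
  then show int: "integrable lborel (\<lambda>x. \<bar>u x\<bar> powr (10/3))"
    by (simp add: integrable_iff_bounded)
  then have X: "?X = ennreal (lp_power (10/3) u)"
    unfolding lp_power_def by (intro nn_integral_eq_integral) auto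
  have le: "lp_power (10/3) u \<le> gn_const * mass u powr (2/3) * A" if A: "A > dirichlet u" for A
  proof -
    have "0 \<le> gn_const * mass u powr (2/3) * A" using A dirichlet_nonneg[of u] gn_const_pos by simp
    then show ?thesis using main[OF A] by (simp add: X)
  qed
  define d where "d = gn_const * mass u powr (2/3)"
  have d: "d > 0" using m gn_const_pos by (simp add: d_def)
  show "lp_power (10/3) u \<le> gn_const * mass u powr (2/3) * dirichlet u"
  proof (rule field_le_epsilon)
    fix e :: real assume e: "e > 0"
    have "lp_power (10/3) u \<le> d * (dirichlet u + e / d)" unfolding d_def using e d by (intro le) (simp add: d_def)
    then show "lp_power (10/3) u \<le> gn_const * mass u powr (2/3) * dirichlet u + e"
      using d by (simp add: distrib_left flip: d_def)
  qed
qed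

section \<open>Finiteness of the energy terms and the cubic bound\<close>

lemma powr_between:
  fixes s :: real
  assumes "s \<ge> 0" "l \<le> q" "q \<le> r" "l > 0"
  shows "s powr q \<le> s powr l + s powr r"
proof (cases "s \<le> 1")
  case True
  then have "s powr q \<le> s powr l" using assms by (cases "s = 0") (auto intro: powr_mono')
  then show ?thesis by (simp add: add_increasing2)
next
  case False
  then have "s powr q \<le> s powr r" using assms by (intro powr_mono) auto
  then show ?thesis by (simp add: add_increasing)
qed

lemma integrable_square: "u \<in> H1 \<Longrightarrow> integrable lborel (\<lambda>x. \<bar>u x\<bar>\<^sup>2)"
  using H1_weak_gradient(2) by (simp add: square_integrable_def)

lemma integrable_lp:
  assumes u: "u \<in> H1" "mass u > 0" and q: "2 \<le> q" "q \<le> 10/3"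
  shows "integrable lborel (\<lambda>x. \<bar>u x\<bar> powr q)"
proof (rule Bochner_Integration.integrable_bound)
  have [measurable]: "u \<in> borel_measurable borel" using u H1_borel by blast
  show "integrable lborel (\<lambda>x. \<bar>u x\<bar>\<^sup>2 + \<bar>u x\<bar> powr (10/3))"
    by (intro Bochner_Integration.integrable_add integrable_square gagliardo_nirenberg u)
  show "(\<lambda>x. \<bar>u x\<bar> powr q) \<in> borel_measurable lborel" by measurable
  show "AE x in lborel. norm (\<bar>u x\<bar> powr q) \<le> norm (\<bar>u x\<bar>\<^sup>2 + \<bar>u x\<bar> powr (10/3))"
  proof (rule AE_I2)
    fix x
    show "norm (\<bar>u x\<bar> powr q) \<le> norm (\<bar>u x\<bar>\<^sup>2 + \<bar>u x\<bar> powr (10/3))"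
      using powr_between[of "\<bar>u x\<bar>" 2 q "10/3"] q by simp
  qed
qed

text \<open>With b = |u|^(1/3) and m = 1, \<open>coulomb_power_le\<close> involves only the
  exponents 7/3, 10/3 and 2 of |u|, for which integrability is known.\<close>

lemma coulomb_finite:
  assumes u: "u \<in> H1" "mass u > 0"
  shows "coulomb (\<lambda>x. \<bar>u x\<bar>\<^sup>2) < \<infinity>"
proof -
  have [measurable]: "u \<in> borel_measurable borel" using u H1_borel by blast
  define b where "b x = \<bar>u x\<bar> powr (1/3)" for x
  have [measurable]: "b \<in> borel_measurable borel" unfolding b_def by measurable
  have b0: "0 \<le> b x" for x by (simp add: b_def)
  have pw: "b x ^ k = \<bar>u x\<bar> powr (real k / 3)" if "k > 0" for x k
    using that powr_realpow'[of "b x" k] by (simp add: b_def powr_powr)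
  have fin: "(\<integral>\<^sup>+x. ennreal (b x ^ k) \<partial>lborel) < \<infinity>" if "6 \<le> k" "k \<le> 10" for k
    using integrable_lp[OF u, of "real k / 3"] that by (simp add: pw integrable_iff_bounded)
  have "2 * coulomb (\<lambda>x. b x ^ 6) \<le> (\<integral>\<^sup>+x. ennreal (b x ^ 7) \<partial>lborel) * ((\<integral>\<^sup>+y. ennreal (b y ^ 10) \<partial>lborel) + ennreal (4 * pi)) + 2 * (\<integral>\<^sup>+x. ennreal (b x ^ 6) \<partial>lborel)\<^sup>2"
    using coulomb_power_le[of b 1] b0 by simp
  also have "\<dots> < \<infinity>"
    using fin[of 6] fin[of 7] fin[of 10] by (auto simp: ennreal_mult_less_top power2_eq_square)
  finally have "coulomb (\<lambda>x. b x ^ 6) < \<infinity>" by (auto simp: ennreal_mult_less_top)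
  moreover have "b x ^ 6 = \<bar>u x\<bar>\<^sup>2" for x by (simp add: pw)
  ultimately show ?thesis by simp
qed

text \<open>In \<open>hartree\<close> a divergent inner integral would count as 0. Finiteness of
  \<open>coulomb\<close> makes the inner integrals finite almost everywhere, so both expressions
  agree.\<close>

lemma coulomb_eq_hartree:
  assumes u: "u \<in> H1" "mass u > 0"
  shows "coulomb (\<lambda>x. \<bar>u x\<bar>\<^sup>2) = ennreal (hartree u)"
proof -
  have [measurable]: "u \<in> borel_measurable borel" using u H1_borel by blast
  define N where "N x = (\<integral>\<^sup>+y. ennreal (\<bar>u x\<bar>\<^sup>2 * \<bar>u y\<bar>\<^sup>2 / norm (x - y)) \<partial>lborel)" for x
  have [measurable]: "N \<in> borel_measurable borel" unfolding N_def by measurable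
  have c: "coulomb (\<lambda>x. \<bar>u x\<bar>\<^sup>2) = (\<integral>\<^sup>+x. N x \<partial>lborel)"
    unfolding coulomb_def N_def by (simp add: ennreal_mult[symmetric])
  then have fin: "(\<integral>\<^sup>+x. N x \<partial>lborel) < \<infinity>" using coulomb_finite[OF u] by simp
  have AEN: "AE x in lborel. N x \<noteq> \<infinity>" using fin by (intro nn_integral_PInf_AE) auto
  have "(LINT y|lborel. \<bar>u x\<bar>\<^sup>2 * \<bar>u y\<bar>\<^sup>2 / norm (x - y)) = enn2real (N x)" for x
    unfolding N_def by (intro integral_eq_nn_integral) auto
  then have "hartree u = (LINT x|lborel. enn2real (N x))" by (simp add: hartree_def)
  also have "\<dots> = enn2real (\<integral>\<^sup>+x. ennreal (enn2real (N x)) \<partial>lborel)"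
    by (intro integral_eq_nn_integral) auto
  also have "(\<integral>\<^sup>+x. ennreal (enn2real (N x)) \<partial>lborel) = (\<integral>\<^sup>+x. N x \<partial>lborel)"
    using AEN by (intro nn_integral_cong_AE, eventually_elim) (simp add: less_top)
  finally show ?thesis using fin c by simp
qed

text \<open>Duality with w = u^2 and l = 8 pi gives the gradient the coefficient 1; the Coulomb
  coefficient, 14/3 before division by 8 pi, is at most 4 pi. The resulting right side is twice the
  positive part of the energy, whereas p = 3 tolerates three times that part.\<close>

lemma cubic_bound:
  assumes u: "u \<in> H1" "mass u > 0"
  shows "lp_power 3 u \<le> dirichlet u + 1/2 * hartree u"
proof -
  have [measurable]: "u \<in> borel_measurable borel" using u H1_borel by blast
  note wg = H1_weak_gradient[OF u(1)]
  have "(\<integral>\<^sup>+x. ennreal (\<bar>u x\<bar> * \<bar>u x\<bar>\<^sup>2) \<partial>lborel) = (\<integral>\<^sup>+x. ennreal (\<bar>u x\<bar> powr 3) \<partial>lborel)"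
    by (simp add: eval_nat_numeral)
  also have "\<dots> = ennreal (lp_power 3 u)"
    unfolding lp_power_def using integrable_lp[OF u, of 3] by (intro nn_integral_eq_integral) auto
  finally have "ennreal (8 * pi) * ennreal (lp_power 3 u) \<le> ennreal (8 * pi) * ennreal (dirichlet u) + ennreal (112/3 * pi / (8 * pi)) * ennreal (hartree u)"
    using riesz_duality[OF wg, of "\<lambda>x. \<bar>u x\<bar>\<^sup>2" "8 * pi"] coulomb_eq_hartree[OF u] by (simp add: dirichlet_def)
  then have "ennreal (8 * pi * lp_power 3 u) \<le> ennreal (8 * pi * dirichlet u + 14/3 * hartree u)"
    using dirichlet_nonneg[of u] hartree_nonneg[of u] lp_power_nonneg[of 3 u]
    by (simp add: ennreal_mult[symmetric] ennreal_plus[symmetric] del: ennreal_plus)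
  then have "8 * pi * lp_power 3 u \<le> 8 * pi * dirichlet u + 14/3 * hartree u"
    using dirichlet_nonneg[of u] hartree_nonneg[of u] by (subst (asm) ennreal_le_iff) auto
  also have "14/3 * hartree u \<le> 8 * pi * (1/2 * hartree u)"
    using mult_right_mono[of "14/3" "4 * pi" "hartree u"] pi_ge_two hartree_nonneg[of u] by simp
  finally have "8 * pi * lp_power 3 u \<le> 8 * pi * (dirichlet u + 1/2 * hartree u)" by (simp add: distrib_left)
  then show ?thesis by simp
qed

section \<open>The thresholds\<close>

lemma test_function_H1:
  assumes "test_function \<phi>"
  shows "\<phi> \<in> H1"
  unfolding H1_def
proof (intro CollectI conjI exI)
  have sq: "integrable lborel (\<lambda>x. (\<psi> x)\<^sup>2)" if "test_function \<psi>" for \<psi>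
    using integrable_mult_test[OF locally_integrable_const[of 1] test_function_mult[OF that that]]
    by (simp add: power2_eq_square)
  show "square_integrable \<phi>"
    using sq[OF assms] test_function_borel[OF assms] by (simp add: square_integrable_def)
  show wg: "has_weak_gradient \<phi> (\<lambda>x. \<chi> i. pderiv_at i \<phi> x)"
    by (rule has_weak_gradient_test_function[OF assms])
  have "(norm (\<chi> i. pderiv_at i \<phi> x))\<^sup>2 = (\<Sum>i\<in>UNIV. (pderiv_at i \<phi> x)\<^sup>2)" for x
    by (simp add: norm_vec_def L2_set_def sum_nonneg)
  then show "square_integrable (\<lambda>x. \<chi> i. pderiv_at i \<phi> x)"
    using wg sq[OF test_function_pderiv[OF assms]]
    by (auto simp: square_integrable_def has_weak_gradient_def locally_integrable_def)
qed

text \<open>Over an empty sphere the infimum would be \<infinity>; a bump function multiplied by a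
  constant rules this out.\<close>

lemma mass_sphere_nonempty:
  assumes "c > 0"
  obtains u where "u \<in> mass_sphere c"
proof -
  define \<phi> where "\<phi> = box_bump 0 1"
  have "\<phi> x \<noteq> 0 \<longleftrightarrow> x \<in> box 0 1" for x
    using box_bump_pos_iff[of 0 1 x] box_bump_range(1)[of 0 1 x] unfolding \<phi>_def by linarith
  then have supp: "{x. \<phi> x \<noteq> 0} = box (0::real^3) 1" by blast
  then have test: "test_function \<phi>"
    by (simp add: test_function_iff bounded_box) (simp add: \<phi>_def k_smooth_box_bump)
  have H: "\<phi> \<in> H1" by (rule test_function_H1[OF test])
  have "mass \<phi> \<noteq> 0"
  proof
    assume "mass \<phi> = 0"
    then have "AE x in lborel. \<bar>\<phi> x\<bar>\<^sup>2 = 0"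
      using integrable_square[OF H] unfolding mass_def by (subst (asm) integral_nonneg_eq_0_iff_AE) auto
    then have "AE x in lborel. x \<notin> box (0::real^3) 1"
      by eventually_elim (use supp in auto)
    then have "emeasure lborel (box (0::real^3) 1) = 0"
      by (subst (asm) AE_iff_measurable[OF _ refl]) auto
    moreover have "emeasure lborel (box (0::real^3) 1) = 1"
      by (subst emeasure_lborel_box) (auto simp: Basis_vec_def inner_axis prod.neutral)
    ultimately show False by simp
  qed
  then have m: "mass \<phi> > 0" using H1_mass_nonneg[of \<phi>] by linarith
  have "rescale (sqrt (c / mass \<phi>)) 1 \<phi> \<in> mass_sphere c"
    unfolding mass_sphere_iff using rescale_H1[OF H, of 1] mass_rescale[OF H, of 1] m assms by simp
  then show ?thesis using that by blast
qed

text \<open>The gradient term scales by a^2 / b and the Coulomb term by a^4 / b^5. For a > 0 these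
  agree exactly if a = b^2, which leaves a single power of \<theta> to decide the sign of the
  energy.\<close>

lemma dilation:
  assumes u: "u \<in> mass_sphere c" and th: "\<theta> > 0" and p: "p > 0"
  shows "rescale (\<theta>\<^sup>2) \<theta> u \<in> mass_sphere (\<theta> * c)"
    and "energy p (rescale (\<theta>\<^sup>2) \<theta> u) = \<theta>^3 * (1/2 * dirichlet u + 1/4 * hartree u - \<theta> powr (2 * p - 6) * (1/p * lp_power p u))"
proof -
  have H: "u \<in> H1" and m: "mass u = c" using u by (auto simp: mass_sphere_iff)
  show "rescale (\<theta>\<^sup>2) \<theta> u \<in> mass_sphere (\<theta> * c)"
    using rescale_H1[OF H th] mass_rescale[OF H th, of "\<theta>\<^sup>2"] m th
    by (simp add: mass_sphere_iff field_simps eval_nat_numeral)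
  have d: "dirichlet (rescale (\<theta>\<^sup>2) \<theta> u) = \<theta>^3 * dirichlet u"
    using dirichlet_rescale[OF H th, of "\<theta>\<^sup>2"] th by (simp add: field_simps eval_nat_numeral)
  have h: "hartree (rescale (\<theta>\<^sup>2) \<theta> u) = \<theta>^3 * hartree u"
    using hartree_rescale[OF H th, of "\<theta>\<^sup>2"] th by (simp add: field_simps eval_nat_numeral)
  have t2: "\<theta>\<^sup>2 = \<theta> powr 2" "\<theta>^3 = \<theta> powr 3" using th by simp_all
  have "\<theta>\<^sup>2 powr p / \<theta>^3 = \<theta> powr (2 * p) / \<theta> powr 3"
    unfolding t2 by (simp add: powr_powr)
  also have "\<dots> = \<theta> powr (3 + (2 * p - 6))" by (simp flip: powr_diff)
  also have "\<dots> = \<theta>^3 * \<theta> powr (2 * p - 6)" unfolding t2 by (rule powr_add)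
  finally have l: "lp_power p (rescale (\<theta>\<^sup>2) \<theta> u) = \<theta>^3 * \<theta> powr (2 * p - 6) * lp_power p u"
    using lp_power_rescale[OF H th, of "\<theta>\<^sup>2" p] by simp
  show "energy p (rescale (\<theta>\<^sup>2) \<theta> u) = \<theta>^3 * (1/2 * dirichlet u + 1/4 * hartree u - \<theta> powr (2 * p - 6) * (1/p * lp_power p u))"
    unfolding energy_eq d h l using p by (simp add: field_simps)
qed

text \<open>Small t spreads u out and sends the positive terms to 0. For p = 10/3 the last exponent
  is 2, so for large t the gradient term and the power term compete at the same order, above the
  Coulomb term.\<close>

lemma mass_preserving_dilation:
  assumes u: "u \<in> mass_sphere c" and t: "t > 0" and p: "p > 0"
  shows "rescale (t powr (3/2)) t u \<in> mass_sphere c"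
    and "energy p (rescale (t powr (3/2)) t u) = t\<^sup>2 * (1/2 * dirichlet u) + t * (1/4 * hartree u) - t powr (3/2 * p - 3) * (1/p * lp_power p u)"
proof -
  let ?v = "rescale (t powr (3/2)) t u"
  have H: "u \<in> H1" and m: "mass u = c" using u by (auto simp: mass_sphere_iff)
  have a2: "(t powr (3/2))\<^sup>2 = t^3" using t by (simp add: powr_power)
  have "(t powr (3/2))^4 = ((t powr (3/2))\<^sup>2)\<^sup>2" by (simp flip: power_mult)
  then have a4: "(t powr (3/2))^4 = t^6" using a2 by (simp flip: power_mult)
  show "?v \<in> mass_sphere c"
    using rescale_H1[OF H t] mass_rescale[OF H t, of "t powr (3/2)"] m t by (simp add: mass_sphere_iff a2)
  have d: "dirichlet ?v = t\<^sup>2 * dirichlet u"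
    using dirichlet_rescale[OF H t, of "t powr (3/2)"] t
    unfolding a2 by (simp add: field_simps eval_nat_numeral)
  have h: "hartree ?v = t * hartree u"
    using hartree_rescale[OF H t, of "t powr (3/2)"] t
    unfolding a4 by (simp add: field_simps eval_nat_numeral)
  have "(t powr (3/2)) powr p / t^3 = t powr (3/2 * p) / t powr 3" using t by (simp add: powr_powr)
  also have "\<dots> = t powr (3/2 * p - 3)" by (simp flip: powr_diff)
  finally have l: "lp_power p ?v = t powr (3/2 * p - 3) * lp_power p u"
    using lp_power_rescale[OF H t, of "t powr (3/2)" p] by simp
  show "energy p ?v = t\<^sup>2 * (1/2 * dirichlet u) + t * (1/4 * hartree u) - t powr (3/2 * p - 3) * (1/p * lp_power p u)"
    unfolding energy_eq d h l using p by (simp add: field_simps)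
qed

section \<open>Sign of the minimal energy and effect of dilations on it\<close>

lemma min_energy_lower: "u \<in> mass_sphere c \<Longrightarrow> min_energy p c \<le> ereal (energy p u)"
  unfolding min_energy_def by (rule INF_lower)

text \<open>Spreading the mass out, with t tending to 0, makes the gradient and Coulomb terms
  vanish; the remaining term only lowers the energy.\<close>

lemma min_energy_nonpos:
  assumes c: "c > 0" and p: "p > 0"
  shows "min_energy p c \<le> 0"
proof -
  obtain u where u: "u \<in> mass_sphere c" using mass_sphere_nonempty[OF c] .
  let ?E = "\<lambda>t. t\<^sup>2 * (1/2 * dirichlet u) + t * (1/4 * hartree u)"
  have "((\<lambda>t. ?E t) \<longlongrightarrow> 0\<^sup>2 * (1/2 * dirichlet u) + 0 * (1/4 * hartree u)) (at_right 0)"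
    by (intro tendsto_intros)
  then have "((\<lambda>t. ereal (?E t)) \<longlongrightarrow> ereal 0) (at_right 0)" by simp
  moreover have "\<forall>\<^sub>F t in at_right 0. min_energy p c \<le> ereal (?E t)"
  proof (rule eventually_at_right_less[THEN eventually_mono])
    fix t :: real assume t: "0 < t"
    have "min_energy p c \<le> ereal (energy p (rescale (t powr (3/2)) t u))"
      by (rule min_energy_lower[OF mass_preserving_dilation(1)[OF u t p]])
    also have "\<dots> \<le> ereal (?E t)"
      unfolding mass_preserving_dilation(2)[OF u t p] using p lp_power_nonneg[of p u] by simp
    finally show "min_energy p c \<le> ereal (?E t)" .
  qed
  ultimately have "min_energy p c \<le> ereal 0"
    by (rule tendsto_lowerbound) simp
  then show ?thesis by (simp only: zero_ereal_def)
qed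

lemma min_energy_neg_iff: "min_energy p c < 0 \<longleftrightarrow> (\<exists>u\<in>mass_sphere c. energy p u < 0)"
  unfolding min_energy_def by (simp add: INF_less_iff)

lemma min_energy_nonneg: "(\<And>u. u \<in> mass_sphere c \<Longrightarrow> 0 \<le> energy p u) \<Longrightarrow> 0 \<le> min_energy p c"
  unfolding min_energy_def by (intro INF_greatest) simp

lemma lp_power_pos:
  assumes "u \<in> mass_sphere c" "c > 0" "2 \<le> q" "q \<le> 10/3"
  shows "lp_power q u > 0"
proof -
  have u: "u \<in> H1" "mass u > 0" "mass u \<noteq> 0" using assms by (auto simp: mass_sphere_iff)
  then have "lp_power q u \<noteq> 0"
    using AE_zero_if_lp_power_zero[OF u(1) integrable_lp[OF u(1,2) assms(3,4)]] by blast
  then show ?thesis using lp_power_nonneg[of q u] by linarith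
qed

lemma energy_dilation_le:
  assumes u: "u \<in> mass_sphere c" and th: "\<theta> \<ge> 1" and p: "p \<ge> 3"
  shows "energy p (rescale (\<theta>\<^sup>2) \<theta> u) \<le> \<theta>^3 * energy p u"
proof -
  have "1 \<le> \<theta> powr (2 * p - 6)" using th p by (intro ge_one_powr_ge_zero) auto
  then have "1 * (1/p * lp_power p u) \<le> \<theta> powr (2 * p - 6) * (1/p * lp_power p u)"
    using lp_power_nonneg[of p u] p by (intro mult_right_mono) auto
  moreover have "\<theta> > 0" "p > 0" "0 \<le> \<theta>^3" using th p by auto
  ultimately show ?thesis
    using dilation(2)[OF u, of \<theta> p] by (auto simp: energy_eq intro!: mult_left_mono)
qed

lemma energy_dilation_neg:
  assumes u: "u \<in> mass_sphere c" and c: "c > 0" and th: "\<theta> > 1" and p: "3 < p" "p \<le> 10/3"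
    and E: "energy p u \<le> 0"
  shows "energy p (rescale (\<theta>\<^sup>2) \<theta> u) < 0"
proof -
  have "\<theta> powr (2 * p - 6) > \<theta> powr 0" using th p by (intro powr_less_mono) auto
  then have "1 < \<theta> powr (2 * p - 6)" using th by simp
  then have "1 * (1/p * lp_power p u) < \<theta> powr (2 * p - 6) * (1/p * lp_power p u)"
    using lp_power_pos[OF u c, of p] p by (intro mult_strict_right_mono) auto
  then have "1/2 * dirichlet u + 1/4 * hartree u - \<theta> powr (2 * p - 6) * (1/p * lp_power p u) < 0"
    using E by (simp add: energy_eq)
  then show ?thesis
    using dilation(2)[OF u, of \<theta> p] th p by (simp add: mult_pos_neg)
qed

lemma exists_negative_energy:
  assumes p: "3 < p" "p \<le> 10/3"
  obtains c u where "c > 0" "u \<in> mass_sphere c" "energy p u < 0"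
proof -
  obtain u where u: "u \<in> mass_sphere 1" using mass_sphere_nonempty[of 1] by auto
  define X Y where "X = 1/2 * dirichlet u + 1/4 * hartree u" and "Y = 1/p * lp_power p u"
  have X: "X \<ge> 0" using dirichlet_nonneg[of u] hartree_nonneg[of u] by (simp add: X_def)
  have Y: "Y > 0" using lp_power_pos[OF u, of p] p by (simp add: Y_def)
  \<comment> \<open>Chosen so that the negative term grows to X + 1.\<close>
  define \<theta> where "\<theta> = ((X + 1) / Y) powr (1 / (2 * p - 6))"
  have th: "\<theta> > 0" using X Y by (simp add: \<theta>_def)
  have "\<theta> powr (2 * p - 6) = (X + 1) / Y" using X Y p by (simp add: \<theta>_def powr_powr)
  then have "X - \<theta> powr (2 * p - 6) * Y = - 1" using Y by simp
  then have "energy p (rescale (\<theta>\<^sup>2) \<theta> u) < 0"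
    using dilation(2)[OF u th, of p] th p by (simp add: X_def Y_def)
  then show ?thesis using that[of "\<theta> * 1"] dilation(1)[OF u th, of p] th p by simp
qed

definition small_mass :: real where
  "small_mass = (1 / (2 * gn_const)) powr (3/2)"

lemma small_mass_pos: "small_mass > 0"
  using gn_const_pos by (simp add: small_mass_def)

lemma small_mass_gn:
  assumes "0 < c" "c \<le> small_mass"
  shows "gn_const * c powr (2/3) \<le> 1/2"
proof -
  have "c powr (2/3) \<le> small_mass powr (2/3)" using assms by (intro powr_mono2) auto
  also have "\<dots> = 1 / (2 * gn_const)" using gn_const_pos by (simp add: small_mass_def powr_powr)
  finally show ?thesis using gn_const_pos by (simp add: field_simps)
qed

lemma small_mass_bound:
  assumes u: "u \<in> mass_sphere c" and c: "0 < c" "c \<le> small_mass"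
  shows "lp_power (10/3) u \<le> 1/2 * dirichlet u"
proof -
  have H: "u \<in> H1" "mass u > 0" "mass u = c" using u c by (auto simp: mass_sphere_iff)
  have "lp_power (10/3) u \<le> gn_const * c powr (2/3) * dirichlet u"
    using gagliardo_nirenberg(2)[OF H(1,2)] H(3) by simp
  also have "\<dots> \<le> 1/2 * dirichlet u"
    by (intro mult_right_mono small_mass_gn c dirichlet_nonneg)
  finally show ?thesis .
qed

text \<open>For p between 3 and 10/3, |u|^p is at most |u|^3 + |u|^(10/3). The cubic part costs one
  gradient term and half a Coulomb term, the other part half a gradient term at small mass. Together
  this is at most three times the positive part of the energy, and 1/p \<le> 1/3; this balance
  dictates the 1/2 behind \<open>small_mass\<close>.\<close>

lemma energy_nonneg_small_mass:
  assumes u: "u \<in> mass_sphere c" and c: "0 < c" "c \<le> small_mass" and p: "3 \<le> p" "p \<le> 10/3"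
  shows "0 \<le> energy p u"
proof -
  have H: "u \<in> H1" "mass u > 0" using u c by (auto simp: mass_sphere_iff)
  have "lp_power p u \<le> (LINT x|lborel. \<bar>u x\<bar> powr 3 + \<bar>u x\<bar> powr (10/3))"
    unfolding lp_power_def
    using p integrable_lp[OF H, of p] integrable_lp[OF H, of 3] integrable_lp[OF H, of "10/3"]
    by (intro integral_mono Bochner_Integration.integrable_add powr_between) auto
  also have "\<dots> = lp_power 3 u + lp_power (10/3) u"
    unfolding lp_power_def using integrable_lp[OF H, of 3] integrable_lp[OF H, of "10/3"]
    by (intro Bochner_Integration.integral_add) auto
  also have "\<dots> \<le> (dirichlet u + 1/2 * hartree u) + 1/2 * dirichlet u"
    by (intro add_mono cubic_bound[OF H] small_mass_bound[OF u c])
  also have "\<dots> \<le> 3 * (1/2 * dirichlet u + 1/4 * hartree u)"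
    using hartree_nonneg[of u] by (simp add: field_simps)
  finally have "lp_power p u \<le> 3 * (1/2 * dirichlet u + 1/4 * hartree u)" .
  moreover have "1/p * lp_power p u \<le> 1/3 * lp_power p u"
    using p lp_power_nonneg[of p u] by (intro mult_right_mono) (auto simp: field_simps)
  ultimately show ?thesis by (simp add: energy_eq)
qed

lemma energy_pos_small_mass_critical:
  assumes u: "u \<in> mass_sphere c" and c: "0 < c" "c \<le> small_mass"
  shows "0 < energy (10/3) u"
proof -
  have "0 < lp_power (10/3) u" using lp_power_pos[OF u c(1)] by simp
  moreover have "lp_power (10/3) u \<le> 1/2 * dirichlet u" by (rule small_mass_bound[OF u c])
  ultimately show ?thesis using hartree_nonneg[of u] by (simp add: energy_eq)
qed

text \<open>Below the exponent 10/3, splitting at a level L bounds |u|^p by a multiple of u^2 and a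
  small multiple of |u|^(10/3), which the gradient absorbs. The infimum has to be finite for the
  strict comparison of two masses later.\<close>

lemma min_energy_bounded_below:
  assumes c: "c > 0" and p: "3 \<le> p" "p < 10/3"
  shows "min_energy p c \<noteq> -\<infinity>"
proof -
  define k where "k = gn_const * c powr (2/3)"
  have k: "k > 0" using gn_const_pos c by (simp add: k_def)
  \<comment> \<open>Makes the small multiple equal to 1 / (k + 1), which beats the
    Gagliardo-Nirenberg factor k.\<close>
  define L where "L = (k + 1) powr (1 / (10/3 - p))"
  have L: "L > 0" using k by (simp add: L_def)
  have Lp: "L powr (p - 10/3) = 1 / (k + 1)"
  proof -
    have "1 / (10/3 - p) * (p - 10/3) = -1" using p by (simp add: field_simps)
    then show ?thesis using k by (simp add: L_def powr_powr powr_minus_divide)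
  qed
  have "- (L powr (p - 2) * c) \<le> energy p u" if u: "u \<in> mass_sphere c" for u
  proof -
    have H: "u \<in> H1" "mass u > 0" "mass u = c" using u c by (auto simp: mass_sphere_iff)
    have pt: "s powr p \<le> L powr (p - 2) * s\<^sup>2 + L powr (p - 10/3) * s powr (10/3)" if s: "s \<ge> 0" for s
    proof (cases "s = 0")
      case False
      then have s: "s > 0" using s by simp
      show ?thesis
      proof (cases "s \<le> L")
        case True
        have "s powr p = s powr (p - 2) * s\<^sup>2" using s by (simp add: powr_diff)
        also have "\<dots> \<le> L powr (p - 2) * s\<^sup>2" using True s p by (intro mult_right_mono powr_mono2) auto
        finally show ?thesis by (simp add: add_increasing2)
      next
        case False
        have "s powr p = s powr (p - 10/3) * s powr (10/3)" using s by (simp add: powr_diff)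
        also have "\<dots> \<le> L powr (p - 10/3) * s powr (10/3)"
          using False L p by (intro mult_right_mono powr_mono2') auto
        finally show ?thesis by (simp add: add_increasing)
      qed
    qed (use p in simp)
    have "lp_power p u \<le> (LINT x|lborel. L powr (p - 2) * \<bar>u x\<bar>\<^sup>2 + L powr (p - 10/3) * \<bar>u x\<bar> powr (10/3))"
      unfolding lp_power_def
      using p integrable_lp[OF H(1,2)] integrable_square[OF H(1)]
      by (intro integral_mono Bochner_Integration.integrable_add integrable_mult_right pt) auto
    also have "\<dots> = L powr (p - 2) * c + L powr (p - 10/3) * lp_power (10/3) u"
      unfolding lp_power_def H(3)[symmetric] mass_def
      using integrable_lp[OF H(1,2), of "10/3"] integrable_square[OF H(1)]
      by (subst Bochner_Integration.integral_add) auto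
    also have "L powr (p - 10/3) * lp_power (10/3) u \<le> 1 / (k + 1) * (k * dirichlet u)"
      unfolding Lp using gagliardo_nirenberg(2)[OF H(1,2)] k by (intro mult_left_mono) (auto simp: H(3) k_def)
    also have "\<dots> \<le> 1 * dirichlet u"
      using k dirichlet_nonneg[of u] by (simp only: mult.assoc[symmetric]) (intro mult_right_mono, auto)
    finally have le: "lp_power p u \<le> L powr (p - 2) * c + dirichlet u" by simp
    have "1/p * lp_power p u \<le> 1/2 * lp_power p u"
      using p lp_power_nonneg[of p u] by (intro mult_right_mono) (auto simp: field_simps)
    then have "1/p * lp_power p u \<le> L powr (p - 2) * c + 1/2 * dirichlet u"
      using le mult_nonneg_nonneg[OF powr_ge_zero[of L "p - 2"] less_imp_le[OF c]] by (simp add: field_simps)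
    then show ?thesis using hartree_nonneg[of u] unfolding energy_eq by linarith
  qed
  then have "ereal (- (L powr (p - 2) * c)) \<le> min_energy p c"
    unfolding min_energy_def by (intro INF_greatest) simp
  then show ?thesis by auto
qed

section \<open>The two thresholds\<close>

lemma threshold_neg_pos:
  assumes "3 \<le> p" "p \<le> 10/3"
  shows "0 < threshold_neg p"
proof -
  have "ereal small_mass \<le> threshold_neg p"
    unfolding threshold_neg_def
  proof (intro Inf_greatest, clarsimp)
    fix c assume c: "0 < c" "min_energy p c < 0"
    show "small_mass \<le> c"
    proof (rule ccontr)
      assume "\<not> small_mass \<le> c"
      then have "0 \<le> min_energy p c"
        using c assms energy_nonneg_small_mass by (intro min_energy_nonneg) auto
      then show False using c by simp
    qed
  qed
  then show ?thesis using small_mass_pos less_le_trans[of 0 "ereal small_mass"] by simp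
qed

lemma threshold_nonpos_pos: "0 < threshold_nonpos (10/3)"
proof -
  have "ereal small_mass \<le> threshold_nonpos (10/3)"
    unfolding threshold_nonpos_def
  proof (intro Inf_greatest, clarsimp)
    fix c u assume c: "0 < c" "u \<in> mass_sphere c" "energy (10/3) u \<le> 0"
    show "small_mass \<le> c"
      using energy_pos_small_mass_critical[OF c(2,1)] c(3) by (meson leI less_imp_le not_less)
  qed
  then show ?thesis using small_mass_pos less_le_trans[of 0 "ereal small_mass"] by simp
qed

lemma threshold_finite:
  assumes "3 < p" "p \<le> 10/3"
  shows "threshold_neg p < \<infinity>" "threshold_nonpos p < \<infinity>"
proof -
  obtain c u where cu: "c > 0" "u \<in> mass_sphere c" "energy p u < 0"
    using exists_negative_energy[OF assms] .
  have "threshold_neg p \<le> ereal c"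
    unfolding threshold_neg_def using cu min_energy_neg_iff by (intro Inf_lower) auto
  moreover have "threshold_nonpos p \<le> ereal c"
    unfolding threshold_nonpos_def using cu by (intro Inf_lower) (auto intro: less_imp_le)
  ultimately show "threshold_neg p < \<infinity>" "threshold_nonpos p < \<infinity>"
    by (auto intro: le_less_trans)
qed

text \<open>Negative energy is an open condition: a function that has it at mass c keeps it under a
  dilation with \<theta> < 1 close to 1, so c lies strictly above the threshold. This settles the
  threshold mass itself, too.\<close>

lemma min_energy_zero_below_threshold:
  assumes p: "3 < p" "p \<le> 10/3" and c: "0 < c" "ereal c \<le> threshold_neg p"
  shows "min_energy p c = 0"
proof (rule antisym)
  show "min_energy p c \<le> 0" using p by (intro min_energy_nonpos c) auto
  show "0 \<le> min_energy p c"
  proof (rule ccontr)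
    assume "\<not> ?thesis"
    then obtain u where u: "u \<in> mass_sphere c" "energy p u < 0"
      using min_energy_neg_iff[of p c] by auto
    define X Y where "X = 1/2 * dirichlet u + 1/4 * hartree u" and "Y = 1/p * lp_power p u"
    have X: "X \<ge> 0" using dirichlet_nonneg[of u] hartree_nonneg[of u] by (simp add: X_def)
    have Y: "X < Y" using u(2) by (simp add: X_def Y_def energy_eq)
    \<comment> \<open>The midpoint of X / Y and 1: below 1, and still with X < s Y.\<close>
    define s where "s = (X / Y + 1) / 2"
    have s: "0 < s" "s < 1" "X < s * Y" using X Y by (auto simp: s_def field_simps add_pos_nonneg)
    define \<theta> where "\<theta> = s powr (1 / (2 * p - 6))"
    have th: "\<theta> > 0" using s by (simp add: \<theta>_def)
    have "\<theta> < 1 powr (1 / (2 * p - 6))" unfolding \<theta>_def using s p by (intro powr_less_mono2) auto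
    then have th1: "\<theta> < 1" by simp
    have "\<theta> powr (2 * p - 6) = s" using s p by (simp add: \<theta>_def powr_powr)
    then have "energy p (rescale (\<theta>\<^sup>2) \<theta> u) = \<theta>^3 * (X - s * Y)"
      using dilation(2)[OF u(1) th, of p] p by (simp add: X_def Y_def)
    also have "\<dots> < 0" using th s by (simp add: mult_pos_neg)
    finally have "energy p (rescale (\<theta>\<^sup>2) \<theta> u) < 0" .
    then have "min_energy p (\<theta> * c) < 0"
      using dilation(1)[OF u(1) th, of p] p min_energy_neg_iff by auto
    then have "threshold_neg p \<le> ereal (\<theta> * c)"
      unfolding threshold_neg_def using th c by (intro Inf_lower) auto
    then have "c \<le> \<theta> * c" using c order_trans by fastforce
    then show False using th1 c by simp
  qed
qed

text \<open>The threshold is an infimum, so some mass c' < c already carries negative energy, and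
  dilation by c / c' > 1 preserves the sign.\<close>

lemma min_energy_neg_above_threshold:
  assumes p: "3 < p" "p \<le> 10/3" and c: "threshold_neg p < ereal c"
  shows "0 < c" "min_energy p c < 0"
proof -
  obtain c' where c': "0 < c'" "min_energy p c' < 0" "c' < c"
    using c unfolding threshold_neg_def by (auto simp: Inf_less_iff)
  then obtain u where u: "u \<in> mass_sphere c'" "energy p u < 0" using min_energy_neg_iff by blast
  have th: "c / c' > 1" using c' by simp
  then have "energy p (rescale ((c / c')\<^sup>2) (c / c') u) < 0"
    using u c' p by (intro energy_dilation_neg[OF u(1)]) auto
  moreover have "rescale ((c / c')\<^sup>2) (c / c') u \<in> mass_sphere c"
    using dilation(1)[OF u(1), of "c / c'" p] c' p by simp
  ultimately show "min_energy p c < 0" using min_energy_neg_iff by blast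
  show "0 < c" using c' by simp
qed

text \<open>An almost minimiser suffices. Since m(c) is finite and negative, m(c) / \<theta>^3 lies
  strictly above it for \<theta> = d / c, so some u has energy below that quotient; after the
  dilation its energy is below m(c), with a strict gap that is independent of d's minimising
  sequences.\<close>

lemma min_energy_strictly_decreasing:
  assumes p: "3 < p" "p < 10/3" and c: "threshold_neg p < ereal c" and d: "c < d"
  shows "min_energy p d < min_energy p c"
proof -
  have c0: "0 < c" "min_energy p c < 0" using min_energy_neg_above_threshold[of p c] p c by auto
  have "min_energy p c \<noteq> -\<infinity>" using min_energy_bounded_below[OF c0(1)] p by auto
  then obtain m where m: "min_energy p c = ereal m" using c0(2) by (cases "min_energy p c") auto
  have m0: "m < 0" using m c0 by simp
  define \<theta> where "\<theta> = d / c"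
  have th: "\<theta> > 1" "\<theta> * c = d" using c0 d by (auto simp: \<theta>_def)
  have th3: "\<theta>^3 > 1" using th by (intro one_less_power) auto
  have "m < m / \<theta>^3" using m0 th3 th by (simp add: pos_less_divide_eq)
  then have "min_energy p c < ereal (m / \<theta>^3)" using m by simp
  then obtain u where u: "u \<in> mass_sphere c" "energy p u < m / \<theta>^3"
    unfolding min_energy_def by (auto simp: INF_less_iff)
  have "min_energy p d \<le> ereal (energy p (rescale (\<theta>\<^sup>2) \<theta> u))"
    using dilation(1)[OF u(1), of \<theta> p] th p by (intro min_energy_lower) simp
  also have "\<dots> \<le> ereal (\<theta>^3 * energy p u)" using energy_dilation_le[OF u(1), of \<theta> p] th p by simp
  also have "\<dots> < ereal m" using u(2) th by (simp add: pos_less_divide_eq mult.commute)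
  finally show ?thesis using m by simp
qed

lemma min_energy_cubic:
  assumes "0 < c"
  shows "min_energy 3 c = 0"
proof (rule antisym)
  show "min_energy 3 c \<le> 0" using assms by (intro min_energy_nonpos) auto
  show "0 \<le> min_energy 3 c"
  proof (rule min_energy_nonneg)
    fix u assume u: "u \<in> mass_sphere c"
    then have "lp_power 3 u \<le> dirichlet u + 1/2 * hartree u"
      using assms by (intro cubic_bound) (auto simp: mass_sphere_iff)
    then show "0 \<le> energy 3 u" using dirichlet_nonneg[of u] hartree_nonneg[of u] by (simp add: energy_eq)
  qed
qed

lemma min_energy_critical_below:
  assumes c: "0 < c" "ereal c < threshold_nonpos (10/3)"
  shows "min_energy (10/3) c = 0"
proof (rule antisym)
  show "min_energy (10/3) c \<le> 0" using c by (intro min_energy_nonpos) auto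
  show "0 \<le> min_energy (10/3) c"
  proof (rule min_energy_nonneg, rule ccontr)
    fix u assume "u \<in> mass_sphere c" "\<not> 0 \<le> energy (10/3) u"
    then have "threshold_nonpos (10/3) \<le> ereal c"
      unfolding threshold_nonpos_def using c by (intro Inf_lower) (auto intro!: exI bexI[of _ u])
    then show False using c by simp
  qed
qed

text \<open>Dilating from a smaller mass gives strictly negative energy at mass c, hence a surplus e
  > 0 of the power term over the gradient term. The mass-preserving dilation multiplies this surplus
  by t^2 but the Coulomb term only by t.\<close>

lemma min_energy_critical_above:
  assumes c: "threshold_nonpos (10/3) < ereal c"
  shows "min_energy (10/3) c = -\<infinity>"
proof -
  obtain c' u where c': "0 < c'" "c' < c" and u: "u \<in> mass_sphere c'" "energy (10/3) u \<le> 0"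
    using c unfolding threshold_nonpos_def by (auto simp: Inf_less_iff)
  define v where "v = rescale ((c / c')\<^sup>2) (c / c') u"
  have v: "v \<in> mass_sphere c"
    using dilation(1)[OF u(1), of "c / c'" "10/3"] c' by (simp add: v_def)
  have Ev: "energy (10/3) v < 0"
    unfolding v_def using u c' by (intro energy_dilation_neg[OF u(1)]) auto
  define e where "e = 1/(10/3) * lp_power (10/3) v - 1/2 * dirichlet v"
  have e: "e > 0" using Ev hartree_nonneg[of v] by (simp add: e_def energy_eq)
  have "min_energy (10/3) c \<le> ereal B" for B
  proof -
    define h where "h = 1/4 * hartree v"
    \<comment> \<open>Ensures e t \<ge> |B| + h, so the energy is at most - t |B|; with t \<ge> 1
      this is at most B.\<close>
    define t where "t = max 1 ((\<bar>B\<bar> + h) / e)"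
    have t: "t \<ge> 1" "(\<bar>B\<bar> + h) / e \<le> t" by (auto simp: t_def)
    have "\<bar>B\<bar> + h \<le> e * t" using t(2) e by (simp add: divide_le_eq mult.commute)
    then have "t * (\<bar>B\<bar> + h) \<le> t * (e * t)" using t(1) by (intro mult_left_mono) auto
    moreover have "1 * \<bar>B\<bar> \<le> t * \<bar>B\<bar>" using t(1) by (intro mult_right_mono) auto
    ultimately have "t * h - e * t\<^sup>2 \<le> B" by (simp add: distrib_left power2_eq_square mult_ac)
    moreover have "energy (10/3) (rescale (t powr (3/2)) t v) = t * h - e * t\<^sup>2"
      using mass_preserving_dilation(2)[OF v, of t "10/3"] t(1) by (simp add: e_def h_def algebra_simps)
    ultimately have "ereal (energy (10/3) (rescale (t powr (3/2)) t v)) \<le> ereal B" by simp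
    then show ?thesis
      using min_energy_lower[OF mass_preserving_dilation(1)[OF v, of t "10/3"], of "10/3"] t(1) order_trans by fastforce
  qed
  then show ?thesis by (rule ereal_bot)
qed

theorem theorem1p1:
  fixes p :: real
  assumes "p \<in> {3..10/3}"
  shows "(p \<in> {3<..<10/3} \<longrightarrow>
            0 < threshold_neg p \<and> threshold_neg p < \<infinity> \<and>
            (\<forall>c::real. 0 < c \<and> ereal c \<le> threshold_neg p \<longrightarrow> min_energy p c = 0) \<and>
            (\<forall>c::real. threshold_neg p < ereal c \<longrightarrow> min_energy p c < 0) \<and>
            strict_antimono_on {c::real. threshold_neg p < ereal c} (min_energy p))
       \<and> (p = 3 \<longrightarrow> (\<forall>c::real. 0 < c \<longrightarrow> min_energy p c = 0))
       \<and> (p = 10/3 \<longrightarrow>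
            0 < threshold_nonpos p \<and> threshold_nonpos p < \<infinity> \<and>
            (\<forall>c::real. 0 < c \<and> ereal c < threshold_nonpos p \<longrightarrow> min_energy p c = 0) \<and>
            (\<forall>c::real. threshold_nonpos p < ereal c \<longrightarrow> min_energy p c = -\<infinity>))"
proof (intro conjI impI allI)
  assume p: "p \<in> {3<..<10/3}"
  show "0 < threshold_neg p" using p by (intro threshold_neg_pos) auto
  show "threshold_neg p < \<infinity>" using p by (intro threshold_finite) auto
  show "min_energy p c = 0" if "0 < c \<and> ereal c \<le> threshold_neg p" for c
    using p that by (intro min_energy_zero_below_threshold) auto
  show "min_energy p c < 0" if "threshold_neg p < ereal c" for c
    using p that by (intro min_energy_neg_above_threshold) auto
  show "strict_antimono_on {c::real. threshold_neg p < ereal c} (min_energy p)"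
    using p by (intro monotone_onI) (auto intro: min_energy_strictly_decreasing)
next
  fix c :: real assume "p = 3" "0 < c"
  then show "min_energy p c = 0" using min_energy_cubic by simp
next
  assume p: "p = 10/3"
  show "0 < threshold_nonpos p" unfolding p by (rule threshold_nonpos_pos)
  show "threshold_nonpos p < \<infinity>" using p by (intro threshold_finite) auto
  show "min_energy p c = 0" if "0 < c \<and> ereal c < threshold_nonpos p" for c
    using that min_energy_critical_below unfolding p by blast
  show "min_energy p c = -\<infinity>" if "threshold_nonpos p < ereal c" for c
    using that min_energy_critical_above unfolding p by blast
qed

end
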